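(* Let $G$, $H$, and $K$ be finite groups, and let $R$ be a commutative ring such that $|H|$ is invertible in $R$. (a) For all $a\in R\mathscr{S}_{G\times H}$ and $b\in R\mathscr{S}_{H\times K}$ one has $$\zeta_{G,K}(a*_H^\kappa b)=\zeta_{G,H}(a)\ \tilde{*}_H^\kappa\ \zeta_{H,K}(b).$$ (b) If $|G|$ is invertible in $R$ then the map $\rho_{G,G}$ defines an isomorphism between the double Burnside $R$-algebra $RB(G,G)$ and the subring $$(R\mathscr{S}_{G\times G})^{G\times G}=\tilde{e}_G\ \tilde{*}_G^\kappa\ R\mathscr{S}_{G\times G}\ \tilde{*}_G^\kappa\ \tilde{e}_G$$ of $(R\mathscr{S}_{G\times G},\tilde{*}_G^\kappa)$, where $\tilde{e}_G:=\zeta_{G,G}(e_G)$ is an idempotent in $(R\mathscr{S}_{G\times G},\tilde{*}_G^\kappa)$.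
   Context: For a finite group $X$, $\mathscr{S}_X$ is the set of subgroups of $X$ and $R\mathscr{S}_X$ is the free $R$-module with basis $\mathscr{S}_X$. For $L\le G\times H$ put $k_1(L)=\{g\in G\mid (g,1)\in L\}$ and $k_2(L)=\{h\in H\mid(1,h)\in L\}$. For $L\le G\times H$ and $M\le H\times K$ put $L*M=\{(g,k)\in G\times K\mid \exists\,h\in H:\ (g,h)\in L,\ (h,k)\in M\}$ and, if $|H|$ is invertible in $R$, $\kappa(L,M)=\frac{|k_2(L)\cap k_1(M)|}{|H|}\in R$. Two $R$-bilinear maps $R\mathscr{S}_{G\times H}\times R\mathscr{S}_{H\times K}\to R\mathscr{S}_{G\times K}$ are defined on basis elements by $$L*_H^\kappa M=\kappa(L,M)\cdot(L*M),\qquad L\,\tilde{*}_H^\kappa\,M=\sum_{N\le G\times K}a_N^{L,M}\cdot N,$$ $$a_N^{L,M}:=\sum_{\substack{(L',M')\le(L,M)\\ N\le L'*M'}}\mu_{(L',M'),(L,M)}\cdot\kappa(L',M'),$$ where $\mu$ is the Möbius function of the poset $\mathscr{S}_{G\times H}\times\mathscr{S}_{H\times K}$ with $(L',M')\le(L,M)$ iff $L'\le L$ and $M'\le M$. (The Möbius function of a finite poset is given by $\mu_{x,y}=0$ if $x\not\le y$ and $\sum_{x\le z\le y}\mu_{x,z}=\delta_{x,y}$ if $x\le y$.) The $R$-linear map $\zeta_{G,H}\colon R\mathscr{S}_{G\times H}\to R\mathscr{S}_{G\times H}$ is given by $L\mapsto\sum_{L'\le L}L'$. A $(G,H)$-biset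 is a finite set with commuting left $G$- and right $H$-actions, identified with a left $G\times H$-set via $(g,h)x=gxh^{-1}$. $B(G,H)$ is the Grothendieck group of $(G,H)$-bisets with respect to disjoint unions and $RB(G,H)=R\otimes_{\mathbb{Z}}B(G,H)$; $RB(G,G)$ is an $R$-algebra with product $[X]\cdot_G[Y]=[X\times_GY]$, where $X\times_G Y$ is the biset of $G$-orbits of $X\times Y$ under $g(x,y)=(xg^{-1},gy)$. The map $\rho_{G,G}\colon RB(G,G)\to R\mathscr{S}_{G\times G}$ is the $R$-linear (mark) map $[X]\mapsto\sum_{U\le G\times G}|X^U|\cdot U$, $X^U$ being the $U$-fixed points. $(R\mathscr{S}_{G\times G})^{G\times G}$ denotes the fixed points under the conjugation action of $G\times G$ on $\mathscr{S}_{G\times G}$. Finally $\Delta_g(G)=\{(gxg^{-1},x)\mid x\in G\}$ and $e_G:=\sum_{g\in G}\Delta_g(G)\in R\mathscr{S}_{G\times G}$. *)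

theory Defs
  imports "HOL-Algebra.Module" "HOL-Algebra.QuotRing" "HOL-Algebra.Generated_Groups" "HOL-Algebra.Free_Abelian_Groups"
begin

text \<open>
  Coefficients come from a type of sort \<open>{comm_ring, comm_monoid_mult}\<close>: commutative rings with 1
  in which 1 = 0 is permitted (\<open>comm_ring_1\<close> would exclude the zero ring). The library's
  \<open>of_int\<close> and \<open>of_nat\<close> need a sort with 1 \<noteq> 0, hence the following replacement.
\<close>

definition rint :: "int \<Rightarrow> 'r::{comm_ring,comm_monoid_mult}" where
  "rint k = (if 0 \<le> k then (\<Sum>i<nat k. 1) else - (\<Sum>i<nat (- k). 1))"

abbreviation invertible_in_ring :: "'r::{comm_ring,comm_monoid_mult} \<Rightarrow> bool" where
  "invertible_in_ring x \<equiv> x dvd 1"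

definition ring_inv :: "'r::{comm_ring,comm_monoid_mult} \<Rightarrow> 'r" where
  "ring_inv x = (THE y. x * y = 1)"


section \<open>The free module on the subgroups of a finite group\<close>

definition subgroups_of :: "'x monoid \<Rightarrow> 'x set set" where
  "subgroups_of X = {L. subgroup L X}"

text \<open>
  An element of the free module is its coefficient function, which vanishes off the subgroups.
  For finite \<open>X\<close> there are finitely many subgroups, so no condition of finite support is needed.
\<close>

definition free_mod :: "'x monoid \<Rightarrow> ('x set \<Rightarrow> 'r::{comm_ring,comm_monoid_mult}) set" where
  "free_mod X = {a. \<forall>L. L \<notin> subgroups_of X \<longrightarrow> a L = 0}"

definition bas :: "'a \<Rightarrow> 'a \<Rightarrow> 'r::{comm_ring,comm_monoid_mult}" where
  "bas L = (\<lambda>N. if N = L then 1 else 0)"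

definition lin_ext ::
  "'a set \<Rightarrow> ('a \<Rightarrow> 'c \<Rightarrow> 'r) \<Rightarrow> ('a \<Rightarrow> 'r) \<Rightarrow> 'c \<Rightarrow> 'r::{comm_ring,comm_monoid_mult}" where
  "lin_ext S f a = (\<lambda>N. \<Sum>L\<in>S. a L * f L N)"

definition bilin_ext ::
  "'a set \<Rightarrow> 'b set \<Rightarrow> ('a \<Rightarrow> 'b \<Rightarrow> 'c \<Rightarrow> 'r) \<Rightarrow> ('a \<Rightarrow> 'r) \<Rightarrow> ('b \<Rightarrow> 'r)
    \<Rightarrow> 'c \<Rightarrow> 'r::{comm_ring,comm_monoid_mult}" where
  "bilin_ext S T f a b = (\<lambda>N. \<Sum>L\<in>S. \<Sum>M\<in>T. a L * b M * f L M N)"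

definition zeta ::
  "'x monoid \<Rightarrow> ('x set \<Rightarrow> 'r) \<Rightarrow> 'x set \<Rightarrow> 'r::{comm_ring,comm_monoid_mult}" where
  "zeta X = lin_ext (subgroups_of X)
     (\<lambda>L N. \<Sum>L' | L' \<in> subgroups_of X \<and> L' \<subseteq> L. bas L' N)"


section \<open>The two products\<close>

definition k1 :: "'g monoid \<Rightarrow> 'h monoid \<Rightarrow> ('g \<times> 'h) set \<Rightarrow> 'g set" where
  "k1 G H L = {g \<in> carrier G. (g, \<one>\<^bsub>H\<^esub>) \<in> L}"

definition k2 :: "'g monoid \<Rightarrow> 'h monoid \<Rightarrow> ('g \<times> 'h) set \<Rightarrow> 'h set" where
  "k2 G H L = {h \<in> carrier H. (\<one>\<^bsub>G\<^esub>, h) \<in> L}"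

definition kappa :: "'g monoid \<Rightarrow> 'h monoid \<Rightarrow> 'k monoid \<Rightarrow> ('g \<times> 'h) set \<Rightarrow> ('h \<times> 'k) set
    \<Rightarrow> 'r::{comm_ring,comm_monoid_mult}" where
  "kappa G H K L M =
     rint (int (card (k2 G H L \<inter> k1 H K M))) * ring_inv (rint (int (order H)))"

text \<open>The subgroup \<open>L * M\<close> is the relational composition \<open>L O M\<close>.\<close>

definition star :: "'g monoid \<Rightarrow> 'h monoid \<Rightarrow> 'k monoid \<Rightarrow> (('g \<times> 'h) set \<Rightarrow> 'r)
    \<Rightarrow> (('h \<times> 'k) set \<Rightarrow> 'r) \<Rightarrow> ('g \<times> 'k) set \<Rightarrow> 'r::{comm_ring,comm_monoid_mult}" where
  "star G H K = bilin_ext (subgroups_of (G \<times>\<times> H)) (subgroups_of (H \<times>\<times> K))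
     (\<lambda>L M N. kappa G H K L M * bas (L O M) N)"

text \<open>Here \<open>P\<close> is a finite set that is partially ordered by \<open>leq\<close>.\<close>

definition moebius :: "'a set \<Rightarrow> ('a \<Rightarrow> 'a \<Rightarrow> bool) \<Rightarrow> 'a \<Rightarrow> 'a \<Rightarrow> int" where
  "moebius P leq = (THE \<mu>.
     (\<forall>x y. \<not> (x \<in> P \<and> y \<in> P \<and> leq x y) \<longrightarrow> \<mu> x y = 0) \<and>
     (\<forall>x\<in>P. \<forall>y\<in>P. leq x y \<longrightarrow>
        (\<Sum>z | z \<in> P \<and> leq x z \<and> leq z y. \<mu> x z) = (if x = y then 1 else 0)))"

definition pair_le :: "'a set \<times> 'b set \<Rightarrow> 'a set \<times> 'b set \<Rightarrow> bool" where
  "pair_le p q \<longleftrightarrow> fst p \<subseteq> fst q \<and> snd p \<subseteq> snd q"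

definition coeff_a :: "'g monoid \<Rightarrow> 'h monoid \<Rightarrow> 'k monoid \<Rightarrow> ('g \<times> 'h) set \<Rightarrow> ('h \<times> 'k) set
    \<Rightarrow> ('g \<times> 'k) set \<Rightarrow> 'r::{comm_ring,comm_monoid_mult}" where
  "coeff_a G H K L M N =
     (let P = subgroups_of (G \<times>\<times> H) \<times> subgroups_of (H \<times>\<times> K) in
      \<Sum>(L', M') | (L', M') \<in> P \<and> pair_le (L', M') (L, M) \<and> N \<subseteq> L' O M'.
        rint (moebius P pair_le (L', M') (L, M)) * kappa G H K L' M')"

definition tstar :: "'g monoid \<Rightarrow> 'h monoid \<Rightarrow> 'k monoid \<Rightarrow> (('g \<times> 'h) set \<Rightarrow> 'r)
    \<Rightarrow> (('h \<times> 'k) set \<Rightarrow> 'r) \<Rightarrow> ('g \<times> 'k) set \<Rightarrow> 'r::{comm_ring,comm_monoid_mult}" where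
  "tstar G H K = bilin_ext (subgroups_of (G \<times>\<times> H)) (subgroups_of (H \<times>\<times> K))
     (\<lambda>L M N. \<Sum>N'\<in>subgroups_of (G \<times>\<times> K). coeff_a G H K L M N' * bas N' N)"


section \<open>The ring on \<open>G \<times> G\<close> and its fixed points\<close>

definition Delta :: "'g monoid \<Rightarrow> 'g \<Rightarrow> ('g \<times> 'g) set" where
  "Delta G g = {(g \<otimes>\<^bsub>G\<^esub> x \<otimes>\<^bsub>G\<^esub> inv\<^bsub>G\<^esub> g, x) | x. x \<in> carrier G}"

text \<open>
  The sum runs over group elements, so \<open>Delta G g\<close> occurs once for each element of the coset of \<open>g\<close>
  modulo the centre.
\<close>

definition e_elt :: "'g monoid \<Rightarrow> ('g \<times> 'g) set \<Rightarrow> 'r::{comm_ring,comm_monoid_mult}" where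
  "e_elt G = (\<lambda>N. \<Sum>g\<in>carrier G. bas (Delta G g) N)"

definition e_tilde :: "'g monoid \<Rightarrow> ('g \<times> 'g) set \<Rightarrow> 'r::{comm_ring,comm_monoid_mult}" where
  "e_tilde G = zeta (G \<times>\<times> G) (e_elt G)"

text \<open>
  The identity of the product \<open>star G G G\<close> is the diagonal subgroup multiplied by the order of
  \<open>G\<close>; its image under \<open>zeta\<close> is the identity of \<open>tstar G G G\<close>.
\<close>

definition ghost_algebra ::
  "'g monoid \<Rightarrow> ('r::{comm_ring,comm_monoid_mult}, ('g \<times> 'g) set \<Rightarrow> 'r) module" where
  "ghost_algebra G = \<lparr>
     carrier = free_mod (G \<times>\<times> G),
     monoid.mult = tstar G G G,
     one = zeta (G \<times>\<times> G) (\<lambda>N. rint (int (order G)) * bas (Delta G \<one>\<^bsub>G\<^esub>) N),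
     ring.zero = (\<lambda>N. 0),
     ring.add = (\<lambda>a b N. a N + b N),
     smult = (\<lambda>r a N. r * a N)\<rparr>"

definition conj_set :: "'x monoid \<Rightarrow> 'x \<Rightarrow> 'x set \<Rightarrow> 'x set" where
  "conj_set X x L = (\<lambda>l. x \<otimes>\<^bsub>X\<^esub> l \<otimes>\<^bsub>X\<^esub> inv\<^bsub>X\<^esub> x) ` L"

definition conj_fixed :: "'x monoid \<Rightarrow> ('x set \<Rightarrow> 'r::{comm_ring,comm_monoid_mult}) set" where
  "conj_fixed X = {a \<in> free_mod X. \<forall>x\<in>carrier X.
     lin_ext (subgroups_of X) (\<lambda>L. bas (conj_set X x L)) a = a}"

text \<open>The library's \<open>subring\<close> requires the identity of the large ring to lie in the subring.\<close>

definition nonunital_subring :: "'a set \<Rightarrow> ('a, 'm) ring_scheme \<Rightarrow> bool" where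
  "nonunital_subring S A \<longleftrightarrow>
     subgroup S (add_monoid A) \<and> (\<forall>x\<in>S. \<forall>y\<in>S. x \<otimes>\<^bsub>A\<^esub> y \<in> S)"


section \<open>Bisets\<close>

record ('x, 'g, 'h) biset =
  points :: "'x set"
  lact :: "'g \<Rightarrow> 'x \<Rightarrow> 'x"
  ract :: "'x \<Rightarrow> 'h \<Rightarrow> 'x"

definition is_biset :: "'g monoid \<Rightarrow> 'h monoid \<Rightarrow> ('x, 'g, 'h) biset \<Rightarrow> bool" where
  "is_biset G H X \<longleftrightarrow> finite (points X) \<and>
     (\<forall>g\<in>carrier G. \<forall>x\<in>points X. lact X g x \<in> points X) \<and>
     (\<forall>x\<in>points X. lact X \<one>\<^bsub>G\<^esub> x = x) \<and>
     (\<forall>g\<in>carrier G. \<forall>g'\<in>carrier G. \<forall>x\<in>points X.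
        lact X (g \<otimes>\<^bsub>G\<^esub> g') x = lact X g (lact X g' x)) \<and>
     (\<forall>h\<in>carrier H. \<forall>x\<in>points X. ract X x h \<in> points X) \<and>
     (\<forall>x\<in>points X. ract X x \<one>\<^bsub>H\<^esub> = x) \<and>
     (\<forall>h\<in>carrier H. \<forall>h'\<in>carrier H. \<forall>x\<in>points X.
        ract X x (h \<otimes>\<^bsub>H\<^esub> h') = ract X (ract X x h) h') \<and>
     (\<forall>g\<in>carrier G. \<forall>h\<in>carrier H. \<forall>x\<in>points X.
        ract X (lact X g x) h = lact X g (ract X x h))"

definition biset_iso ::
  "'g monoid \<Rightarrow> 'h monoid \<Rightarrow> ('x, 'g, 'h) biset \<Rightarrow> ('y, 'g, 'h) biset \<Rightarrow> bool" where
  "biset_iso G H X Y \<longleftrightarrow> (\<exists>f. bij_betw f (points X) (points Y) \<and>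
     (\<forall>g\<in>carrier G. \<forall>x\<in>points X. f (lact X g x) = lact Y g (f x)) \<and>
     (\<forall>h\<in>carrier H. \<forall>x\<in>points X. f (ract X x h) = ract Y (f x) h))"

definition biset_sum ::
  "('x, 'g, 'h) biset \<Rightarrow> ('y, 'g, 'h) biset \<Rightarrow> ('x + 'y, 'g, 'h) biset" where
  "biset_sum X Y = \<lparr>
     points = Sum_Type.Plus (points X) (points Y),
     lact = (\<lambda>g. map_sum (lact X g) (lact Y g)),
     ract = (\<lambda>z h. map_sum (\<lambda>x. ract X x h) (\<lambda>y. ract Y y h) z)\<rparr>"

definition biset_tensor :: "'h monoid \<Rightarrow> ('x, 'g, 'h) biset \<Rightarrow> ('y, 'h, 'k) biset
    \<Rightarrow> (('x \<times> 'y) set, 'g, 'k) biset" where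
  "biset_tensor H X Y = \<lparr>
     points = {{(ract X x (inv\<^bsub>H\<^esub> h), lact Y h y) | h. h \<in> carrier H} | x y.
                 x \<in> points X \<and> y \<in> points Y},
     lact = (\<lambda>g Q. (\<lambda>(x, y). (lact X g x, y)) ` Q),
     ract = (\<lambda>Q k. (\<lambda>(x, y). (x, ract Y y k)) ` Q)\<rparr>"

definition regular_biset :: "'g monoid \<Rightarrow> ('g, 'g, 'g) biset" where
  "regular_biset G = \<lparr>points = carrier G, lact = (\<otimes>\<^bsub>G\<^esub>), ract = (\<otimes>\<^bsub>G\<^esub>)\<rparr>"

definition fixed_points ::
  "'h monoid \<Rightarrow> ('x, 'g, 'h) biset \<Rightarrow> ('g \<times> 'h) set \<Rightarrow> 'x set" where
  "fixed_points H X U = {x \<in> points X. \<forall>(g, h)\<in>U. lact X g (ract X x (inv\<^bsub>H\<^esub> h)) = x}"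


section \<open>The double Burnside algebra\<close>

text \<open>
  The isomorphism class of a biset (of any point type) is represented by the set of all
  isomorphic bisets whose points are natural numbers; as bisets are finite, this set is nonempty.
\<close>

type_synonym ('g, 'h) iso_class = "(nat, 'g, 'h) biset set"

definition iso_class_of ::
  "'g monoid \<Rightarrow> 'h monoid \<Rightarrow> ('x, 'g, 'h) biset \<Rightarrow> ('g, 'h) iso_class" where
  "iso_class_of G H X = {Y. is_biset G H Y \<and> biset_iso G H X Y}"

definition iso_classes :: "'g monoid \<Rightarrow> 'h monoid \<Rightarrow> ('g, 'h) iso_class set" where
  "iso_classes G H = {iso_class_of G H X | X :: (nat, 'g, 'h) biset. is_biset G H X}"

text \<open>
  Free abelian groups and their quotients are written multiplicatively in the library: the
  operation \<open>mult\<close> of \<open>burnside_group\<close> and \<open>tensor_int\<close> below is the addition.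
\<close>

type_synonym ('g, 'h) burnside_elt = "(('g, 'h) iso_class \<Rightarrow>\<^sub>0 int) set"

definition burnside_rels :: "'g monoid \<Rightarrow> 'h monoid \<Rightarrow> (('g, 'h) iso_class \<Rightarrow>\<^sub>0 int) set" where
  "burnside_rels G H = generate (free_Abelian_group (iso_classes G H))
     {frag_of (iso_class_of G H (biset_sum X Y))
        - frag_of (iso_class_of G H X) - frag_of (iso_class_of G H Y)
      | (X :: (nat, 'g, 'h) biset) (Y :: (nat, 'g, 'h) biset). is_biset G H X \<and> is_biset G H Y}"

definition burnside_group :: "'g monoid \<Rightarrow> 'h monoid \<Rightarrow> ('g, 'h) burnside_elt monoid" where
  "burnside_group G H = free_Abelian_group (iso_classes G H) Mod burnside_rels G H"

definition burnside_coset ::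
  "'g monoid \<Rightarrow> 'h monoid \<Rightarrow> (('g, 'h) iso_class \<Rightarrow>\<^sub>0 int) \<Rightarrow> ('g, 'h) burnside_elt" where
  "burnside_coset G H p = burnside_rels G H #>\<^bsub>free_Abelian_group (iso_classes G H)\<^esub> p"

definition biset_class ::
  "'g monoid \<Rightarrow> 'h monoid \<Rightarrow> ('x, 'g, 'h) biset \<Rightarrow> ('g, 'h) burnside_elt" where
  "biset_class G H X = burnside_coset G H (frag_of (iso_class_of G H X))"

definition frag_bilin ::
  "('a \<Rightarrow> 'b \<Rightarrow> 'c \<Rightarrow>\<^sub>0 int) \<Rightarrow> ('a \<Rightarrow>\<^sub>0 int) \<Rightarrow> ('b \<Rightarrow>\<^sub>0 int) \<Rightarrow> ('c \<Rightarrow>\<^sub>0 int)" where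
  "frag_bilin f p q = frag_extend (\<lambda>x. frag_extend (f x) q) p"

text \<open>
  Operations on classes are unions over all representatives, in the manner of
  \<open>rcoset_mult\<close> in the library's construction of quotient rings.
\<close>

definition iso_class_mult ::
  "'g monoid \<Rightarrow> ('g, 'g) iso_class \<Rightarrow> ('g, 'g) iso_class \<Rightarrow> ('g, 'g) iso_class" where
  "iso_class_mult G C D = (\<Union>X\<in>C. \<Union>Y\<in>D. iso_class_of G G (biset_tensor G X Y))"

definition burnside_mult ::
  "'g monoid \<Rightarrow> ('g, 'g) burnside_elt \<Rightarrow> ('g, 'g) burnside_elt \<Rightarrow> ('g, 'g) burnside_elt" where
  "burnside_mult G A B = (\<Union>p\<in>A. \<Union>q\<in>B.
     burnside_coset G G (frag_bilin (\<lambda>C D. frag_of (iso_class_mult G C D)) p q))"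

text \<open>
  The tensor product over the integers of the additive group of the coefficient ring with an
  abelian group \<open>A\<close>. Over the integers, biadditivity already makes the tensor balanced.
\<close>

definition tensor_rels ::
  "('b, 'm) monoid_scheme \<Rightarrow> (('r::{comm_ring,comm_monoid_mult} \<times> 'b) \<Rightarrow>\<^sub>0 int) set" where
  "tensor_rels A = generate (free_Abelian_group (UNIV \<times> carrier A))
     ({frag_of (r + s, x) - frag_of (r, x) - frag_of (s, x) | r s x. x \<in> carrier A} \<union>
      {frag_of (r, x \<otimes>\<^bsub>A\<^esub> y) - frag_of (r, x) - frag_of (r, y) | r x y.
         x \<in> carrier A \<and> y \<in> carrier A})"

definition tensor_int :: "('b, 'm) monoid_scheme
    \<Rightarrow> (('r::{comm_ring,comm_monoid_mult} \<times> 'b) \<Rightarrow>\<^sub>0 int) set monoid" where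
  "tensor_int A = free_Abelian_group (UNIV \<times> carrier A) Mod tensor_rels A"

definition tensor_coset :: "('b, 'm) monoid_scheme
    \<Rightarrow> (('r::{comm_ring,comm_monoid_mult} \<times> 'b) \<Rightarrow>\<^sub>0 int) \<Rightarrow> (('r \<times> 'b) \<Rightarrow>\<^sub>0 int) set" where
  "tensor_coset A t = tensor_rels A #>\<^bsub>free_Abelian_group (UNIV \<times> carrier A)\<^esub> t"

type_synonym ('r, 'g, 'h) rburnside_elt = "(('r \<times> ('g, 'h) burnside_elt) \<Rightarrow>\<^sub>0 int) set"

definition double_burnside_algebra ::
  "'g monoid \<Rightarrow> ('r::{comm_ring,comm_monoid_mult}, ('r, 'g, 'g) rburnside_elt) module" where
  "double_burnside_algebra G =
     (let B = burnside_group G G; T = tensor_int B in \<lparr>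
       carrier = carrier T,
       monoid.mult = (\<lambda>A C. \<Union>s\<in>A. \<Union>t\<in>C. tensor_coset B
         (frag_bilin (\<lambda>(r, x) (r', x'). frag_of (r * r', burnside_mult G x x')) s t)),
       one = tensor_coset B (frag_of (1, biset_class G G (regular_biset G))),
       ring.zero = \<one>\<^bsub>T\<^esub>,
       ring.add = monoid.mult T,
       smult = (\<lambda>r A. \<Union>s\<in>A. tensor_coset B
         (frag_extend (\<lambda>(r', x). frag_of (r * r', x)) s))\<rparr>)"


section \<open>The mark map\<close>

text \<open>
  The number of fixed points depends only on the isomorphism class, and it extends linearly, first
  to the Grothendieck group and then to the tensor product. At each stage \<open>the_elem\<close> picks the
  common value at all representatives of a class.
\<close>

definition iso_class_mark :: "'h monoid \<Rightarrow> ('g \<times> 'h) set \<Rightarrow> ('g, 'h) iso_class \<Rightarrow> int" where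
  "iso_class_mark H U C = the_elem ((\<lambda>X. int (card (fixed_points H X U))) ` C)"

definition burnside_mark :: "'h monoid \<Rightarrow> ('g \<times> 'h) set \<Rightarrow> ('g, 'h) burnside_elt \<Rightarrow> int" where
  "burnside_mark H U A = the_elem
     ((\<lambda>p. \<Sum>C\<in>Poly_Mapping.keys p. Poly_Mapping.lookup p C * iso_class_mark H U C) ` A)"

definition rho :: "'g monoid \<Rightarrow> 'h monoid \<Rightarrow> ('r, 'g, 'h) rburnside_elt
    \<Rightarrow> ('g \<times> 'h) set \<Rightarrow> 'r::{comm_ring,comm_monoid_mult}" where
  "rho G H A = (\<lambda>N. \<Sum>U\<in>subgroups_of (G \<times>\<times> H). the_elem
     ((\<lambda>t. \<Sum>(r, x)\<in>Poly_Mapping.keys t.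
        rint (Poly_Mapping.lookup t (r, x)) * (r * rint (burnside_mark H U x))) ` A) * bas U N)"

end

theory Submission
  imports Defs
begin

text \<open>
  The proof reads everything off from stabilizers. For a finite biset \<open>X\<close> let \<open>\<alpha>(X)\<close> be the formal sum of
  the stabilizers of its points, so that the coefficient of \<open>U\<close> counts the points with stabilizer \<open>U\<close>.
  A point is fixed by \<open>U\<close> iff its stabilizer contains \<open>U\<close>; hence the mark map is \<open>\<zeta> \<circ> \<alpha>\<close>. In
  the tensor product of \<open>X\<close> and \<open>Y\<close> over \<open>H\<close> the class of \<open>(x, y)\<close> has stabilizer
  \<open>stab x * stab y\<close>, and it consists of \<open>|H| / |k\<^sub>2(stab x) \<inter> k\<^sub>1(stab y)|\<close> pairs. The factor
  \<open>\<kappa>\<close> is the reciprocal of this number. It corrects for summing over pairs instead of classes, and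
  therefore \<open>\<alpha>\<close> is multiplicative for the product \<open>star\<close> (\<open>star_count_elt\<close>).

  Part (a) carries this over to the mark map. After an exchange of summations it is the defining
  equation of the Moebius function (\<open>coeff_a_interval_sum\<close>). As \<open>\<zeta>\<close> is given by a triangular matrix,
  it is bijective, and the ghost ring is a copy of the free module with the product \<open>star\<close>.
  The latter is associative because \<open>\<kappa>(L, M) \<kappa>(L * M, N)\<close> and \<open>\<kappa>(L, M * N) \<kappa>(M, N)\<close> count the same
  group, once by a projection to each side (\<open>card_kernels_relcomp\<close>). Composing with \<open>\<Delta>\<^sub>g(G)\<close>
  conjugates one coordinate, so multiplying by \<open>e\<^sub>G\<close> on both sides averages over all conjugations
  (\<open>star_e_e_eq_average\<close>), which makes the corner ring of \<open>e\<^sub>G\<close> the ring of fixed points.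

  Finite sets with a group action are isomorphic iff they have the same number of points for each
  stabilizer (\<open>stab_count_eq_imp_isomorphic\<close>). So all relations between bisets that the
  double Burnside algebra rests on, from the compatibility of the tensor product with isomorphisms to
  its additivity, become identities between numbers.

  If \<open>|G|\<close> is invertible, the inverse of \<open>\<alpha>\<close> can be written down: it maps \<open>c\<close> to the sum of
  \<open>c(U) |U| / |G|\<^sup>2\<close> times the class of \<open>(G \<times> G) / U\<close> (\<open>theta\<close>). On an orbit this
  reproduces the class of the orbit because the orders of the stabilizers of its points add up to
  \<open>|G|\<^sup>2\<close> (\<open>tens_transitive_eq_theta\<close>), and on a fixed element \<open>c\<close> it yields the average of
  the conjugates of \<open>c\<close>, that is, \<open>c\<close> itself (\<open>rho_theta\<close>). Associativity and the unit laws of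
  the double Burnside algebra are then inherited from the ghost ring.
\<close>

section \<open>Integers and inverses in the coefficient ring\<close>

lemma rint_0 [simp]: "rint 0 = 0"
  by (simp add: rint_def)

lemma rint_1 [simp]: "rint 1 = 1"
  by (simp add: rint_def)

lemma rint_int: "rint (int n) = (\<Sum>i<n. 1)"
  by (simp add: rint_def)

lemma sum_ones_add: "(\<Sum>i<(m::nat) + n. 1::'r::{comm_ring,comm_monoid_mult}) = (\<Sum>i<m. 1) + (\<Sum>i<n. 1)"
  by (induction n) (simp_all add: algebra_simps)

lemma rint_diff_int: "(rint (int m - int n) :: 'r::{comm_ring,comm_monoid_mult}) = rint (int m) - rint (int n)"
proof (cases "n \<le> m")
  case True
  then obtain k where "m = k + n" by (metis le_add_diff_inverse2)
  then show ?thesis by (simp add: rint_def sum_ones_add nat_add_distrib)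
next
  case False
  then obtain k where k: "n = k + m" "k > 0" by (metis le_add_diff_inverse2 less_imp_le not_le zero_less_diff add_diff_cancel_right')
  then show ?thesis by (simp add: rint_def sum_ones_add nat_add_distrib)
qed

lemma rint_add: "(rint (a + b) :: 'r::{comm_ring,comm_monoid_mult}) = rint a + rint b"
proof -
  obtain m n where a: "a = int m - int n" by (cases a rule: int_diff_cases)
  obtain p q where b: "b = int p - int q" by (cases b rule: int_diff_cases)
  have "a + b = int (m + p) - int (n + q)" by (simp add: a b)
  then show ?thesis unfolding a b
    by (simp only: rint_diff_int) (simp only: rint_int sum_ones_add, simp)
qed

lemma rint_minus: "(rint (- a) :: 'r::{comm_ring,comm_monoid_mult}) = - rint a"
  using rint_add[of a "- a"] by (simp add: eq_neg_iff_add_eq_0 add.commute)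

lemma rint_diff: "(rint (a - b) :: 'r::{comm_ring,comm_monoid_mult}) = rint a - rint b"
  using rint_add[of a "- b"] by (simp add: rint_minus)

lemma rint_mult: "(rint (a * b) :: 'r::{comm_ring,comm_monoid_mult}) = rint a * rint b"
proof (induction a rule: int_induct[where k = 0])
  case (step1 i)
  then show ?case by (simp add: distrib_right rint_add)
next
  case (step2 i)
  then show ?case by (simp add: left_diff_distrib rint_diff)
qed simp

lemma rint_sum: "(rint (sum f A) :: 'r::{comm_ring,comm_monoid_mult}) = (\<Sum>x\<in>A. rint (f x))"
  by (induction A rule: infinite_finite_induct) (simp_all add: rint_add)

lemma rint_sum_nat:
  "(rint (int (sum f A)) :: 'r::{comm_ring,comm_monoid_mult}) = (\<Sum>x\<in>A. rint (int (f x)))"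
  by (simp add: rint_sum of_nat_sum)

lemma ring_inv_right:
  fixes x :: "'r::{comm_ring,comm_monoid_mult}"
  assumes "invertible_in_ring x"
  shows "x * ring_inv x = 1"
proof -
  obtain y where y: "x * y = 1" using assms by (metis dvdE)
  have "z = y" if "x * z = 1" for z
    using y that by (metis mult.assoc mult.commute mult_1)
  then show ?thesis unfolding ring_inv_def using y by (metis (mono_tags, lifting) theI)
qed


section \<open>Triangular systems over a finite poset\<close>

definition finite_poset :: "'a set \<Rightarrow> ('a \<Rightarrow> 'a \<Rightarrow> bool) \<Rightarrow> bool" where
  "finite_poset P leq \<longleftrightarrow> finite P \<and> (\<forall>x\<in>P. leq x x) \<and>
     (\<forall>x\<in>P. \<forall>y\<in>P. leq x y \<longrightarrow> leq y x \<longrightarrow> x = y) \<and>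
     (\<forall>x\<in>P. \<forall>y\<in>P. \<forall>z\<in>P. leq x y \<longrightarrow> leq y z \<longrightarrow> leq x z)"

lemma finite_poset_finite: "finite_poset P leq \<Longrightarrow> finite P"
  unfolding finite_poset_def by (rule conjunct1)

lemma finite_poset_refl: "finite_poset P leq \<Longrightarrow> x \<in> P \<Longrightarrow> leq x x"
  unfolding finite_poset_def by metis

lemma finite_poset_antisym:
  "finite_poset P leq \<Longrightarrow> x \<in> P \<Longrightarrow> y \<in> P \<Longrightarrow> leq x y \<Longrightarrow> leq y x \<Longrightarrow> x = y"
  unfolding finite_poset_def by metis

lemma finite_poset_trans:
  "finite_poset P leq \<Longrightarrow> x \<in> P \<Longrightarrow> y \<in> P \<Longrightarrow> z \<in> P \<Longrightarrow> leq x y \<Longrightarrow> leq y z \<Longrightarrow> leq x z"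
  unfolding finite_poset_def by metis

lemma finite_poset_subset: "finite_poset P leq \<Longrightarrow> Q \<subseteq> P \<Longrightarrow> finite_poset Q leq"
  unfolding finite_poset_def by (meson finite_subset subsetD)

lemma finite_poset_has_minimal:
  assumes P: "finite_poset P leq" and ne: "P \<noteq> {}"
  shows "\<exists>m\<in>P. \<forall>x\<in>P. leq x m \<longrightarrow> x = m"
proof -
  let ?R = "\<lambda>x y. leq x y \<and> x \<noteq> y"
  have 1: "asymp_on P ?R" by (rule asymp_onI) (metis finite_poset_antisym[OF P])
  have 2: "transp_on P ?R"
    by (rule transp_onI) (metis finite_poset_antisym[OF P] finite_poset_trans[OF P])
  obtain m where "m \<in> P" "\<forall>x\<in>P. x \<noteq> m \<longrightarrow> \<not> ?R x m"
    using Finite_Set.bex_min_element[OF finite_poset_finite[OF P] 1 2 ne] by metis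
  then show ?thesis by metis
qed

lemma finite_poset_has_maximal:
  assumes P: "finite_poset P leq" and ne: "P \<noteq> {}"
  shows "\<exists>m\<in>P. \<forall>x\<in>P. leq m x \<longrightarrow> x = m"
proof -
  have "finite_poset P (\<lambda>x y. leq y x)" using P unfolding finite_poset_def by metis
  from finite_poset_has_minimal[OF this ne] show ?thesis .
qed

text \<open>
  Induction by removing a maximal element \<open>m\<close>: the unknown \<open>f m\<close> occurs in the equation for \<open>m\<close> only.
\<close>

lemma triangular_system_solvable:
  fixes g :: "'a \<Rightarrow> 'b::ab_group_add"
  assumes "finite_poset P leq"
  shows "\<exists>f. (\<forall>y. y \<notin> P \<longrightarrow> f y = 0) \<and> (\<forall>y\<in>P. (\<Sum>z | z \<in> P \<and> leq z y. f z) = g y)"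
  using assms
proof (induction "card P" arbitrary: P)
  case 0
  then have "P = {}" using finite_poset_finite by fastforce
  then show ?case by (intro exI[of _ "\<lambda>_. 0"]) simp
next
  case (Suc n)
  have fin: "finite P" using Suc.prems by (rule finite_poset_finite)
  have ne: "P \<noteq> {}" using Suc.hyps by auto
  obtain m where m: "m \<in> P" "\<And>x. x \<in> P \<Longrightarrow> leq m x \<Longrightarrow> x = m"
    using finite_poset_has_maximal[OF Suc.prems ne] by metis
  let ?Q = "P - {m}"
  have "n = card ?Q" using Suc.hyps fin m by simp
  moreover have "finite_poset ?Q leq" by (rule finite_poset_subset[OF Suc.prems]) auto
  ultimately have "\<exists>f. (\<forall>y. y \<notin> ?Q \<longrightarrow> f y = 0) \<and> (\<forall>y\<in>?Q. (\<Sum>z | z \<in> ?Q \<and> leq z y. f z) = g y)"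
    by (rule Suc.hyps(1))
  then obtain f where fQ: "(\<forall>y. y \<notin> ?Q \<longrightarrow> f y = 0) \<and>
      (\<forall>y\<in>?Q. (\<Sum>z | z \<in> ?Q \<and> leq z y. f z) = g y)" ..
  then have f0: "f y = 0" if "y \<notin> ?Q" for y using that by simp
  from fQ have f: "(\<Sum>z | z \<in> ?Q \<and> leq z y. f z) = g y" if "y \<in> ?Q" for y
    using that by simp
  let ?f = "f(m := g m - (\<Sum>z | z \<in> ?Q \<and> leq z m. f z))"
  have "(\<Sum>z | z \<in> P \<and> leq z y. ?f z) = g y" if y: "y \<in> P" for y
  proof (cases "y = m")
    case True
    have "{z. z \<in> P \<and> leq z m} = insert m {z. z \<in> ?Q \<and> leq z m}"
      using m finite_poset_refl[OF Suc.prems] by auto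
    moreover have "(\<Sum>z | z \<in> ?Q \<and> leq z m. ?f z) = (\<Sum>z | z \<in> ?Q \<and> leq z m. f z)"
      by (rule sum.cong) auto
    ultimately show ?thesis using True fin by simp
  next
    case False
    have "{z. z \<in> P \<and> leq z y} = {z. z \<in> ?Q \<and> leq z y}"
      using m y False by blast
    moreover have "(\<Sum>z | z \<in> ?Q \<and> leq z y. ?f z) = (\<Sum>z | z \<in> ?Q \<and> leq z y. f z)"
      by (rule sum.cong) auto
    ultimately show ?thesis using f y False by simp
  qed
  moreover have "\<forall>y. y \<notin> P \<longrightarrow> ?f y = 0" using f0 m by auto
  ultimately show ?case by blast
qed

text \<open>
  In the equation for a minimal element at which two solutions differ, all other terms agree.
\<close>

lemma triangular_system_unique:
  fixes f f' :: "'a \<Rightarrow> 'b::ab_group_add"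
  assumes P: "finite_poset P leq"
    and eq: "\<And>y. y \<in> P \<Longrightarrow> (\<Sum>z | z \<in> P \<and> leq z y. f z) = (\<Sum>z | z \<in> P \<and> leq z y. f' z)"
    and "y \<in> P"
  shows "f y = f' y"
proof (rule ccontr)
  assume "f y \<noteq> f' y"
  let ?D = "{z \<in> P. f z \<noteq> f' z}"
  have fin: "finite P" using P by (rule finite_poset_finite)
  have "?D \<noteq> {}" using \<open>y \<in> P\<close> \<open>f y \<noteq> f' y\<close> by blast
  have "finite_poset ?D leq" by (rule finite_poset_subset[OF P]) auto
  from finite_poset_has_minimal[OF this \<open>?D \<noteq> {}\<close>]
  obtain m where m: "m \<in> ?D" "\<And>x. x \<in> ?D \<Longrightarrow> leq x m \<Longrightarrow> x = m" by metis
  let ?B = "{z. z \<in> P \<and> leq z m \<and> z \<noteq> m}"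
  have "{z. z \<in> P \<and> leq z m} = insert m ?B" using m finite_poset_refl[OF P] by auto
  with eq[of m] m fin have "f m + sum f ?B = f' m + sum f' ?B" by simp
  moreover have "sum f ?B = sum f' ?B" using m by (intro sum.cong) auto
  ultimately show False using m by simp
qed

text \<open>
  For a fixed first argument \<open>x\<close> the defining equations of the Moebius function form a triangular
  system over the elements above \<open>x\<close>, so they have exactly one solution and the definite description
  in \<open>moebius\<close> denotes it.
\<close>

lemma moebius_sum:
  assumes P: "finite_poset P leq" and "x \<in> P" "y \<in> P" "leq x y"
  shows "(\<Sum>z | z \<in> P \<and> leq x z \<and> leq z y. moebius P leq x z) = (if x = y then 1 else 0)"
proof -
  let ?S = "\<lambda>\<mu>::'a \<Rightarrow> 'a \<Rightarrow> int. (\<forall>x y. \<not> (x \<in> P \<and> y \<in> P \<and> leq x y) \<longrightarrow> \<mu> x y = 0) \<and>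
     (\<forall>x\<in>P. \<forall>y\<in>P. leq x y \<longrightarrow>
        (\<Sum>z | z \<in> P \<and> leq x z \<and> leq z y. \<mu> x z) = (if x = y then 1 else 0))"
  define Up where "Up x = {z \<in> P. leq x z}" for x
  let ?row = "\<lambda>x (f::'a \<Rightarrow> int). (\<forall>y. y \<notin> Up x \<longrightarrow> f y = 0) \<and>
      (\<forall>y\<in>Up x. (\<Sum>z | z \<in> Up x \<and> leq z y. f z) = (if x = y then 1 else 0))"
  have up: "finite_poset (Up x) leq" for x
    by (rule finite_poset_subset[OF P]) (simp add: Up_def)
  have set_eq: "{z. z \<in> Up x \<and> leq z y} = {z. z \<in> P \<and> leq x z \<and> leq z y}" for x y
    by (auto simp: Up_def)
  have Up_iff: "y \<in> Up x \<longleftrightarrow> y \<in> P \<and> leq x y" for x y by (simp add: Up_def)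
  define \<nu> where "\<nu> x = (if x \<in> P then SOME f. ?row x f else (\<lambda>y. 0))" for x
  have row: "?row x (\<nu> x)" if "x \<in> P" for x
    using someI_ex[OF triangular_system_solvable[OF up[of x], of "\<lambda>y. if x = y then 1 else 0"]] that
    by (simp only: \<nu>_def if_True)
  have ex: "?S \<nu>"
  proof (intro conjI allI ballI impI)
    fix x y assume "\<not> (x \<in> P \<and> y \<in> P \<and> leq x y)"
    then show "\<nu> x y = 0" using row[of x] Up_iff[of y x] by (cases "x \<in> P") (auto simp: \<nu>_def)
  next
    fix x y assume "x \<in> P" "y \<in> P" "leq x y"
    then show "(\<Sum>z | z \<in> P \<and> leq x z \<and> leq z y. \<nu> x z) = (if x = y then 1 else 0)"
      using row[of x] Up_iff[of y x] by (simp only: set_eq[symmetric])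
  qed
  have "\<nu>' = \<nu>" if S: "?S \<nu>'" for \<nu>'
  proof (intro ext)
    fix x y show "\<nu>' x y = \<nu> x y"
    proof (cases "x \<in> P \<and> y \<in> P \<and> leq x y")
      case True
      show ?thesis
      proof (rule triangular_system_unique[OF up[of x]])
        fix y assume "y \<in> Up x"
        then show "(\<Sum>z | z \<in> Up x \<and> leq z y. \<nu>' x z) = (\<Sum>z | z \<in> Up x \<and> leq z y. \<nu> x z)"
          using S ex True Up_iff[of y x] by (simp only: set_eq)
      qed (use True Up_iff in auto)
    next
      case False
      then have "\<nu>' x y = 0" "\<nu> x y = 0" using S ex by auto
      then show ?thesis by simp
    qed
  qed
  with ex have "?S (THE \<mu>. ?S \<mu>)" by (rule theI)
  then have "?S (moebius P leq)" by (simp only: moebius_def)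
  then show ?thesis using assms(2-4) by auto
qed


section \<open>The zeta transform intertwines the two products\<close>

lemma subgroups_of_iff [simp]: "L \<in> subgroups_of X \<longleftrightarrow> subgroup L X"
  by (simp add: subgroups_of_def)

lemma finite_subgroups_of: "finite (carrier X) \<Longrightarrow> finite (subgroups_of X)"
  by (rule finite_subset[of _ "Pow (carrier X)"]) (auto simp: subgroups_of_def dest: subgroup.subset)

lemma free_mod_zero: "a \<in> free_mod X \<Longrightarrow> \<not> subgroup L X \<Longrightarrow> a L = 0"
  by (simp add: free_mod_def)

lemma zeta_apply:
  fixes a :: "'x set \<Rightarrow> 'r::{comm_ring,comm_monoid_mult}"
  assumes "finite (carrier X)"
  shows "zeta X a N = (if subgroup N X then \<Sum>L | L \<in> subgroups_of X \<and> N \<subseteq> L. a L else 0)"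
proof -
  note fin = finite_subgroups_of[OF assms]
  have "(\<Sum>L' | L' \<in> subgroups_of X \<and> L' \<subseteq> L. bas L' N)
      = (if subgroup N X \<and> N \<subseteq> L then 1 else 0 :: 'r)" for L
  proof -
    have "finite {L'. L' \<in> subgroups_of X \<and> L' \<subseteq> L}"
      by (rule finite_subset[OF _ fin]) auto
    then show ?thesis by (simp add: bas_def sum.delta sum.delta')
  qed
  then have "zeta X a N = (\<Sum>L\<in>subgroups_of X. if subgroup N X \<and> N \<subseteq> L then a L else 0)"
    unfolding zeta_def lin_ext_def by (intro sum.cong) auto
  also have "\<dots> = (if subgroup N X then \<Sum>L | L \<in> subgroups_of X \<and> N \<subseteq> L. a L else 0)"
    using fin by (simp add: sum.inter_filter[symmetric])
  finally show ?thesis .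
qed

lemma zeta_in_free_mod: "finite (carrier X) \<Longrightarrow> zeta X a \<in> free_mod X"
  by (simp add: free_mod_def zeta_apply)

lemma zeta_add:
  fixes a b :: "'x set \<Rightarrow> 'r::{comm_ring,comm_monoid_mult}"
  shows "zeta X (\<lambda>N. a N + b N) = (\<lambda>N. zeta X a N + zeta X b N)"
  by (simp add: zeta_def lin_ext_def distrib_right sum.distrib)

lemma zeta_smult:
  fixes a :: "'x set \<Rightarrow> 'r::{comm_ring,comm_monoid_mult}"
  shows "zeta X (\<lambda>N. r * a N) = (\<lambda>N. r * zeta X a N)"
  by (simp add: zeta_def lin_ext_def sum_distrib_left mult.assoc)

text \<open>
  By \<open>zeta_apply\<close> the coefficient at \<open>N\<close> of the transform is a sum over the subgroups above \<open>N\<close>, so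
  inverting \<open>zeta\<close> means solving a triangular system for reverse inclusion.
\<close>

lemma zeta_surj:
  fixes b :: "'x set \<Rightarrow> 'r::{comm_ring,comm_monoid_mult}"
  assumes fin: "finite (carrier X)" and b: "b \<in> free_mod X"
  obtains a where "a \<in> free_mod X" "zeta X a = b"
proof -
  have P: "finite_poset (subgroups_of X) (\<lambda>L M. M \<subseteq> L)"
    using finite_subgroups_of[OF fin] by (auto simp: finite_poset_def)
  from triangular_system_solvable[OF P, of b]
  obtain a where aS: "(\<forall>L. L \<notin> subgroups_of X \<longrightarrow> a L = 0) \<and>
    (\<forall>N\<in>subgroups_of X. (\<Sum>L | L \<in> subgroups_of X \<and> N \<subseteq> L. a L) = b N)" ..
  then have "a \<in> free_mod X" by (simp add: free_mod_def)
  moreover have "zeta X a = b"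
    using aS b fin by (intro ext) (auto simp: zeta_apply free_mod_def)
  ultimately show ?thesis using that by blast
qed

lemma zeta_inj:
  fixes a b :: "'x set \<Rightarrow> 'r::{comm_ring,comm_monoid_mult}"
  assumes fin: "finite (carrier X)" and "a \<in> free_mod X" "b \<in> free_mod X"
    and eq: "zeta X a = zeta X b"
  shows "a = b"
proof
  fix L
  have P: "finite_poset (subgroups_of X) (\<lambda>L M. M \<subseteq> L)"
    using finite_subgroups_of[OF fin] by (auto simp: finite_poset_def)
  show "a L = b L"
  proof (cases "subgroup L X")
    case True
    show ?thesis
    proof (rule triangular_system_unique[OF P])
      fix N assume "N \<in> subgroups_of X"
      then show "(\<Sum>L | L \<in> subgroups_of X \<and> N \<subseteq> L. a L) = (\<Sum>L | L \<in> subgroups_of X \<and> N \<subseteq> L. b L)"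
        using fun_cong[OF eq, of N] fin by (simp add: zeta_apply)
    qed (use True in simp)
  qed (use assms in \<open>simp add: free_mod_zero\<close>)
qed

lemma finite_carrier_DirProd:
  "finite (carrier G) \<Longrightarrow> finite (carrier H) \<Longrightarrow> finite (carrier (G \<times>\<times> H))"
  by (simp add: DirProd_def)

lemma DirProd_subgroupD:
  assumes "group G" "group H" "subgroup L (G \<times>\<times> H)"
  shows "(\<one>\<^bsub>G\<^esub>, \<one>\<^bsub>H\<^esub>) \<in> L"
    and "(g, h) \<in> L \<Longrightarrow> g \<in> carrier G" and "(g, h) \<in> L \<Longrightarrow> h \<in> carrier H"
    and "(g, h) \<in> L \<Longrightarrow> (g', h') \<in> L \<Longrightarrow> (g \<otimes>\<^bsub>G\<^esub> g', h \<otimes>\<^bsub>H\<^esub> h') \<in> L"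
    and "(g, h) \<in> L \<Longrightarrow> (inv\<^bsub>G\<^esub> g, inv\<^bsub>H\<^esub> h) \<in> L"
proof -
  interpret L: subgroup L "G \<times>\<times> H" by fact
  show "(\<one>\<^bsub>G\<^esub>, \<one>\<^bsub>H\<^esub>) \<in> L" using L.one_closed by simp
  show c: "g \<in> carrier G" "h \<in> carrier H" if "(g, h) \<in> L" for g h
    using subsetD[OF L.subset that] by simp_all
  show "(g, h) \<in> L \<Longrightarrow> (g', h') \<in> L \<Longrightarrow> (g \<otimes>\<^bsub>G\<^esub> g', h \<otimes>\<^bsub>H\<^esub> h') \<in> L"
    using L.m_closed[of "(g, h)" "(g', h')"] by simp
  show "(g, h) \<in> L \<Longrightarrow> (inv\<^bsub>G\<^esub> g, inv\<^bsub>H\<^esub> h) \<in> L"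
    using L.m_inv_closed[of "(g, h)"] c[of g h] assms(1,2) by simp
qed

lemma DirProd_subgroupI:
  assumes G: "group G" and H: "group H"
    and "\<And>g h. (g, h) \<in> L \<Longrightarrow> g \<in> carrier G \<and> h \<in> carrier H"
    and "(\<one>\<^bsub>G\<^esub>, \<one>\<^bsub>H\<^esub>) \<in> L"
    and "\<And>g h. (g, h) \<in> L \<Longrightarrow> (inv\<^bsub>G\<^esub> g, inv\<^bsub>H\<^esub> h) \<in> L"
    and "\<And>g h g' h'. (g, h) \<in> L \<Longrightarrow> (g', h') \<in> L \<Longrightarrow> (g \<otimes>\<^bsub>G\<^esub> g', h \<otimes>\<^bsub>H\<^esub> h') \<in> L"
  shows "subgroup L (G \<times>\<times> H)"
proof (rule group.subgroupI[OF DirProd_group[OF G H]])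
  show "L \<subseteq> carrier (G \<times>\<times> H)" using assms(3) by auto
  show "L \<noteq> {}" using assms(4) by blast
  show "inv\<^bsub>G \<times>\<times> H\<^esub> p \<in> L" if "p \<in> L" for p
    using that assms(3,5) by (cases p) (simp add: G H)
  show "p \<otimes>\<^bsub>G \<times>\<times> H\<^esub> q \<in> L" if "p \<in> L" "q \<in> L" for p q
    using that assms(6) by (cases p; cases q) simp
qed

lemma relcomp_subgroup:
  assumes G: "group G" and H: "group H" and K: "group K"
    and L: "subgroup L (G \<times>\<times> H)" and M: "subgroup M (H \<times>\<times> K)"
  shows "subgroup (L O M) (G \<times>\<times> K)"
proof -
  note l = DirProd_subgroupD[OF G H L] and m = DirProd_subgroupD[OF H K M]
  show ?thesis
  proof (rule DirProd_subgroupI[OF G K])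
    show "(\<one>\<^bsub>G\<^esub>, \<one>\<^bsub>K\<^esub>) \<in> L O M" using l(1) m(1) by (rule relcompI)
  next
    fix g k assume "(g, k) \<in> L O M"
    then obtain h where h: "(g, h) \<in> L" "(h, k) \<in> M" by blast
    show "g \<in> carrier G \<and> k \<in> carrier K" using l(2)[OF h(1)] m(3)[OF h(2)] by simp
    show "(inv\<^bsub>G\<^esub> g, inv\<^bsub>K\<^esub> k) \<in> L O M" using l(5)[OF h(1)] m(5)[OF h(2)] by (rule relcompI)
    fix g' k' assume "(g', k') \<in> L O M"
    then obtain h' where h': "(g', h') \<in> L" "(h', k') \<in> M" by blast
    show "(g \<otimes>\<^bsub>G\<^esub> g', k \<otimes>\<^bsub>K\<^esub> k') \<in> L O M"
      using l(4)[OF h(1) h'(1)] m(4)[OF h(2) h'(2)] by (rule relcompI)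
  qed
qed

text \<open>
  Summing a product against a weight \<open>w\<close> eliminates the basis functions from its definition. With
  the indicator of the subgroups above \<open>N\<close> as weight it yields the transform of a product, and with
  the coefficients of another product it yields products of three factors.
\<close>

lemma star_weighted_sum:
  fixes a :: "('g \<times> 'h) set \<Rightarrow> 'r::{comm_ring,comm_monoid_mult}" and b :: "('h \<times> 'k) set \<Rightarrow> 'r"
  assumes grp: "group G" "group H" "group K"
    and fin: "finite (carrier G)" "finite (carrier K)"
  shows "(\<Sum>Q\<in>subgroups_of (G \<times>\<times> K). star G H K a b Q * w Q) =
    (\<Sum>L\<in>subgroups_of (G \<times>\<times> H). \<Sum>M\<in>subgroups_of (H \<times>\<times> K). a L * b M * (kappa G H K L M * w (L O M)))"
proof -
  let ?S = "subgroups_of (G \<times>\<times> H)" and ?T = "subgroups_of (H \<times>\<times> K)" and ?U = "subgroups_of (G \<times>\<times> K)"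
  note finU = finite_subgroups_of[OF finite_carrier_DirProd[OF fin]]
  have "(\<Sum>Q\<in>?U. star G H K a b Q * w Q) =
    (\<Sum>Q\<in>?U. \<Sum>L\<in>?S. \<Sum>M\<in>?T. a L * b M * (kappa G H K L M * bas (L O M) Q) * w Q)"
    by (simp add: star_def bilin_ext_def sum_distrib_right)
  also have "\<dots> = (\<Sum>L\<in>?S. \<Sum>Q\<in>?U. \<Sum>M\<in>?T. a L * b M * (kappa G H K L M * bas (L O M) Q) * w Q)"
    by (rule sum.swap)
  also have "\<dots> = (\<Sum>L\<in>?S. \<Sum>M\<in>?T. \<Sum>Q\<in>?U. a L * b M * (kappa G H K L M * bas (L O M) Q) * w Q)"
    by (rule sum.cong[OF refl], rule sum.swap)
  also have "\<dots> = (\<Sum>L\<in>?S. \<Sum>M\<in>?T. a L * b M * (kappa G H K L M * w (L O M)))"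
  proof (intro sum.cong refl)
    fix L M assume "L \<in> ?S" "M \<in> ?T"
    then have LM: "L O M \<in> ?U" by (simp add: relcomp_subgroup[OF grp])
    have "(\<Sum>Q\<in>?U. a L * b M * (kappa G H K L M * bas (L O M) Q) * w Q)
      = (\<Sum>Q\<in>?U. if Q = L O M then a L * b M * kappa G H K L M * w Q else 0)"
      by (intro sum.cong) (auto simp: bas_def)
    also have "\<dots> = a L * b M * (kappa G H K L M * w (L O M))"
      unfolding sum.delta[OF finU] using LM by (simp add: mult.assoc)
    finally show "(\<Sum>Q\<in>?U. a L * b M * (kappa G H K L M * bas (L O M) Q) * w Q)
      = a L * b M * (kappa G H K L M * w (L O M))" .
  qed
  finally show ?thesis .
qed

lemma zeta_star_apply:
  fixes a :: "('g \<times> 'h) set \<Rightarrow> 'r::{comm_ring,comm_monoid_mult}" and b :: "('h \<times> 'k) set \<Rightarrow> 'r"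
  assumes grp: "group G" "group H" "group K"
    and fin: "finite (carrier G)" "finite (carrier H)" "finite (carrier K)"
    and N: "subgroup N (G \<times>\<times> K)"
  shows "zeta (G \<times>\<times> K) (star G H K a b) N =
    (\<Sum>L\<in>subgroups_of (G \<times>\<times> H). \<Sum>M\<in>subgroups_of (H \<times>\<times> K).
       a L * b M * (if N \<subseteq> L O M then kappa G H K L M else 0))"
proof -
  note fGK = finite_carrier_DirProd[OF fin(1,3)]
  let ?U = "subgroups_of (G \<times>\<times> K)"
  have "zeta (G \<times>\<times> K) (star G H K a b) N = (\<Sum>Q\<in>{Q. Q \<in> ?U \<and> N \<subseteq> Q}. star G H K a b Q)"
    using N by (simp add: zeta_apply[OF fGK])
  also have "\<dots> = (\<Sum>Q\<in>?U. star G H K a b Q * (if N \<subseteq> Q then 1 else 0))"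
    by (rule sum.mono_neutral_cong_left) (auto simp: finite_subgroups_of[OF fGK])
  also have "\<dots> = (\<Sum>L\<in>subgroups_of (G \<times>\<times> H). \<Sum>M\<in>subgroups_of (H \<times>\<times> K).
       a L * b M * (if N \<subseteq> L O M then kappa G H K L M else 0))"
    unfolding star_weighted_sum[OF grp fin(1,3)] by (intro sum.cong refl) simp
  finally show ?thesis .
qed

lemma tstar_apply:
  fixes a :: "('g \<times> 'h) set \<Rightarrow> 'r::{comm_ring,comm_monoid_mult}" and b :: "('h \<times> 'k) set \<Rightarrow> 'r"
  assumes fin: "finite (carrier G)" "finite (carrier K)"
  shows "tstar G H K a b N = (if subgroup N (G \<times>\<times> K) then
    (\<Sum>L\<in>subgroups_of (G \<times>\<times> H). \<Sum>M\<in>subgroups_of (H \<times>\<times> K). a L * b M * coeff_a G H K L M N) else 0)"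
proof -
  have "(\<Sum>N'\<in>subgroups_of (G \<times>\<times> K). coeff_a G H K L M N' * bas N' N)
    = (if subgroup N (G \<times>\<times> K) then coeff_a G H K L M N else 0 :: 'r)" for L M
  proof -
    have "(\<Sum>N'\<in>subgroups_of (G \<times>\<times> K). coeff_a G H K L M N' * bas N' N)
      = (\<Sum>N'\<in>subgroups_of (G \<times>\<times> K). if N' = N then coeff_a G H K L M N' else (0::'r))"
      by (intro sum.cong) (auto simp: bas_def)
    then show ?thesis using finite_subgroups_of[OF finite_carrier_DirProd[OF fin]]
      by (simp add: sum.delta)
  qed
  then show ?thesis by (simp add: tstar_def bilin_ext_def)
qed

text \<open>
  After an exchange of the two summations, each pair \<open>(L', M')\<close> is weighted with the sum of the
  Moebius function over the interval from \<open>(L', M')\<close> to \<open>(L\<^sub>0, M\<^sub>0)\<close>. This weight vanishes unless the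
  interval is a single point.
\<close>

lemma coeff_a_interval_sum:
  fixes G :: "'g monoid" and H :: "'h monoid" and K :: "'k monoid"
  assumes fin: "finite (carrier G)" "finite (carrier H)" "finite (carrier K)"
    and L0: "subgroup L0 (G \<times>\<times> H)" and M0: "subgroup M0 (H \<times>\<times> K)"
  shows "(\<Sum>p | p \<in> subgroups_of (G \<times>\<times> H) \<times> subgroups_of (H \<times>\<times> K) \<and> pair_le p (L0, M0).
      coeff_a G H K (fst p) (snd p) N) = (if N \<subseteq> L0 O M0 then kappa G H K L0 M0 else 0 :: 'r::{comm_ring,comm_monoid_mult})"
proof -
  let ?P = "subgroups_of (G \<times>\<times> H) \<times> subgroups_of (H \<times>\<times> K)"
  have finP: "finite ?P"
    using fin by (simp add: finite_subgroups_of finite_carrier_DirProd)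
  have P: "finite_poset ?P pair_le"
    using finP by (auto simp: finite_poset_def pair_le_def)
  let ?w = "\<lambda>p. if N \<subseteq> fst p O snd p then kappa G H K (fst p) (snd p) else (0::'r)"
  let ?\<mu> = "\<lambda>p q. rint (moebius ?P pair_le p q) :: 'r"
  have tr: "pair_le p r" if "pair_le p q" "pair_le q r" for p q r :: "('g \<times> 'h) set \<times> ('h \<times> 'k) set"
    using that by (auto simp: pair_le_def)
  have co: "coeff_a G H K (fst q) (snd q) N = (\<Sum>p | p \<in> ?P \<and> pair_le p q. ?\<mu> p q * ?w p)" for q
  proof -
    have "coeff_a G H K (fst q) (snd q) N =
      (\<Sum>p | p \<in> ?P \<and> pair_le p q \<and> N \<subseteq> fst p O snd p. ?\<mu> p q * kappa G H K (fst p) (snd p))"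
      unfolding coeff_a_def Let_def by (rule sum.cong) auto
    also have "\<dots> = (\<Sum>p | p \<in> ?P \<and> pair_le p q. ?\<mu> p q * ?w p)"
      using finP by (intro sum.mono_neutral_cong_left) auto
    finally show ?thesis .
  qed
  let ?I = "{q. q \<in> ?P \<and> pair_le q (L0, M0)}"
  have finI: "finite ?I" using finP by simp
  have "(\<Sum>q\<in>?I. coeff_a G H K (fst q) (snd q) N) = (\<Sum>q\<in>?I. \<Sum>p | p \<in> ?I \<and> pair_le p q. ?\<mu> p q * ?w p)"
  proof (rule sum.cong[OF refl])
    fix q assume "q \<in> ?I"
    then have "{p. p \<in> ?P \<and> pair_le p q} = {p. p \<in> ?I \<and> pair_le p q}" using tr by blast
    then show "coeff_a G H K (fst q) (snd q) N = (\<Sum>p | p \<in> ?I \<and> pair_le p q. ?\<mu> p q * ?w p)"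
      by (simp only: co)
  qed
  also have "\<dots> = (\<Sum>p\<in>?I. \<Sum>q | q \<in> ?I \<and> pair_le p q. ?\<mu> p q * ?w p)"
    by (rule sum.swap_restrict[OF finI finI])
  also have "\<dots> = (\<Sum>p\<in>?I. if p = (L0, M0) then ?w p else 0)"
  proof (rule sum.cong[OF refl])
    fix p assume p: "p \<in> ?I"
    have "(\<Sum>q | q \<in> ?I \<and> pair_le p q. moebius ?P pair_le p q)
      = (\<Sum>q | q \<in> ?P \<and> pair_le p q \<and> pair_le q (L0, M0). moebius ?P pair_le p q)"
      by (rule sum.cong) auto
    also have "\<dots> = (if p = (L0, M0) then 1 else 0)"
      using p L0 M0 by (intro moebius_sum[OF P]) auto
    finally have *: "(\<Sum>q | q \<in> ?I \<and> pair_le p q. moebius ?P pair_le p q) = (if p = (L0, M0) then 1 else 0)" .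
    have "(\<Sum>q | q \<in> ?I \<and> pair_le p q. ?\<mu> p q * ?w p)
       = rint (\<Sum>q | q \<in> ?I \<and> pair_le p q. moebius ?P pair_le p q) * ?w p"
      by (simp only: rint_sum sum_distrib_right)
    then show "(\<Sum>q | q \<in> ?I \<and> pair_le p q. ?\<mu> p q * ?w p) = (if p = (L0, M0) then ?w p else 0)"
      by (simp only: *) simp
  qed
  also have "\<dots> = ?w (L0, M0)"
    using finI L0 M0 by (simp add: sum.delta pair_le_def)
  finally show ?thesis by simp
qed

text \<open>
  Both transforms on the right are sums over larger subgroups. Collecting the terms that belong to a
  fixed pair \<open>(L\<^sub>0, M\<^sub>0)\<close> leaves the coefficients of all smaller pairs, whose sum is known from
  \<open>coeff_a_interval_sum\<close>.
\<close>

theorem zeta_star: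
  fixes a :: "('g \<times> 'h) set \<Rightarrow> 'r::{comm_ring,comm_monoid_mult}" and b :: "('h \<times> 'k) set \<Rightarrow> 'r"
  assumes grp: "group G" "group H" "group K"
    and fin: "finite (carrier G)" "finite (carrier H)" "finite (carrier K)"
  shows "zeta (G \<times>\<times> K) (star G H K a b) = tstar G H K (zeta (G \<times>\<times> H) a) (zeta (H \<times>\<times> K) b)"
proof
  fix N
  note fGH = finite_carrier_DirProd[OF fin(1,2)] and fHK = finite_carrier_DirProd[OF fin(2,3)]
    and fGK = finite_carrier_DirProd[OF fin(1,3)]
  let ?S = "subgroups_of (G \<times>\<times> H)" and ?T = "subgroups_of (H \<times>\<times> K)"
  note fS = finite_subgroups_of[OF fGH] and fT = finite_subgroups_of[OF fHK]
  show "zeta (G \<times>\<times> K) (star G H K a b) N = tstar G H K (zeta (G \<times>\<times> H) a) (zeta (H \<times>\<times> K) b) N"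
  proof (cases "subgroup N (G \<times>\<times> K)")
    case True
    let ?P = "?S \<times> ?T"
    have fP: "finite ?P" using fS fT by simp
    let ?c = "\<lambda>p. coeff_a G H K (fst p) (snd p) N :: 'r"
    let ?ab = "\<lambda>p. a (fst p) * b (snd p)"
    have z: "zeta (G \<times>\<times> H) a L * zeta (H \<times>\<times> K) b M = (\<Sum>q | q \<in> ?P \<and> pair_le (L, M) q. ?ab q)"
      if "L \<in> ?S" "M \<in> ?T" for L M
    proof -
      have "zeta (G \<times>\<times> H) a L * zeta (H \<times>\<times> K) b M
        = (\<Sum>q\<in>{L0. L0 \<in> ?S \<and> L \<subseteq> L0} \<times> {M0. M0 \<in> ?T \<and> M \<subseteq> M0}. ?ab q)"
        using that by (simp add: zeta_apply[OF fGH] zeta_apply[OF fHK] sum_product sum.cartesian_product case_prod_unfold)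
      also have "{L0. L0 \<in> ?S \<and> L \<subseteq> L0} \<times> {M0. M0 \<in> ?T \<and> M \<subseteq> M0} = {q. q \<in> ?P \<and> pair_le (L, M) q}"
        by (auto simp: pair_le_def)
      finally show ?thesis .
    qed
    have "tstar G H K (zeta (G \<times>\<times> H) a) (zeta (H \<times>\<times> K) b) N
      = (\<Sum>p\<in>?P. zeta (G \<times>\<times> H) a (fst p) * zeta (H \<times>\<times> K) b (snd p) * ?c p)"
      using True fin by (simp add: tstar_apply sum.cartesian_product case_prod_unfold)
    also have "\<dots> = (\<Sum>p\<in>?P. \<Sum>q | q \<in> ?P \<and> pair_le p q. ?ab q * ?c p)"
      by (rule sum.cong[OF refl]) (auto simp: z sum_distrib_right)
    also have "\<dots> = (\<Sum>q\<in>?P. \<Sum>p | p \<in> ?P \<and> pair_le p q. ?ab q * ?c p)"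
      by (rule sum.swap_restrict[OF fP fP])
    also have "\<dots> = (\<Sum>q\<in>?P. ?ab q * (if N \<subseteq> fst q O snd q then kappa G H K (fst q) (snd q) else 0))"
    proof (rule sum.cong[OF refl])
      fix q assume "q \<in> ?P"
      then have "(\<Sum>p | p \<in> ?P \<and> pair_le p q. ?c p)
          = (if N \<subseteq> fst q O snd q then kappa G H K (fst q) (snd q) else 0)"
        using coeff_a_interval_sum[OF fin, of "fst q" "snd q" N, where ?'r = 'r]
        by (simp only: mem_Times_iff subgroups_of_iff prod.collapse)
      then show "(\<Sum>p | p \<in> ?P \<and> pair_le p q. ?ab q * ?c p)
          = ?ab q * (if N \<subseteq> fst q O snd q then kappa G H K (fst q) (snd q) else 0)"
        by (simp only: sum_distrib_left[symmetric])
    qed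
    also have "\<dots> = zeta (G \<times>\<times> K) (star G H K a b) N"
      unfolding zeta_star_apply[OF grp fin True]
      by (simp add: sum.cartesian_product case_prod_unfold)
    finally show ?thesis by simp
  qed (simp add: zeta_apply fGK tstar_apply fin)
qed


section \<open>Associativity of the star product\<close>

text \<open>
  The fibres of the projection to \<open>K\<close> are cosets of its kernel.
\<close>

lemma card_eq_card_kernel_times_card_image:
  assumes "group H" "group K" and W: "subgroup W (H \<times>\<times> K)" and fin: "finite W"
  shows "card W = card {h. (h, \<one>\<^bsub>K\<^esub>) \<in> W} * card (snd ` W)"
proof -
  interpret H: group H by fact
  interpret K: group K by fact
  note Wc = DirProd_subgroupD(2,3)[OF assms(1,2) W] and mult = DirProd_subgroupD(4)[OF assms(1,2) W]
    and inv = DirProd_subgroupD(5)[OF assms(1,2) W]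
  have fibre: "card {h. (h, k) \<in> W} = card {h. (h, \<one>\<^bsub>K\<^esub>) \<in> W}" if k: "k \<in> snd ` W" for k
  proof -
    obtain h0 where h0: "(h0, k) \<in> W" using k by auto
    note c0 = Wc[OF h0]
    have "bij_betw (\<lambda>h. h \<otimes>\<^bsub>H\<^esub> h0) {h. (h, \<one>\<^bsub>K\<^esub>) \<in> W} {h. (h, k) \<in> W}"
    proof (rule bij_betwI[where g = "\<lambda>h. h \<otimes>\<^bsub>H\<^esub> inv\<^bsub>H\<^esub> h0"])
      show "(\<lambda>h. h \<otimes>\<^bsub>H\<^esub> h0) \<in> {h. (h, \<one>\<^bsub>K\<^esub>) \<in> W} \<rightarrow> {h. (h, k) \<in> W}"
        using mult[OF _ h0] c0 by fastforce
      show "(\<lambda>h. h \<otimes>\<^bsub>H\<^esub> inv\<^bsub>H\<^esub> h0) \<in> {h. (h, k) \<in> W} \<rightarrow> {h. (h, \<one>\<^bsub>K\<^esub>) \<in> W}"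
        using mult[OF _ inv[OF h0]] c0 by fastforce
      fix h assume "h \<in> {h. (h, \<one>\<^bsub>K\<^esub>) \<in> W}"
      then show "h \<otimes>\<^bsub>H\<^esub> h0 \<otimes>\<^bsub>H\<^esub> inv\<^bsub>H\<^esub> h0 = h" using Wc(1) c0 by (simp add: H.m_assoc)
    next
      fix h assume "h \<in> {h. (h, k) \<in> W}"
      then show "h \<otimes>\<^bsub>H\<^esub> inv\<^bsub>H\<^esub> h0 \<otimes>\<^bsub>H\<^esub> h0 = h" using Wc(1) c0 by (simp add: H.m_assoc)
    qed
    then show ?thesis by (metis bij_betw_same_card)
  qed
  have "card W = card ((\<lambda>(k, h). (h, k)) ` (SIGMA k:snd ` W. {h. (h, k) \<in> W}))"
    by (rule arg_cong[where f = card]) force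
  also have "\<dots> = card (SIGMA k:snd ` W. {h. (h, k) \<in> W})"
    by (rule card_image) (auto simp: inj_on_def)
  also have "\<dots> = (\<Sum>k\<in>snd ` W. card {h. (h, k) \<in> W})"
  proof (rule card_SigmaI)
    show "\<forall>k\<in>snd ` W. finite {h. (h, k) \<in> W}"
    proof
      fix k
      have "{h. (h, k) \<in> W} \<subseteq> fst ` W" by force
      then show "finite {h. (h, k) \<in> W}" using fin by (rule finite_subset[OF _ finite_imageI])
    qed
  qed (use fin in simp)
  also have "\<dots> = card {h. (h, \<one>\<^bsub>K\<^esub>) \<in> W} * card (snd ` W)"
    by (simp add: fibre)
  finally show ?thesis .
qed

lemma subgroup_converse:
  assumes H: "group H" and K: "group K" and W: "subgroup W (H \<times>\<times> K)"
  shows "subgroup (W\<inverse>) (K \<times>\<times> H)"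
  by (rule DirProd_subgroupI[OF K H]) (use DirProd_subgroupD[OF H K W] in auto)

text \<open>
  Both sides are the order of the group of all \<open>(h, k) \<in> M\<close> with \<open>(1, h) \<in> L\<close> and \<open>(k, 1) \<in> N\<close>: the
  left hand side is obtained by projecting it to \<open>K\<close>, the right hand side by projecting it to \<open>H\<close>.
\<close>

lemma card_kernels_relcomp:
  assumes grp: "group G" "group H" "group K" "group J" and fin: "finite (carrier H)" "finite (carrier K)"
    and L: "subgroup L (G \<times>\<times> H)" and M: "subgroup M (H \<times>\<times> K)" and N: "subgroup N (K \<times>\<times> J)"
  shows "card (k2 G H L \<inter> k1 H K M) * card (k2 G K (L O M) \<inter> k1 K J N)
       = card (k2 G H L \<inter> k1 H J (M O N)) * card (k2 H K M \<inter> k1 K J N)"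
proof -
  interpret G: group G by fact
  interpret J: group J by fact
  note l = DirProd_subgroupD[OF grp(1,2) L] and m = DirProd_subgroupD[OF grp(2,3) M]
    and n = DirProd_subgroupD[OF grp(3,4) N]
  define W where "W = {(h, k) \<in> M. (\<one>\<^bsub>G\<^esub>, h) \<in> L \<and> (k, \<one>\<^bsub>J\<^esub>) \<in> N}"
  have finW: "finite W"
    by (rule finite_subset[OF _ finite_cartesian_product[OF fin]]) (use m(2,3) in \<open>auto simp: W_def\<close>)
  have W: "subgroup W (H \<times>\<times> K)"
  proof (rule DirProd_subgroupI[OF grp(2,3)])
    fix h k assume "(h, k) \<in> W"
    then show "(inv\<^bsub>H\<^esub> h, inv\<^bsub>K\<^esub> k) \<in> W"
      using l(5)[of "\<one>\<^bsub>G\<^esub>" h] m(5)[of h k] n(5)[of k "\<one>\<^bsub>J\<^esub>"] by (simp add: W_def)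
  next
    fix h k h' k' assume "(h, k) \<in> W" "(h', k') \<in> W"
    then show "(h \<otimes>\<^bsub>H\<^esub> h', k \<otimes>\<^bsub>K\<^esub> k') \<in> W"
      using l(4)[of "\<one>\<^bsub>G\<^esub>" h "\<one>\<^bsub>G\<^esub>" h'] m(4)[of h k h' k'] n(4)[of k "\<one>\<^bsub>J\<^esub>" k' "\<one>\<^bsub>J\<^esub>"]
      by (simp add: W_def)
  qed (use l(1) m(1-3) n(1) in \<open>auto simp: W_def\<close>)
  have img: "snd ` V = {k. \<exists>h. (h, k) \<in> V}" for V :: "('x \<times> 'y) set" by force
  have 1: "{h. (h, \<one>\<^bsub>K\<^esub>) \<in> W} = k2 G H L \<inter> k1 H K M"
    using l(3) m(1) n(1) by (auto simp: W_def k1_def k2_def)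
  have 2: "snd ` W = k2 G K (L O M) \<inter> k1 K J N"
    unfolding W_def k1_def k2_def img using m(2,3) by blast
  have 3: "{k. (k, \<one>\<^bsub>H\<^esub>) \<in> W\<inverse>} = k2 H K M \<inter> k1 K J N"
    using l(1) m(1) n(2) by (auto simp: W_def k1_def k2_def)
  have 4: "snd ` (W\<inverse>) = k2 G H L \<inter> k1 H J (M O N)"
    unfolding W_def k1_def k2_def img using m(2,3) by blast
  have "card W = card (k2 G H L \<inter> k1 H K M) * card (k2 G K (L O M) \<inter> k1 K J N)"
    using card_eq_card_kernel_times_card_image[OF grp(2,3) W finW] by (simp only: 1 2)
  moreover have "card (W\<inverse>) = card (k2 H K M \<inter> k1 K J N) * card (k2 G H L \<inter> k1 H J (M O N))"
    using card_eq_card_kernel_times_card_image[OF grp(3,2) subgroup_converse[OF grp(2,3) W]] finW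
    by (simp only: 3 4 finite_converse)
  moreover have "card (W\<inverse>) = card W" by simp
  ultimately show ?thesis by (simp add: mult.commute)
qed

text \<open>
  The cocycle identity that makes the product twisted by \<open>\<kappa>\<close> associative.
\<close>

lemma kappa_relcomp:
  assumes "group G" "group H" "group K" "group J" "finite (carrier H)" "finite (carrier K)"
    and "subgroup L (G \<times>\<times> H)" "subgroup M (H \<times>\<times> K)" "subgroup N (K \<times>\<times> J)"
  shows "kappa G H K L M * kappa G K J (L O M) N
       = (kappa G H J L (M O N) * kappa H K J M N :: 'r::{comm_ring,comm_monoid_mult})"
proof -
  let ?r = "\<lambda>n. rint (int n) :: 'r"
  have "?r (card (k2 G H L \<inter> k1 H K M)) * ?r (card (k2 G K (L O M) \<inter> k1 K J N))
      = ?r (card (k2 G H L \<inter> k1 H J (M O N))) * ?r (card (k2 H K M \<inter> k1 K J N))"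
    using card_kernels_relcomp[OF assms] by (simp only: rint_mult[symmetric] of_nat_mult[symmetric])
  then show ?thesis by (simp add: kappa_def ac_simps)
qed

lemma star_assoc:
  fixes a :: "('g \<times> 'h) set \<Rightarrow> 'r::{comm_ring,comm_monoid_mult}" and b :: "('h \<times> 'k) set \<Rightarrow> 'r"
    and c :: "('k \<times> 'j) set \<Rightarrow> 'r"
  assumes grp: "group G" "group H" "group K" "group J"
    and fin: "finite (carrier G)" "finite (carrier H)" "finite (carrier K)" "finite (carrier J)"
  shows "star G K J (star G H K a b) c = star G H J a (star H K J b c)"
proof
  fix N
  let ?S = "subgroups_of (G \<times>\<times> H)" and ?T = "subgroups_of (H \<times>\<times> K)" and ?U = "subgroups_of (K \<times>\<times> J)"
  have "star G K J (star G H K a b) c N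
    = (\<Sum>P\<in>subgroups_of (G \<times>\<times> K). star G H K a b P * (\<Sum>Q\<in>?U. c Q * (kappa G K J P Q * bas (P O Q) N)))"
    by (simp add: star_def[of G K J] bilin_ext_def sum_distrib_left mult.assoc)
  also have "\<dots> = (\<Sum>L\<in>?S. \<Sum>M\<in>?T. \<Sum>Q\<in>?U. a L * b M * c Q *
      (kappa G H K L M * kappa G K J (L O M) Q) * bas (L O M O Q) N)"
    unfolding star_weighted_sum[OF grp(1-3) fin(1,3)]
    by (simp add: sum_distrib_left ac_simps O_assoc)
  also have "\<dots> = (\<Sum>L\<in>?S. \<Sum>M\<in>?T. \<Sum>Q\<in>?U. a L * b M * c Q *
      (kappa G H J L (M O Q) * kappa H K J M Q) * bas (L O M O Q) N)"
    by (intro sum.cong refl) (simp add: kappa_relcomp[OF grp fin(2,3)])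
  also have "\<dots> = (\<Sum>L\<in>?S. a L * (\<Sum>P\<in>subgroups_of (H \<times>\<times> J). star H K J b c P * (kappa G H J L P * bas (L O P) N)))"
    unfolding star_weighted_sum[OF grp(2-4) fin(2,4)]
    by (simp add: sum_distrib_left ac_simps)
  also have "\<dots> = star G H J a (star H K J b c) N"
    by (simp add: star_def[of G H J] bilin_ext_def sum_distrib_left mult.assoc)
  finally show "star G K J (star G H K a b) c N = star G H J a (star H K J b c) N" .
qed

lemma star_in_free_mod:
  fixes a :: "('g \<times> 'h) set \<Rightarrow> 'r::{comm_ring,comm_monoid_mult}" and b :: "('h \<times> 'k) set \<Rightarrow> 'r"
  assumes "group G" "group H" "group K"
  shows "star G H K a b \<in> free_mod (G \<times>\<times> K)"
proof -
  have "star G H K a b N = 0" if N: "\<not> subgroup N (G \<times>\<times> K)" for N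
  proof -
    have "bas (L O M) N = (0 :: 'r)" if "L \<in> subgroups_of (G \<times>\<times> H)" "M \<in> subgroups_of (H \<times>\<times> K)" for L M
      using that N relcomp_subgroup[OF assms] by (auto simp: bas_def)
    then show ?thesis by (simp add: star_def bilin_ext_def)
  qed
  then show ?thesis by (simp add: free_mod_def)
qed


section \<open>Conjugation and the fixed points\<close>

lemma conj_set_conj_set:
  assumes "group X" "x \<in> carrier X" "y \<in> carrier X" "L \<subseteq> carrier X"
  shows "conj_set X x (conj_set X y L) = conj_set X (x \<otimes>\<^bsub>X\<^esub> y) L"
proof -
  interpret group X by fact
  show ?thesis unfolding conj_set_def image_image
    by (intro image_cong refl) (use assms in \<open>auto simp: m_assoc inv_mult_group\<close>)
qed

lemma conj_set_one:
  assumes "group X" "L \<subseteq> carrier X"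
  shows "conj_set X \<one>\<^bsub>X\<^esub> L = L"
proof -
  interpret group X by fact
  have "conj_set X \<one>\<^bsub>X\<^esub> L = id ` L" unfolding conj_set_def
    by (intro image_cong refl) (use assms in auto)
  then show ?thesis by simp
qed

lemma conj_set_inv:
  assumes "group X" "x \<in> carrier X" "L \<subseteq> carrier X"
  shows "conj_set X x (conj_set X (inv\<^bsub>X\<^esub> x) L) = L" "conj_set X (inv\<^bsub>X\<^esub> x) (conj_set X x L) = L"
  using assms by (simp_all add: conj_set_conj_set conj_set_one group.l_inv group.r_inv)

lemma conj_set_mono: "L \<subseteq> M \<Longrightarrow> conj_set X x L \<subseteq> conj_set X x M"
  unfolding conj_set_def by (rule image_mono)

lemma conj_set_subgroup:
  assumes "group X" and x: "x \<in> carrier X" and L: "subgroup L X"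
  shows "subgroup (conj_set X x L) X"
proof -
  interpret group X by fact
  interpret L: subgroup L X by fact
  show ?thesis
  proof (rule subgroupI)
    show "conj_set X x L \<subseteq> carrier X" using x L.subset by (auto simp: conj_set_def)
    show "conj_set X x L \<noteq> {}" using L.one_closed unfolding conj_set_def by blast
  next
    fix p assume "p \<in> conj_set X x L"
    then obtain l where l: "l \<in> L" "p = x \<otimes>\<^bsub>X\<^esub> l \<otimes>\<^bsub>X\<^esub> inv\<^bsub>X\<^esub> x" by (auto simp: conj_set_def)
    then have "inv\<^bsub>X\<^esub> p = x \<otimes>\<^bsub>X\<^esub> inv\<^bsub>X\<^esub> l \<otimes>\<^bsub>X\<^esub> inv\<^bsub>X\<^esub> x"
      using x L.mem_carrier by (simp add: inv_mult_group m_assoc)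
    then show "inv\<^bsub>X\<^esub> p \<in> conj_set X x L" using l by (auto simp: conj_set_def)
  next
    fix p q assume "p \<in> conj_set X x L" "q \<in> conj_set X x L"
    then obtain l m where l: "l \<in> L" "p = x \<otimes>\<^bsub>X\<^esub> l \<otimes>\<^bsub>X\<^esub> inv\<^bsub>X\<^esub> x"
      and m: "m \<in> L" "q = x \<otimes>\<^bsub>X\<^esub> m \<otimes>\<^bsub>X\<^esub> inv\<^bsub>X\<^esub> x" by (auto simp: conj_set_def)
    have "inv\<^bsub>X\<^esub> x \<otimes>\<^bsub>X\<^esub> (x \<otimes>\<^bsub>X\<^esub> z) = z" if "z \<in> carrier X" for z
      using x that by (simp add: m_assoc[symmetric])
    then have "p \<otimes>\<^bsub>X\<^esub> q = x \<otimes>\<^bsub>X\<^esub> (l \<otimes>\<^bsub>X\<^esub> m) \<otimes>\<^bsub>X\<^esub> inv\<^bsub>X\<^esub> x"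
      using l m x L.mem_carrier by (simp add: m_assoc)
    then show "p \<otimes>\<^bsub>X\<^esub> q \<in> conj_set X x L" using l m by (auto simp: conj_set_def)
  qed
qed

text \<open>
  Conjugation by \<open>x\<close> moves the basis elements forwards and therefore reads the coefficients at the
  subgroup conjugated by the inverse of \<open>x\<close>.
\<close>

lemma conj_action_apply:
  fixes a :: "'x set \<Rightarrow> 'r::{comm_ring,comm_monoid_mult}"
  assumes X: "group X" and fin: "finite (carrier X)" and x: "x \<in> carrier X"
  shows "lin_ext (subgroups_of X) (\<lambda>L. bas (conj_set X x L)) a N
    = (if subgroup N X then a (conj_set X (inv\<^bsub>X\<^esub> x) N) else 0)"
proof -
  interpret group X by fact
  have iff: "N = conj_set X x L \<longleftrightarrow> subgroup N X \<and> L = conj_set X (inv\<^bsub>X\<^esub> x) N" if "subgroup L X" for L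
    using that x conj_set_inv[OF X x] conj_set_subgroup[OF X x] by (metis subgroup.subset)
  have "lin_ext (subgroups_of X) (\<lambda>L. bas (conj_set X x L)) a N
      = (\<Sum>L\<in>subgroups_of X. if L = conj_set X (inv\<^bsub>X\<^esub> x) N then (if subgroup N X then a L else 0) else 0)"
    unfolding lin_ext_def bas_def by (intro sum.cong refl) (auto simp: iff)
  also have "\<dots> = (if subgroup N X then a (conj_set X (inv\<^bsub>X\<^esub> x) N) else 0)"
    unfolding sum.delta[OF finite_subgroups_of[OF fin]] using conj_set_subgroup[OF X] x by simp
  finally show ?thesis .
qed

lemma conj_fixed_iff:
  fixes a :: "'x set \<Rightarrow> 'r::{comm_ring,comm_monoid_mult}"
  assumes X: "group X" and fin: "finite (carrier X)"
  shows "a \<in> conj_fixed X \<longleftrightarrow> a \<in> free_mod X \<and>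
    (\<forall>x\<in>carrier X. \<forall>N. subgroup N X \<longrightarrow> a (conj_set X x N) = a N)"
proof -
  interpret group X by fact
  have "lin_ext (subgroups_of X) (\<lambda>L. bas (conj_set X x L)) a = a
      \<longleftrightarrow> (\<forall>N. subgroup N X \<longrightarrow> a (conj_set X (inv\<^bsub>X\<^esub> x) N) = a N)"
    if "x \<in> carrier X" "a \<in> free_mod X" for x
    unfolding fun_eq_iff conj_action_apply[OF X fin that(1)] using free_mod_zero[OF that(2)] by auto
  then show ?thesis unfolding conj_fixed_def by (auto) (metis inv_closed inv_inv)
qed

text \<open>
  The transform is defined by inclusions, hence it commutes with conjugation; and it is injective.
\<close>

lemma zeta_conj_fixed_iff:
  fixes a :: "'x set \<Rightarrow> 'r::{comm_ring,comm_monoid_mult}"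
  assumes X: "group X" and fin: "finite (carrier X)" and a: "a \<in> free_mod X"
  shows "zeta X a \<in> conj_fixed X \<longleftrightarrow> a \<in> conj_fixed X"
proof -
  interpret group X by fact
  let ?act = "\<lambda>x. lin_ext (subgroups_of X) (\<lambda>L. bas (conj_set X x L)) :: ('x set \<Rightarrow> 'r) \<Rightarrow> 'x set \<Rightarrow> 'r"
  have act_free: "?act x a \<in> free_mod X" if "x \<in> carrier X" for x
    using that by (simp add: free_mod_def conj_action_apply[OF X fin])
  have comm: "zeta X (?act x a) = ?act x (zeta X a)" if x: "x \<in> carrier X" for x
  proof
    fix N
    note xi = inv_closed[OF x]
    show "zeta X (?act x a) N = ?act x (zeta X a) N"
    proof (cases "subgroup N X")
      case True
      have bij: "bij_betw (conj_set X (inv\<^bsub>X\<^esub> x)) {L. L \<in> subgroups_of X \<and> N \<subseteq> L}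
          {L. L \<in> subgroups_of X \<and> conj_set X (inv\<^bsub>X\<^esub> x) N \<subseteq> L}"
      proof (rule bij_betwI[where g = "conj_set X x"])
        show "conj_set X (inv\<^bsub>X\<^esub> x) \<in> {L. L \<in> subgroups_of X \<and> N \<subseteq> L} \<rightarrow>
          {L. L \<in> subgroups_of X \<and> conj_set X (inv\<^bsub>X\<^esub> x) N \<subseteq> L}"
          using conj_set_mono[of N _ X "inv\<^bsub>X\<^esub> x"] conj_set_subgroup[OF X xi] by auto
        have "N \<subseteq> conj_set X x L" if "conj_set X (inv\<^bsub>X\<^esub> x) N \<subseteq> L" for L
          using conj_set_mono[OF that, of X x] conj_set_inv(1)[OF X x] subgroup.subset[OF True] by simp
        then show "conj_set X x \<in> {L. L \<in> subgroups_of X \<and> conj_set X (inv\<^bsub>X\<^esub> x) N \<subseteq> L} \<rightarrow>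
          {L. L \<in> subgroups_of X \<and> N \<subseteq> L}"
          using conj_set_subgroup[OF X x] by auto
      qed (simp_all add: conj_set_inv[OF X x] subgroup.subset)
      have "zeta X (?act x a) N = (\<Sum>L | L \<in> subgroups_of X \<and> N \<subseteq> L. a (conj_set X (inv\<^bsub>X\<^esub> x) L))"
        using True by (simp add: zeta_apply[OF fin] conj_action_apply[OF X fin x])
      also have "\<dots> = (\<Sum>L | L \<in> subgroups_of X \<and> conj_set X (inv\<^bsub>X\<^esub> x) N \<subseteq> L. a L)"
        by (rule sum.reindex_bij_betw[OF bij])
      also have "\<dots> = ?act x (zeta X a) N"
        using True conj_set_subgroup[OF X xi True]
        by (simp add: zeta_apply[OF fin] conj_action_apply[OF X fin x])
      finally show ?thesis .
    qed (simp add: zeta_apply[OF fin] conj_action_apply[OF X fin x])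
  qed
  have "?act x (zeta X a) = zeta X a \<longleftrightarrow> ?act x a = a" if "x \<in> carrier X" for x
    using comm[OF that] zeta_inj[OF fin act_free[OF that] a] by auto
  then show ?thesis using a zeta_in_free_mod[OF fin, of a] unfolding conj_fixed_def by auto
qed


section \<open>The ghost ring and its idempotent\<close>

lemma star_add_left: "star G H K (\<lambda>L. a L + a' L) b = (\<lambda>N. star G H K a b N + star G H K a' b N)"
  by (simp add: star_def bilin_ext_def distrib_right sum.distrib)

lemma star_add_right: "star G H K a (\<lambda>L. b L + b' L) = (\<lambda>N. star G H K a b N + star G H K a b' N)"
  by (simp add: star_def bilin_ext_def distrib_right distrib_left sum.distrib)

lemma star_smult_left: "star G H K (\<lambda>L. r * a L) b = (\<lambda>N. r * star G H K a b N)"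
  by (simp add: star_def bilin_ext_def sum_distrib_left ac_simps)

lemma star_smult_right: "star G H K a (\<lambda>L. r * b L) = (\<lambda>N. r * star G H K a b N)"
  by (simp add: star_def bilin_ext_def sum_distrib_left ac_simps)

lemma star_zero_left: "star G H K (\<lambda>L. 0) b = (\<lambda>N. 0)"
  by (simp add: star_def bilin_ext_def)

lemma star_zero_right: "star G H K a (\<lambda>L. 0) = (\<lambda>N. 0)"
  by (simp add: star_def bilin_ext_def)

lemma star_sum_left: "star G H K (\<lambda>L. \<Sum>i\<in>I. a i L) b = (\<lambda>N. \<Sum>i\<in>I. star G H K (a i) b N)"
  by (induction I rule: infinite_finite_induct) (simp_all add: star_add_left star_zero_left)

lemma star_sum_right: "star G H K a (\<lambda>L. \<Sum>i\<in>I. b i L) = (\<lambda>N. \<Sum>i\<in>I. star G H K a (b i) N)"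
  by (induction I rule: infinite_finite_induct) (simp_all add: star_add_right star_zero_right)

locale finite_group = group G for G :: "'g monoid" (structure) +
  assumes finite_carrier: "finite (carrier G)"
begin

abbreviation GG :: "('g \<times> 'g) monoid" where "GG \<equiv> G \<times>\<times> G"



lemma GG_group: "group GG" by (simp add: DirProd_group is_group)

lemma GG_finite: "finite (carrier GG)" by (rule finite_carrier_DirProd) (fact finite_carrier)+

lemma Delta_subset: "g \<in> carrier G \<Longrightarrow> Delta G g \<subseteq> carrier GG"
  by (auto simp: Delta_def)

lemma Delta_one: "Delta G \<one> = {(x, x) | x. x \<in> carrier G}"
  by (auto simp: Delta_def)

text \<open>
  Composing with a twisted diagonal conjugates in one coordinate. This is the reason why multiplication
  by \<open>e_elt\<close> is an average.
\<close>

lemma relcomp_Delta_left: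
  assumes g: "g \<in> carrier G" and M: "M \<subseteq> carrier GG"
  shows "Delta G g O M = conj_set GG (g, \<one>) M"
proof -
  have Mc: "x \<in> carrier G" "y \<in> carrier G" if "(x, y) \<in> M" for x y using that M by auto
  have "Delta G g O M = (\<lambda>(x, y). (g \<otimes> x \<otimes> inv g, y)) ` M"
  proof
    show "Delta G g O M \<subseteq> (\<lambda>(x, y). (g \<otimes> x \<otimes> inv g, y)) ` M" by (force simp: Delta_def)
    show "(\<lambda>(x, y). (g \<otimes> x \<otimes> inv g, y)) ` M \<subseteq> Delta G g O M"
    proof clarify
      fix x y assume "(x, y) \<in> M"
      moreover have "(g \<otimes> x \<otimes> inv g, x) \<in> Delta G g"
        using Mc[OF \<open>(x, y) \<in> M\<close>] unfolding Delta_def by blast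
      ultimately show "(g \<otimes> x \<otimes> inv g, y) \<in> Delta G g O M" by blast
    qed
  qed
  also have "\<dots> = conj_set GG (g, \<one>) M"
    unfolding conj_set_def
    by (rule image_cong[OF refl]) (use Mc g in \<open>auto simp: is_group\<close>)
  finally show ?thesis .
qed

lemma relcomp_Delta_right:
  assumes g: "g \<in> carrier G" and M: "M \<subseteq> carrier GG"
  shows "M O Delta G g = conj_set GG (\<one>, inv g) M"
proof -
  have Mc: "x \<in> carrier G" "y \<in> carrier G" if "(x, y) \<in> M" for x y using that M by auto
  have 1: "g \<otimes> (inv g \<otimes> y \<otimes> g) \<otimes> inv g = y" if "y \<in> carrier G" for y
    using g that by (simp add: m_assoc) (simp add: m_assoc[symmetric])
  have 2: "inv g \<otimes> (g \<otimes> x \<otimes> inv g) \<otimes> g = x" if "x \<in> carrier G" for x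
    using g that by (simp add: m_assoc) (simp add: m_assoc[symmetric])
  have "M O Delta G g = (\<lambda>(x, y). (x, inv g \<otimes> y \<otimes> g)) ` M"
  proof
    show "M O Delta G g \<subseteq> (\<lambda>(x, y). (x, inv g \<otimes> y \<otimes> g)) ` M"
      using 2 by (force simp: Delta_def)
    show "(\<lambda>(x, y). (x, inv g \<otimes> y \<otimes> g)) ` M \<subseteq> M O Delta G g"
    proof clarify
      fix x y assume "(x, y) \<in> M"
      moreover have "(y, inv g \<otimes> y \<otimes> g) \<in> Delta G g"
        using 1 Mc[OF \<open>(x, y) \<in> M\<close>] g unfolding Delta_def by force
      ultimately show "(x, inv g \<otimes> y \<otimes> g) \<in> M O Delta G g" by blast
    qed
  qed
  also have "\<dots> = conj_set GG (\<one>, inv g) M"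
    unfolding conj_set_def
    by (rule image_cong[OF refl]) (use Mc g in \<open>auto simp: is_group\<close>)
  finally show ?thesis .
qed

lemma subgroup_Delta_one: "subgroup (Delta G \<one>) GG"
proof -
  interpret D: group "GG" by (rule GG_group)
  show ?thesis
    by (rule D.subgroupI) (auto simp: Delta_one is_group intro: exI[of _ \<one>])
qed

lemma conj_Delta:
  assumes "g \<in> carrier G" "h \<in> carrier G"
  shows "conj_set GG (h, \<one>) (Delta G g) = Delta G (h \<otimes> g)"
proof -
  have image: "Delta G k = (\<lambda>x. (k \<otimes> x \<otimes> inv k, x)) ` carrier G" for k
    by (auto simp: Delta_def)
  show ?thesis unfolding image conj_set_def image_image
    by (intro image_cong refl) (use assms in \<open>simp add: is_group inv_mult_group m_assoc\<close>)
qed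

lemma subgroup_Delta: "g \<in> carrier G \<Longrightarrow> subgroup (Delta G g) GG"
  using conj_set_subgroup[OF GG_group _ subgroup_Delta_one, of "(g, \<one>)"] conj_Delta[of \<one> g] by simp

lemma k2_Delta: "g \<in> carrier G \<Longrightarrow> k2 G G (Delta G g) = {\<one>}"
proof -
  assume g: "g \<in> carrier G"
  have "x = \<one>" if "x \<in> carrier G" "\<one> = g \<otimes> x \<otimes> inv g" for x
    using that g by (metis inv_closed inv_inv inv_solve_right' l_cancel_one m_closed r_inv r_one)
  moreover have "(\<one>, \<one>) \<in> Delta G g" using g by (auto simp: Delta_def intro: exI[of _ \<one>])
  ultimately show ?thesis by (auto simp: k2_def Delta_def)
qed

lemma k1_Delta: "g \<in> carrier G \<Longrightarrow> k1 G G (Delta G g) = {\<one>}"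
  by (auto simp: k1_def Delta_def)

lemma star_Delta_left:
  fixes b :: "('g \<times> 'g) set \<Rightarrow> 'r::{comm_ring,comm_monoid_mult}"
  assumes g: "g \<in> carrier G"
  shows "star G G G (bas (Delta G g)) b N =
    (if subgroup N GG then ring_inv (rint (int (order G))) * b (conj_set GG (inv g, \<one>) N) else 0)"
proof -
  let ?S = "subgroups_of GG" and ?u = "ring_inv (rint (int (order G))) :: 'r"
  have kap: "kappa G G G (Delta G g) M = ?u" if "M \<in> ?S" for M
  proof -
    have "\<one> \<in> k1 G G M" using that subgroup.one_closed by (fastforce simp: k1_def)
    then have "k2 G G (Delta G g) \<inter> k1 G G M = {\<one>}" by (auto simp: k2_Delta[OF g])
    then show ?thesis by (simp add: kappa_def)
  qed
  have "star G G G (bas (Delta G g)) b N =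
      (\<Sum>L\<in>?S. if L = Delta G g then \<Sum>M\<in>?S. b M * (kappa G G G L M * bas (L O M) N) else 0)"
    unfolding star_def bilin_ext_def by (intro sum.cong refl) (simp add: bas_def)
  also have "\<dots> = (\<Sum>M\<in>?S. b M * (kappa G G G (Delta G g) M * bas (Delta G g O M) N))"
    unfolding sum.delta[OF finite_subgroups_of[OF GG_finite]] using subgroup_Delta[OF g] by simp
  also have "\<dots> = (\<Sum>M\<in>?S. ?u * (b M * bas (conj_set GG (g, \<one>) M) N))"
    by (intro sum.cong refl) (simp add: kap relcomp_Delta_left[OF g subgroup.subset] ac_simps)
  also have "\<dots> = ?u * lin_ext ?S (\<lambda>M. bas (conj_set GG (g, \<one>) M)) b N"
    by (simp add: lin_ext_def sum_distrib_left)
  also have "\<dots> = (if subgroup N GG then ?u * b (conj_set GG (inv g, \<one>) N) else 0)"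
    using conj_action_apply[OF GG_group GG_finite, of "(g, \<one>)" b N] g by (simp add: is_group)
  finally show ?thesis .
qed

lemma star_Delta_right:
  fixes b :: "('g \<times> 'g) set \<Rightarrow> 'r::{comm_ring,comm_monoid_mult}"
  assumes g: "g \<in> carrier G"
  shows "star G G G b (bas (Delta G g)) N =
    (if subgroup N GG then ring_inv (rint (int (order G))) * b (conj_set GG (\<one>, g) N) else 0)"
proof -
  let ?S = "subgroups_of GG" and ?u = "ring_inv (rint (int (order G))) :: 'r"
  have kap: "kappa G G G M (Delta G g) = ?u" if "M \<in> ?S" for M
  proof -
    have "\<one> \<in> k2 G G M" using that subgroup.one_closed by (fastforce simp: k2_def)
    then have "k2 G G M \<inter> k1 G G (Delta G g) = {\<one>}" by (auto simp: k1_Delta[OF g])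
    then show ?thesis by (simp add: kappa_def)
  qed
  have "star G G G b (bas (Delta G g)) N =
      (\<Sum>M\<in>?S. \<Sum>L\<in>?S. if L = Delta G g then b M * (kappa G G G M L * bas (M O L) N) else 0)"
    unfolding star_def bilin_ext_def by (intro sum.cong refl) (simp add: bas_def)
  also have "\<dots> = (\<Sum>M\<in>?S. b M * (kappa G G G M (Delta G g) * bas (M O Delta G g) N))"
    unfolding sum.delta[OF finite_subgroups_of[OF GG_finite]] using subgroup_Delta[OF g] by simp
  also have "\<dots> = (\<Sum>M\<in>?S. ?u * (b M * bas (conj_set GG (\<one>, inv g) M) N))"
    by (intro sum.cong refl) (simp add: kap relcomp_Delta_right[OF g subgroup.subset] ac_simps)
  also have "\<dots> = ?u * lin_ext ?S (\<lambda>M. bas (conj_set GG (\<one>, inv g) M)) b N"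
    by (simp add: lin_ext_def sum_distrib_left)
  also have "\<dots> = (if subgroup N GG then ?u * b (conj_set GG (\<one>, g) N) else 0)"
    using conj_action_apply[OF GG_group GG_finite, of "(\<one>, inv g)" b N] g by (simp add: is_group)
  finally show ?thesis .
qed

lemma e_elt_free_mod: "(e_elt G :: ('g \<times> 'g) set \<Rightarrow> 'r::{comm_ring,comm_monoid_mult}) \<in> free_mod GG"
proof -
  have "(e_elt G N :: 'r) = 0" if "\<not> subgroup N GG" for N
    unfolding e_elt_def by (rule sum.neutral) (use that subgroup_Delta in \<open>auto simp: bas_def\<close>)
  then show ?thesis by (simp add: free_mod_def)
qed

end

text \<open>
  The argument of type \<open>'r itself\<close> only names the coefficient ring, which does not occur in the type
  of \<open>G\<close>.
\<close>

locale invertible_order = finite_group G for G :: "'g monoid" (structure) +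
  fixes ring_type :: "'r::{comm_ring,comm_monoid_mult} itself"
  assumes order_invertible: "invertible_in_ring (rint (int (order G)) :: 'r)"
begin

abbreviation inv_order :: 'r where "inv_order \<equiv> ring_inv (rint (int (order G)))"

lemma order_inv_order: "rint (int (order G)) * inv_order = 1"
  by (rule ring_inv_right[OF order_invertible])

lemma sum_carrier_const: "(\<Sum>g\<in>carrier G. inv_order * x) = (x :: 'r)"
proof -
  have const: "(\<Sum>g\<in>A. y) = rint (int (card A)) * y" if "finite A" for A :: "'b set" and y :: 'r
    using that by (induction A rule: finite_induct) (simp_all add: rint_add distrib_right)
  have "(\<Sum>g\<in>carrier G. inv_order * x) = rint (int (order G)) * (inv_order * x)"
    using const[OF finite_carrier] by (simp add: order_def)
  then show ?thesis by (simp add: mult.assoc[symmetric] order_inv_order)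
qed

abbreviation star_one :: "('g \<times> 'g) set \<Rightarrow> 'r" where
  "star_one \<equiv> \<lambda>N. rint (int (order G)) * bas (Delta G \<one>) N"

lemma star_one_left:
  fixes b :: "('g \<times> 'g) set \<Rightarrow> 'r"
  assumes b: "b \<in> free_mod GG" shows "star G G G star_one b = b"
proof
  fix N show "star G G G star_one b N = b N"
    using free_mod_zero[OF b, of N] conj_set_one[OF GG_group subgroup.subset, of N]
    by (simp add: star_smult_left star_Delta_left mult.assoc[symmetric] order_inv_order)
qed

lemma star_one_right:
  fixes b :: "('g \<times> 'g) set \<Rightarrow> 'r"
  assumes b: "b \<in> free_mod GG" shows "star G G G b star_one = b"
proof
  fix N show "star G G G b star_one N = b N"
    using free_mod_zero[OF b, of N] conj_set_one[OF GG_group subgroup.subset, of N]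
    by (simp add: star_smult_right star_Delta_right mult.assoc[symmetric] order_inv_order)
qed

lemma star_e_left:
  fixes b :: "('g \<times> 'g) set \<Rightarrow> 'r"
  assumes "subgroup N GG"
  shows "star G G G (e_elt G) b N = (\<Sum>g\<in>carrier G. inv_order * b (conj_set GG (g, \<one>) N))"
proof -
  have "star G G G (e_elt G) b N = (\<Sum>g\<in>carrier G. inv_order * b (conj_set GG (inv g, \<one>) N))"
    using assms by (simp add: e_elt_def star_sum_left star_Delta_left)
  also have "\<dots> = (\<Sum>g\<in>carrier G. inv_order * b (conj_set GG (g, \<one>) N))"
    by (rule sum.reindex_bij_witness[of _ "\<lambda>g. inv g" "\<lambda>g. inv g"]) auto
  finally show ?thesis .
qed

lemma star_e_right:
  fixes b :: "('g \<times> 'g) set \<Rightarrow> 'r"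
  assumes "subgroup N GG"
  shows "star G G G b (e_elt G) N = (\<Sum>g\<in>carrier G. inv_order * b (conj_set GG (\<one>, g) N))"
  using assms by (simp add: e_elt_def star_sum_right star_Delta_right)

text \<open>
  The factor on the left conjugates the first coordinate, the factor on the right the second one;
  each contributes one factor \<open>1 / |G|\<close>.
\<close>

lemma star_e_e_eq_average:
  fixes b :: "('g \<times> 'g) set \<Rightarrow> 'r"
  assumes N: "subgroup N GG"
  shows "star G G G (star G G G (e_elt G) b) (e_elt G) N
    = (\<Sum>x\<in>carrier GG. inv_order * inv_order * b (conj_set GG x N))"
proof -
  have "star G G G (star G G G (e_elt G) b) (e_elt G) N
    = (\<Sum>h\<in>carrier G. \<Sum>g\<in>carrier G. inv_order * inv_order * b (conj_set GG (g, h) N))"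
    using conj_set_subgroup[OF GG_group _ N] conj_set_conj_set[OF GG_group _ _ subgroup.subset[OF N]]
    by (simp add: star_e_right[OF N] star_e_left sum_distrib_left mult.assoc)
  also have "\<dots> = (\<Sum>g\<in>carrier G. \<Sum>h\<in>carrier G. inv_order * inv_order * b (conj_set GG (g, h) N))"
    by (rule sum.swap)
  also have "\<dots> = (\<Sum>x\<in>carrier GG. inv_order * inv_order * b (conj_set GG x N))"
    by (simp add: sum.cartesian_product DirProd_def case_prod_unfold)
  finally show ?thesis .
qed

lemma star_e_e_conj_fixed:
  fixes b :: "('g \<times> 'g) set \<Rightarrow> 'r"
  shows "star G G G (star G G G (e_elt G) b) (e_elt G) \<in> conj_fixed GG"
  unfolding conj_fixed_iff[OF GG_group GG_finite]
proof (intro conjI ballI allI impI)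
  show "star G G G (star G G G (e_elt G) b) (e_elt G) \<in> free_mod GG"
    by (rule star_in_free_mod) (fact is_group)+
next
  fix y N assume y: "y \<in> carrier GG" and N: "subgroup N GG"
  interpret D: group "GG" by (rule GG_group)
  let ?b = "\<lambda>x. inv_order * inv_order * b (conj_set GG x N)"
  have "star G G G (star G G G (e_elt G) b) (e_elt G) (conj_set GG y N)
     = (\<Sum>x\<in>carrier GG. ?b (x \<otimes>\<^bsub>GG\<^esub> y))"
    unfolding star_e_e_eq_average[OF conj_set_subgroup[OF GG_group y N]]
    by (intro sum.cong refl) (simp only: conj_set_conj_set[OF GG_group _ y subgroup.subset[OF N]])
  also have "\<dots> = (\<Sum>x\<in>carrier GG. ?b x)"
    by (rule sum.reindex_bij_witness[of _ "\<lambda>x. x \<otimes>\<^bsub>GG\<^esub> inv\<^bsub>GG\<^esub> y" "\<lambda>x. x \<otimes>\<^bsub>GG\<^esub> y"])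
      (use y in \<open>simp_all del: mult_DirProd carrier_DirProd inv_DirProd one_DirProd add: D.m_assoc\<close>)
  finally show "star G G G (star G G G (e_elt G) b) (e_elt G) (conj_set GG y N)
    = star G G G (star G G G (e_elt G) b) (e_elt G) N"
    by (simp only: star_e_e_eq_average[OF N])
qed

lemma star_e_left_conj_fixed:
  fixes b :: "('g \<times> 'g) set \<Rightarrow> 'r"
  assumes b: "b \<in> conj_fixed GG"
  shows "star G G G (e_elt G) b = b"
proof
  fix N show "star G G G (e_elt G) b N = b N"
  proof (cases "subgroup N GG")
    case True
    have "star G G G (e_elt G) b N = (\<Sum>g\<in>carrier G. inv_order * b N)"
      unfolding star_e_left[OF True]
      by (intro sum.cong refl) (use b True in \<open>simp add: conj_fixed_iff[OF GG_group GG_finite]\<close>)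
    then show ?thesis by (simp only: sum_carrier_const)
  next
    case False
    have "b \<in> free_mod GG" using b by (simp only: conj_fixed_def mem_Collect_eq)
    then show ?thesis using False
      by (simp add: free_mod_zero[OF star_in_free_mod[OF is_group is_group is_group]]
          free_mod_zero[of b "GG"])
  qed
qed

lemma star_e_right_conj_fixed:
  fixes b :: "('g \<times> 'g) set \<Rightarrow> 'r"
  assumes b: "b \<in> conj_fixed GG"
  shows "star G G G b (e_elt G) = b"
proof
  fix N show "star G G G b (e_elt G) N = b N"
  proof (cases "subgroup N GG")
    case True
    have "star G G G b (e_elt G) N = (\<Sum>g\<in>carrier G. inv_order * b N)"
      unfolding star_e_right[OF True]
      by (intro sum.cong refl) (use b True in \<open>simp add: conj_fixed_iff[OF GG_group GG_finite]\<close>)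
    then show ?thesis by (simp only: sum_carrier_const)
  next
    case False
    have "b \<in> free_mod GG" using b by (simp only: conj_fixed_def mem_Collect_eq)
    then show ?thesis using False
      by (simp add: free_mod_zero[OF star_in_free_mod[OF is_group is_group is_group]]
          free_mod_zero[of b "GG"])
  qed
qed

lemma e_elt_idempotent: "star G G G (e_elt G) (e_elt G) = (e_elt G :: ('g \<times> 'g) set \<Rightarrow> 'r)"
proof -
  have inv: "e_elt G (conj_set GG (g, \<one>) N) = (e_elt G N :: 'r)"
    if g: "g \<in> carrier G" and N: "subgroup N GG" for g N
  proof -
    have *: "conj_set GG (g, \<one>) N = Delta G (g \<otimes> h) \<longleftrightarrow> N = Delta G h" if "h \<in> carrier G" for h
    proof -
      have "conj_set GG (g, \<one>) N = conj_set GG (g, \<one>) (Delta G h) \<longleftrightarrow> N = Delta G h"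
        using conj_set_inv(2)[OF GG_group, of "(g, \<one>)"] g subgroup.subset[OF N] Delta_subset[OF that]
        by (metis (no_types, lifting) mem_Sigma_iff carrier_DirProd one_closed)
      then show ?thesis using conj_Delta[OF that g] by simp
    qed
    have "e_elt G (conj_set GG (g, \<one>) N)
        = (\<Sum>h\<in>carrier G. bas (Delta G (g \<otimes> h)) (conj_set GG (g, \<one>) N) :: 'r)"
      unfolding e_elt_def
      by (rule sum.reindex_bij_witness[of _ "\<lambda>h. g \<otimes> h" "\<lambda>h. inv g \<otimes> h"])
        (use g in \<open>simp_all add: m_assoc[symmetric]\<close>)
    also have "\<dots> = e_elt G N" unfolding e_elt_def by (intro sum.cong refl) (simp add: bas_def *)
    finally show ?thesis .
  qed
  show ?thesis
  proof
    fix N show "star G G G (e_elt G) (e_elt G) N = (e_elt G N :: 'r)"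
    proof (cases "subgroup N GG")
      case True
      have "star G G G (e_elt G) (e_elt G) N = (\<Sum>g\<in>carrier G. inv_order * e_elt G N)"
        unfolding star_e_left[OF True] by (intro sum.cong refl) (simp only: inv True)
      then show ?thesis by (simp only: sum_carrier_const)
    next
      case False
      then show ?thesis
        by (simp add: free_mod_zero[OF star_in_free_mod[OF is_group is_group is_group]]
            free_mod_zero[OF e_elt_free_mod])
    qed
  qed
qed

lemmas tstar_zeta = zeta_star[OF is_group is_group is_group finite_carrier finite_carrier finite_carrier,
    where 'r = 'r, symmetric]

abbreviation A :: "('r, ('g \<times> 'g) set \<Rightarrow> 'r) module" where "A \<equiv> ghost_algebra G"

lemma ghost_simps:
  "carrier A = free_mod GG" "a \<otimes>\<^bsub>A\<^esub> b = tstar G G G a b" "\<one>\<^bsub>A\<^esub> = zeta GG star_one"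
  "\<zero>\<^bsub>A\<^esub> = (\<lambda>N. 0)" "a \<oplus>\<^bsub>A\<^esub> b = (\<lambda>N. a N + b N)" "r \<odot>\<^bsub>A\<^esub> a = (\<lambda>N. r * a N)"
  by (simp_all add: ghost_algebra_def)

lemma zeta_ghost: "zeta GG a \<in> carrier A"
  by (simp add: ghost_simps zeta_in_free_mod[OF GG_finite])

lemma ghost_zeta_cases:
  assumes "x \<in> carrier A"
  obtains a where "a \<in> free_mod GG" "x = zeta GG a"
  using zeta_surj[OF GG_finite] assms by (metis ghost_simps(1))

lemma ghost_mult_zeta:
  "zeta GG a \<otimes>\<^bsub>A\<^esub> zeta GG b = zeta GG (star G G G a b)"
  by (simp add: ghost_simps tstar_zeta)

lemma ghost_add_zeta:
  "zeta GG a \<oplus>\<^bsub>A\<^esub> zeta GG b = zeta GG (\<lambda>N. a N + b N)"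
  by (simp add: ghost_simps zeta_add)

lemma ghost_ring: "ring A"
proof (rule ringI)
  show "abelian_group A"
  proof (rule abelian_groupI)
    fix x assume "x \<in> carrier A"
    then show "\<exists>y\<in>carrier A. y \<oplus>\<^bsub>A\<^esub> x = \<zero>\<^bsub>A\<^esub>"
      by (intro bexI[of _ "\<lambda>N. - x N"]) (auto simp: ghost_simps free_mod_def)
  qed (auto simp: ghost_simps free_mod_def add.assoc add.commute)
  show "Group.monoid A"
  proof (rule monoidI)
    fix x y z assume "x \<in> carrier A" "y \<in> carrier A" "z \<in> carrier A"
    then show "x \<otimes>\<^bsub>A\<^esub> y \<otimes>\<^bsub>A\<^esub> z = x \<otimes>\<^bsub>A\<^esub> (y \<otimes>\<^bsub>A\<^esub> z)"
      by (elim ghost_zeta_cases)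
        (simp add: ghost_mult_zeta star_assoc[OF is_group is_group is_group is_group
            finite_carrier finite_carrier finite_carrier finite_carrier])
  next
    fix x y assume "x \<in> carrier A" "y \<in> carrier A"
    then show "x \<otimes>\<^bsub>A\<^esub> y \<in> carrier A"
      by (elim ghost_zeta_cases) (simp add: ghost_mult_zeta zeta_ghost)
  next
    show "\<one>\<^bsub>A\<^esub> \<in> carrier A" by (simp add: ghost_simps zeta_in_free_mod[OF GG_finite])
  next
    fix x assume "x \<in> carrier A"
    then obtain a where a: "a \<in> free_mod GG" "x = zeta GG a" by (rule ghost_zeta_cases)
    show "\<one>\<^bsub>A\<^esub> \<otimes>\<^bsub>A\<^esub> x = x" "x \<otimes>\<^bsub>A\<^esub> \<one>\<^bsub>A\<^esub> = x"
      using star_one_left[OF a(1)] star_one_right[OF a(1)]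
      by (simp_all only: a(2) ghost_simps(3) ghost_mult_zeta)
  qed
next
  fix x y z assume "x \<in> carrier A" "y \<in> carrier A" "z \<in> carrier A"
  then show "(x \<oplus>\<^bsub>A\<^esub> y) \<otimes>\<^bsub>A\<^esub> z = x \<otimes>\<^bsub>A\<^esub> z \<oplus>\<^bsub>A\<^esub> y \<otimes>\<^bsub>A\<^esub> z"
    "z \<otimes>\<^bsub>A\<^esub> (x \<oplus>\<^bsub>A\<^esub> y) = z \<otimes>\<^bsub>A\<^esub> x \<oplus>\<^bsub>A\<^esub> z \<otimes>\<^bsub>A\<^esub> y"
    by (auto elim!: ghost_zeta_cases simp: ghost_mult_zeta ghost_add_zeta star_add_left star_add_right)
qed

lemma e_tilde_ghost: "e_tilde G \<in> carrier A"
  by (simp add: e_tilde_def zeta_ghost)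

lemma e_tilde_idempotent: "e_tilde G \<otimes>\<^bsub>A\<^esub> e_tilde G = e_tilde G"
  by (simp add: e_tilde_def ghost_mult_zeta e_elt_idempotent)

lemma conj_fixed_zeta_cases:
  assumes "x \<in> conj_fixed GG"
  obtains a :: "('g \<times> 'g) set \<Rightarrow> 'r" where "a \<in> conj_fixed GG" "x = zeta GG a"
proof -
  have "x \<in> carrier A" using assms by (simp add: conj_fixed_def ghost_simps)
  then obtain a where "a \<in> free_mod GG" "x = zeta GG a" by (rule ghost_zeta_cases)
  then show ?thesis using that assms zeta_conj_fixed_iff[OF GG_group GG_finite] by blast
qed

lemma conj_fixed_e_tilde:
  assumes "x \<in> conj_fixed GG"
  shows "e_tilde G \<otimes>\<^bsub>A\<^esub> x = x" "x \<otimes>\<^bsub>A\<^esub> e_tilde G = x"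
proof -
  obtain a :: "('g \<times> 'g) set \<Rightarrow> 'r" where a: "a \<in> conj_fixed GG" "x = zeta GG a"
    using assms by (rule conj_fixed_zeta_cases)
  show "e_tilde G \<otimes>\<^bsub>A\<^esub> x = x" "x \<otimes>\<^bsub>A\<^esub> e_tilde G = x"
    by (simp_all add: a(2) e_tilde_def ghost_mult_zeta star_e_left_conj_fixed[OF a(1)] star_e_right_conj_fixed[OF a(1)])
qed

text \<open>
  Fixed elements are their own averages, and averages are fixed.
\<close>

lemma conj_fixed_eq_corner:
  "conj_fixed GG = {e_tilde G \<otimes>\<^bsub>A\<^esub> a \<otimes>\<^bsub>A\<^esub> e_tilde G | a. a \<in> carrier A}"
proof (intro equalityI subsetI)
  fix x :: "('g \<times> 'g) set \<Rightarrow> 'r" assume x: "x \<in> conj_fixed GG"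
  then have "x = e_tilde G \<otimes>\<^bsub>A\<^esub> x \<otimes>\<^bsub>A\<^esub> e_tilde G" by (simp add: conj_fixed_e_tilde)
  moreover have "x \<in> carrier A" using x by (simp add: conj_fixed_def ghost_simps)
  ultimately show "x \<in> {e_tilde G \<otimes>\<^bsub>A\<^esub> a \<otimes>\<^bsub>A\<^esub> e_tilde G | a. a \<in> carrier A}" by blast
next
  fix x assume "x \<in> {e_tilde G \<otimes>\<^bsub>A\<^esub> a \<otimes>\<^bsub>A\<^esub> e_tilde G | a. a \<in> carrier A}"
  then obtain y where y: "x = e_tilde G \<otimes>\<^bsub>A\<^esub> y \<otimes>\<^bsub>A\<^esub> e_tilde G" "y \<in> carrier A" by blast
  from y(2) obtain a where a: "y = zeta GG a" by (rule ghost_zeta_cases)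
  have "x = zeta GG (star G G G (star G G G (e_elt G) a) (e_elt G))"
    by (simp add: y(1) a e_tilde_def ghost_mult_zeta)
  then show "x \<in> conj_fixed GG"
    using zeta_conj_fixed_iff[OF GG_group GG_finite, of "star G G G (star G G G (e_elt G) a) (e_elt G)"]
      star_e_e_conj_fixed[of a] by (simp add: conj_fixed_def)
qed

lemma conj_fixed_add_closed:
  fixes x y :: "('g \<times> 'g) set \<Rightarrow> 'r"
  assumes "x \<in> conj_fixed GG" "y \<in> conj_fixed GG"
  shows "(\<lambda>N. x N + y N) \<in> conj_fixed GG"
  using assms by (simp add: conj_fixed_iff[OF GG_group GG_finite] free_mod_def)

lemma conj_fixed_mult_closed:
  assumes x: "x \<in> conj_fixed GG" and y: "y \<in> conj_fixed GG"
  shows "x \<otimes>\<^bsub>A\<^esub> y \<in> conj_fixed GG"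
proof -
  interpret A: ring A by (rule ghost_ring)
  have xy: "x \<in> carrier A" "y \<in> carrier A" using x y by (simp_all add: conj_fixed_def ghost_simps)
  have "x \<otimes>\<^bsub>A\<^esub> y = e_tilde G \<otimes>\<^bsub>A\<^esub> (x \<otimes>\<^bsub>A\<^esub> y) \<otimes>\<^bsub>A\<^esub> e_tilde G"
    using xy e_tilde_ghost conj_fixed_e_tilde[OF x] conj_fixed_e_tilde[OF y]
    by (metis A.m_assoc A.m_closed)
  then show ?thesis unfolding conj_fixed_eq_corner using xy by blast
qed

lemma conj_fixed_subring: "nonunital_subring (conj_fixed GG) A"
  unfolding nonunital_subring_def
proof (intro conjI ballI conj_fixed_mult_closed)
  interpret A: ring A by (rule ghost_ring)
  have minus: "\<ominus>\<^bsub>A\<^esub> x = (\<lambda>N. - x N)" if "x \<in> carrier A" for x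
    by (rule A.minus_equality) (use that in \<open>simp_all add: ghost_simps free_mod_def\<close>)
  show "subgroup (conj_fixed GG) (add_monoid A)"
  proof (rule group.subgroupI)
    show "group (add_monoid A)" by (rule A.a_group)
    show "conj_fixed GG \<subseteq> carrier (add_monoid A)"
      by (auto simp: conj_fixed_def ghost_simps)
    show "conj_fixed GG \<noteq> ({} :: (('g \<times> 'g) set \<Rightarrow> 'r) set)"
      using conj_fixed_iff[OF GG_group GG_finite, of "\<lambda>N. 0 :: 'r"] by (auto simp: free_mod_def)
  next
    fix x :: "('g \<times> 'g) set \<Rightarrow> 'r" assume x: "x \<in> conj_fixed GG"
    then have "inv\<^bsub>add_monoid A\<^esub> x = (\<lambda>N. - x N)"
      using minus[of x] by (simp add: a_inv_def conj_fixed_def ghost_simps)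
    then show "inv\<^bsub>add_monoid A\<^esub> x \<in> conj_fixed GG"
      using x by (simp add: conj_fixed_iff[OF GG_group GG_finite] free_mod_def)
  next
    fix x y :: "('g \<times> 'g) set \<Rightarrow> 'r"
    assume "x \<in> conj_fixed GG" "y \<in> conj_fixed GG"
    then show "x \<otimes>\<^bsub>add_monoid A\<^esub> y \<in> conj_fixed GG"
      using conj_fixed_add_closed by (simp add: ghost_simps)
  qed
qed

end


section \<open>Finite sets with a group action\<close>

definition act_stab :: "'p monoid \<Rightarrow> ('p \<Rightarrow> 'x \<Rightarrow> 'x) \<Rightarrow> 'x \<Rightarrow> 'p set" where
  "act_stab P act x = {p \<in> carrier P. act p x = x}"

definition act_orbit :: "'p monoid \<Rightarrow> ('p \<Rightarrow> 'x \<Rightarrow> 'x) \<Rightarrow> 'x \<Rightarrow> 'x set" where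
  "act_orbit P act x = (\<lambda>p. act p x) ` carrier P"

definition stab_count :: "'p monoid \<Rightarrow> 'x set \<Rightarrow> ('p \<Rightarrow> 'x \<Rightarrow> 'x) \<Rightarrow> 'p set \<Rightarrow> nat" where
  "stab_count P S act V = card {x \<in> S. act_stab P act x = V}"

locale finite_action = finite_group P for P :: "'p monoid" (structure) +
  fixes S :: "'x set" and act :: "'p \<Rightarrow> 'x \<Rightarrow> 'x"
  assumes finite_points: "finite S"
    and act_closed: "p \<in> carrier P \<Longrightarrow> x \<in> S \<Longrightarrow> act p x \<in> S"
    and act_one: "x \<in> S \<Longrightarrow> act \<one> x = x"
    and act_mult: "p \<in> carrier P \<Longrightarrow> q \<in> carrier P \<Longrightarrow> x \<in> S \<Longrightarrow> act (p \<otimes> q) x = act p (act q x)"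
begin

abbreviation "stab \<equiv> act_stab P act"
abbreviation "orb \<equiv> act_orbit P act"

lemma act_inv: "p \<in> carrier P \<Longrightarrow> x \<in> S \<Longrightarrow> act (inv p) (act p x) = x"
  by (simp add: act_mult[symmetric] act_one)

lemma act_inv': "p \<in> carrier P \<Longrightarrow> x \<in> S \<Longrightarrow> act p (act (inv p) x) = x"
  by (simp add: act_mult[symmetric] act_one)

lemma act_eq_iff:
  assumes p: "p \<in> carrier P" and q: "q \<in> carrier P" and x: "x \<in> S"
  shows "act p x = act q x \<longleftrightarrow> inv p \<otimes> q \<in> stab x"
proof -
  have "inv p \<otimes> q \<in> stab x \<longleftrightarrow> act (inv p) (act q x) = x"
    using p q x by (simp add: act_stab_def act_mult)
  also have "\<dots> \<longleftrightarrow> act p x = act q x"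
    using act_inv[OF p x] act_inv'[OF p act_closed[OF q x]] by metis
  finally show ?thesis ..
qed

lemma stab_subgroup: "x \<in> S \<Longrightarrow> subgroup (stab x) P"
proof (rule subgroupI)
  assume x: "x \<in> S"
  show "stab x \<subseteq> carrier P" by (auto simp: act_stab_def)
  show "stab x \<noteq> {}" using x by (auto simp: act_stab_def act_one)
  fix p assume p: "p \<in> stab x"
  then have "act (inv p) x = x" using x act_inv[of p x] by (simp add: act_stab_def)
  then show "inv p \<in> stab x" using p by (simp add: act_stab_def)
next
  fix p q assume "x \<in> S" "p \<in> stab x" "q \<in> stab x"
  then show "p \<otimes> q \<in> stab x" by (simp add: act_stab_def act_mult)
qed

lemma orb_subset: "x \<in> S \<Longrightarrow> orb x \<subseteq> S"
  by (auto simp: act_orbit_def act_closed)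

lemma orb_self: "x \<in> S \<Longrightarrow> x \<in> orb x"
  unfolding act_orbit_def by (rule image_eqI[of _ _ \<one>]) (simp_all add: act_one)

lemma finite_orb: "finite (orb x)"
  by (simp add: act_orbit_def finite_carrier)

lemma orb_closed: "x \<in> S \<Longrightarrow> p \<in> carrier P \<Longrightarrow> z \<in> orb x \<Longrightarrow> act p z \<in> orb x"
  by (auto simp: act_orbit_def act_mult[symmetric])

lemma orb_closed_iff:
  assumes "x \<in> S" "p \<in> carrier P" "z \<in> S"
  shows "act p z \<in> orb x \<longleftrightarrow> z \<in> orb x"
  using orb_closed[OF assms(1,2), of z] orb_closed[OF assms(1), of "inv p" "act p z"] assms
  by (auto simp: act_inv)

lemma orb_eq:
  assumes x: "x \<in> S" and z: "z \<in> orb x"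
  shows "orb z = orb x"
proof -
  have *: "orb w \<subseteq> orb y" if "y \<in> S" "w \<in> orb y" for w y
    using that orb_closed[OF that(1) _ that(2)] by (auto simp: act_orbit_def[of P act w])
  obtain p where p: "p \<in> carrier P" "z = act p x" using z by (auto simp: act_orbit_def)
  have "x = act (inv p) z" using p x by (simp add: act_inv)
  then have "x \<in> orb z" using p by (auto simp: act_orbit_def)
  then show ?thesis using *[OF x z] *[of z x] z orb_subset[OF x] by blast
qed

lemma stab_act:
  assumes p: "p \<in> carrier P" and x: "x \<in> S"
  shows "stab (act p x) = conj_set P p (stab x)"
proof
  show "conj_set P p (stab x) \<subseteq> stab (act p x)"
  proof
    fix q assume "q \<in> conj_set P p (stab x)"
    then obtain s where s: "s \<in> carrier P" "act s x = x" "q = p \<otimes> s \<otimes> inv p"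
      by (auto simp: conj_set_def act_stab_def)
    then show "q \<in> stab (act p x)"
      using p x by (simp add: act_stab_def act_mult act_inv act_closed)
  qed
  show "stab (act p x) \<subseteq> conj_set P p (stab x)"
  proof
    fix q assume "q \<in> stab (act p x)"
    then have q: "q \<in> carrier P" "act q (act p x) = act p x" by (auto simp: act_stab_def)
    have "inv p \<otimes> q \<otimes> p \<in> stab x" using p q x by (simp add: act_stab_def act_mult act_closed act_inv)
    moreover have "q = p \<otimes> (inv p \<otimes> q \<otimes> p) \<otimes> inv p"
      using p q by (simp add: m_assoc) (simp add: m_assoc[symmetric])
    ultimately show "q \<in> conj_set P p (stab x)" unfolding conj_set_def by blast
  qed
qed

text \<open>
  The group elements that move \<open>x\<close> to \<open>y\<close> form a coset of the stabilizer of \<open>y\<close>.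
\<close>

lemma card_transporter:
  assumes x: "x \<in> S" and y: "y \<in> orb x"
  shows "card {p \<in> carrier P. act p x = y} = card (stab y)"
proof -
  obtain p0 where p0: "p0 \<in> carrier P" "y = act p0 x" using y by (auto simp: act_orbit_def)
  have "bij_betw (\<lambda>q. q \<otimes> p0) (stab y) {p \<in> carrier P. act p x = y}"
    by (rule bij_betwI[where g = "\<lambda>p. p \<otimes> inv p0"])
      (use p0 x in \<open>auto simp: act_stab_def act_mult m_assoc act_closed act_inv\<close>)
  from bij_betw_same_card[OF this] show ?thesis ..
qed

lemma orbit_weighted_sum:
  fixes f :: "'x \<Rightarrow> nat"
  assumes x: "x \<in> S"
  shows "(\<Sum>y\<in>orb x. card (stab y) * f y) = (\<Sum>p\<in>carrier P. f (act p x))"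
proof -
  have "(\<Sum>p\<in>carrier P. f (act p x)) = (\<Sum>y\<in>orb x. \<Sum>p | p \<in> carrier P \<and> act p x = y. f (act p x))"
    unfolding act_orbit_def by (rule sum.image_gen[OF finite_carrier])
  also have "\<dots> = (\<Sum>y\<in>orb x. card (stab y) * f y)"
    by (intro sum.cong refl) (simp add: card_transporter[OF x, symmetric])
  finally show ?thesis ..
qed

lemma sum_orbit_card_stab: "x \<in> S \<Longrightarrow> (\<Sum>y\<in>orb x. card (stab y)) = order P"
  using orbit_weighted_sum[of x "\<lambda>_. 1"] by (simp add: order_def)

text \<open>
  This expresses the stabilizer counts of an orbit by the stabilizer of a single point: the
  stabilizers of its points are the conjugates of the latter.
\<close>

lemma stab_count_orbit:
  assumes x: "x \<in> S"
  shows "card V * stab_count P (orb x) act V = card {p \<in> carrier P. conj_set P p (stab x) = V}"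
proof -
  have "card V * stab_count P (orb x) act V = (\<Sum>y\<in>{y \<in> orb x. stab y = V}. card (stab y))"
    by (simp add: stab_count_def)
  also have "\<dots> = (\<Sum>y\<in>orb x. card (stab y) * (if stab y = V then 1 else 0))"
    by (rule sum.mono_neutral_cong_left) (auto simp: finite_orb)
  also have "\<dots> = (\<Sum>p\<in>carrier P. if conj_set P p (stab x) = V then 1 else 0)"
    unfolding orbit_weighted_sum[OF x] by (intro sum.cong refl) (simp add: stab_act[OF _ x])
  also have "\<dots> = card {p \<in> carrier P. conj_set P p (stab x) = V}"
    using finite_carrier by (simp add: sum.If_cases Int_def)
  finally show ?thesis .
qed

lemma stab_count_not_subgroup: "\<not> subgroup V P \<Longrightarrow> stab_count P S act V = 0"
  unfolding stab_count_def using stab_subgroup by (metis (mono_tags, lifting) card.empty equals0I mem_Collect_eq)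

lemma stab_count_pos: "x \<in> S \<Longrightarrow> stab_count P S act (stab x) > 0"
  unfolding stab_count_def using finite_points by (auto simp: card_gt_0_iff)

lemma subaction:
  assumes "T \<subseteq> S" "\<And>p x. p \<in> carrier P \<Longrightarrow> x \<in> T \<Longrightarrow> act p x \<in> T"
  shows "finite_action P T act"
proof (unfold_locales)
  show "finite T" using assms(1) finite_points by (rule finite_subset)
qed (use assms act_one act_mult in auto)

lemma orbit_action: "x \<in> S \<Longrightarrow> finite_action P (orb x) act"
  by (rule subaction[OF orb_subset]) (simp_all add: orb_closed)

lemma orbit_complement_action: "x \<in> S \<Longrightarrow> finite_action P (S - orb x) act"
  by (rule subaction) (auto simp: orb_closed_iff act_closed)

lemma stab_count_split:
  assumes "O' \<subseteq> S"
  shows "stab_count P S act V = stab_count P O' act V + stab_count P (S - O') act V"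
proof -
  have "{x \<in> S. stab x = V} = {x \<in> O'. stab x = V} \<union> {x \<in> S - O'. stab x = V}" using assms by auto
  moreover have "finite {x \<in> O'. stab x = V}" "finite {x \<in> S - O'. stab x = V}"
    using finite_points assms by (auto intro: finite_subset)
  moreover have "{x \<in> O'. stab x = V} \<inter> {x \<in> S - O'. stab x = V} = {}" by auto
  ultimately show ?thesis unfolding stab_count_def by (simp add: card_Un_disjoint)
qed

end

lemma stab_count_orbit_eq:
  assumes S: "finite_action P S a" and T: "finite_action P T b" and x: "x \<in> S" and y: "y \<in> T"
    and eq: "act_stab P a x = act_stab P b y"
  shows "stab_count P (act_orbit P a x) a V = stab_count P (act_orbit P b y) b V"
proof -
  interpret S: finite_action P S a by fact
  interpret T: finite_action P T b by fact
  show ?thesis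
  proof (cases "subgroup V P")
    case True
    then have "V \<noteq> {}" "finite V"
      using subgroup.one_closed[OF True] finite_subset[OF subgroup.subset[OF True] S.finite_carrier] by auto
    then have "card V > 0" by (simp add: card_gt_0_iff)
    then show ?thesis using S.stab_count_orbit[OF x, of V] T.stab_count_orbit[OF y, of V] eq
      by (metis mult_cancel1 less_not_refl)
  next
    case False
    then show ?thesis
      using finite_action.stab_count_not_subgroup[OF S.orbit_action[OF x]]
        finite_action.stab_count_not_subgroup[OF T.orbit_action[OF y]] by simp
  qed
qed

text \<open>
  The map \<open>p x \<mapsto> p y\<close> is well defined and injective because the stabilizers agree.
\<close>

lemma orbit_isomorphism:
  assumes S: "finite_action P S a" and T: "finite_action P T b" and x: "x \<in> S" and y: "y \<in> T"
    and eq: "act_stab P a x = act_stab P b y"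
  shows "\<exists>g. bij_betw g (act_orbit P a x) (act_orbit P b y) \<and> (\<forall>p\<in>carrier P. g (a p x) = b p y)"
proof -
  interpret S: finite_action P S a by fact
  interpret T: finite_action P T b by fact
  define g where "g z = b (SOME p. p \<in> carrier P \<and> a p x = z) y" for z
  have eqv: "a p x = a q x \<longleftrightarrow> b p y = b q y" if "p \<in> carrier P" "q \<in> carrier P" for p q
    using that S.act_eq_iff[OF that x] T.act_eq_iff[OF that y] eq by simp
  have g: "g (a p x) = b p y" if p: "p \<in> carrier P" for p
  proof -
    let ?q = "SOME q. q \<in> carrier P \<and> a q x = a p x"
    have "?q \<in> carrier P \<and> a ?q x = a p x" by (rule someI[of _ p]) (simp add: p)
    then show ?thesis unfolding g_def using eqv[of ?q p] p by simp
  qed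
  have "inj_on g (act_orbit P a x)" using g eqv by (auto simp: inj_on_def act_orbit_def)
  moreover have "g ` act_orbit P a x = act_orbit P b y"
    unfolding act_orbit_def image_image by (rule image_cong[OF refl g])
  ultimately have "bij_betw g (act_orbit P a x) (act_orbit P b y)" by (simp add: bij_betw_def)
  then show ?thesis using g by blast
qed

text \<open>
  A point \<open>x\<close> of \<open>S\<close> has a partner \<open>y\<close> in \<open>T\<close> with the same stabilizer. Their orbits are isomorphic
  and have equal counts, so the counts of the complements agree as well, and induction applies to them.
\<close>

theorem stab_count_eq_imp_isomorphic:
  assumes "finite_action P S a" "finite_action P T b"
    and "\<And>V. stab_count P S a V = stab_count P T b V"
  shows "\<exists>f. bij_betw f S T \<and> (\<forall>p\<in>carrier P. \<forall>x\<in>S. f (a p x) = b p (f x))"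
  using assms
proof (induction "card S" arbitrary: S T rule: less_induct)
  case less
  interpret S: finite_action P S a by (rule less.prems)
  interpret T: finite_action P T b by (rule less.prems)
  show ?case
  proof (cases "S = {}")
    case True
    have "T = {}"
    proof (rule ccontr)
      assume "T \<noteq> {}"
      then obtain y where "y \<in> T" by auto
      from T.stab_count_pos[OF this] show False
        using less.prems(3)[of "act_stab P b y"] True by (simp add: stab_count_def)
    qed
    then show ?thesis using True by (simp add: bij_betw_def)
  next
    case False
    then obtain x where x: "x \<in> S" by auto
    have "stab_count P T b (act_stab P a x) > 0"
      using S.stab_count_pos[OF x] less.prems(3) by simp
    then obtain y where y: "y \<in> T" "act_stab P b y = act_stab P a x"
      unfolding stab_count_def by (metis (mono_tags, lifting) card_gt_0_iff equals0I mem_Collect_eq)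
    let ?O = "act_orbit P a x" and ?Q = "act_orbit P b y"
    obtain g where g: "bij_betw g ?O ?Q" "\<And>p. p \<in> carrier P \<Longrightarrow> g (a p x) = b p y"
      using orbit_isomorphism[OF less.prems(1,2) x y(1) y(2)[symmetric]] by blast
    have "card (S - ?O) < card S"
      using S.orb_self[OF x] x S.finite_points by (intro psubset_card_mono) auto
    moreover have "stab_count P (S - ?O) a V = stab_count P (T - ?Q) b V" for V
      using less.prems(3)[of V] S.stab_count_split[OF S.orb_subset[OF x], of V]
        T.stab_count_split[OF T.orb_subset[OF y(1)], of V]
        stab_count_orbit_eq[OF less.prems(1,2) x y(1) y(2)[symmetric], of V] by simp
    ultimately obtain f where f: "bij_betw f (S - ?O) (T - ?Q)"
      "\<And>p z. p \<in> carrier P \<Longrightarrow> z \<in> S - ?O \<Longrightarrow> f (a p z) = b p (f z)"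
      using less.hyps[OF _ S.orbit_complement_action[OF x] T.orbit_complement_action[OF y(1)]] by blast
    let ?f = "\<lambda>z. if z \<in> ?O then g z else f z"
    have "bij_betw ?f (?O \<union> (S - ?O)) (?Q \<union> (T - ?Q))"
    proof (rule bij_betw_combine)
      show "bij_betw ?f ?O ?Q" using g(1) by (simp cong: bij_betw_cong)
      have "bij_betw ?f (S - ?O) (T - ?Q) \<longleftrightarrow> bij_betw f (S - ?O) (T - ?Q)"
        by (rule bij_betw_cong) auto
      then show "bij_betw ?f (S - ?O) (T - ?Q)" using f(1) by simp
    qed auto
    moreover have "?O \<union> (S - ?O) = S" "?Q \<union> (T - ?Q) = T"
      using S.orb_subset[OF x] T.orb_subset[OF y(1)] by auto
    moreover have "?f (a p z) = b p (?f z)" if p: "p \<in> carrier P" and z: "z \<in> S" for p z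
    proof (cases "z \<in> ?O")
      case True
      then obtain q where q: "q \<in> carrier P" "z = a q x" by (auto simp: act_orbit_def)
      have "g (a p z) = b p (g z)"
        using p q x y(1) g(2)[of "p \<otimes>\<^bsub>P\<^esub> q"] g(2)[of q] by (simp add: S.act_mult T.act_mult)
      then show ?thesis using True S.orb_closed[OF x p True] by simp
    next
      case False
      then show ?thesis using S.orb_closed_iff[OF x p z] f(2)[OF p] z by simp
    qed
    ultimately show ?thesis by (intro exI[of _ ?f]) simp
  qed
qed

lemma isomorphic_imp_stab_count_eq:
  assumes f: "bij_betw f S T" and eqv: "\<And>p x. p \<in> carrier P \<Longrightarrow> x \<in> S \<Longrightarrow> f (a p x) = b p (f x)"
    and closed: "\<And>p x. p \<in> carrier P \<Longrightarrow> x \<in> S \<Longrightarrow> a p x \<in> S"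
  shows "stab_count P S a V = stab_count P T b V"
proof -
  have inj: "inj_on f S" and T: "T = f ` S" using f by (simp_all add: bij_betw_def)
  have st: "act_stab P b (f x) = act_stab P a x" if x: "x \<in> S" for x
  proof -
    have "b p (f x) = f x \<longleftrightarrow> a p x = x" if p: "p \<in> carrier P" for p
      by (simp only: eqv[OF p x, symmetric] inj_on_eq_iff[OF inj closed[OF p x] x])
    then show ?thesis by (auto simp: act_stab_def)
  qed
  have "f ` {x \<in> S. act_stab P a x = V} = {y \<in> T. act_stab P b y = V}"
    unfolding T using st by auto
  then have "bij_betw f {x \<in> S. act_stab P a x = V} {y \<in> T. act_stab P b y = V}"
    by (intro bij_betw_imageI inj_on_subset[OF inj]) auto
  then show ?thesis unfolding stab_count_def by (rule bij_betw_same_card)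
qed


section \<open>Bisets and their stabilizer counts\<close>

definition biset_act :: "'h monoid \<Rightarrow> ('x, 'g, 'h) biset \<Rightarrow> 'g \<times> 'h \<Rightarrow> 'x \<Rightarrow> 'x" where
  "biset_act H X = (\<lambda>(g, h) x. lact X g (ract X x (inv\<^bsub>H\<^esub> h)))"

abbreviation biset_stab :: "'g monoid \<Rightarrow> 'h monoid \<Rightarrow> ('x, 'g, 'h) biset \<Rightarrow> 'x \<Rightarrow> ('g \<times> 'h) set" where
  "biset_stab G H X \<equiv> act_stab (G \<times>\<times> H) (biset_act H X)"

definition biset_count :: "'g monoid \<Rightarrow> 'h monoid \<Rightarrow> ('x, 'g, 'h) biset \<Rightarrow> ('g \<times> 'h) set \<Rightarrow> nat" where
  "biset_count G H X = stab_count (G \<times>\<times> H) (points X) (biset_act H X)"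

lemma is_bisetD:
  assumes "is_biset G H X"
  shows "finite (points X)"
    and "\<And>g x. g \<in> carrier G \<Longrightarrow> x \<in> points X \<Longrightarrow> lact X g x \<in> points X"
    and "\<And>x. x \<in> points X \<Longrightarrow> lact X \<one>\<^bsub>G\<^esub> x = x"
    and "\<And>g g' x. g \<in> carrier G \<Longrightarrow> g' \<in> carrier G \<Longrightarrow> x \<in> points X \<Longrightarrow>
      lact X (g \<otimes>\<^bsub>G\<^esub> g') x = lact X g (lact X g' x)"
    and "\<And>h x. h \<in> carrier H \<Longrightarrow> x \<in> points X \<Longrightarrow> ract X x h \<in> points X"
    and "\<And>x. x \<in> points X \<Longrightarrow> ract X x \<one>\<^bsub>H\<^esub> = x"
    and "\<And>h h' x. h \<in> carrier H \<Longrightarrow> h' \<in> carrier H \<Longrightarrow> x \<in> points X \<Longrightarrow>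
      ract X x (h \<otimes>\<^bsub>H\<^esub> h') = ract X (ract X x h) h'"
    and "\<And>g h x. g \<in> carrier G \<Longrightarrow> h \<in> carrier H \<Longrightarrow> x \<in> points X \<Longrightarrow>
      ract X (lact X g x) h = lact X g (ract X x h)"
  using assms unfolding is_biset_def by simp_all

lemma finite_group_DirProd: "finite_group G \<Longrightarrow> finite_group H \<Longrightarrow> finite_group (G \<times>\<times> H)"
  by (simp add: finite_group_def finite_group_axioms_def DirProd_group finite_carrier_DirProd del: carrier_DirProd)

lemma biset_action:
  assumes "finite_group G" "finite_group H" and X: "is_biset G H X"
  shows "finite_action (G \<times>\<times> H) (points X) (biset_act H X)"
proof -
  interpret G: finite_group G by fact
  interpret H: finite_group H by fact
  note b = is_bisetD[OF X]
  have "finite_action_axioms (G \<times>\<times> H) (points X) (biset_act H X)"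
  proof
    show "finite (points X)" by (rule b)
  next
    fix p x assume "p \<in> carrier (G \<times>\<times> H)" "x \<in> points X"
    then show "biset_act H X p x \<in> points X" by (auto simp: biset_act_def b)
  next
    fix x assume "x \<in> points X"
    then show "biset_act H X \<one>\<^bsub>G \<times>\<times> H\<^esub> x = x" by (simp add: biset_act_def b)
  next
    fix p q x assume "p \<in> carrier (G \<times>\<times> H)" "q \<in> carrier (G \<times>\<times> H)" "x \<in> points X"
    then show "biset_act H X (p \<otimes>\<^bsub>G \<times>\<times> H\<^esub> q) x = biset_act H X p (biset_act H X q x)"
      by (auto simp: biset_act_def b H.inv_mult_group)
  qed
  then show ?thesis
    by (simp add: finite_action_def finite_group_DirProd assms)
qed

text \<open>
  Henceforth isomorphisms of bisets are obtained by comparing stabilizer counts.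
\<close>

lemma biset_iso_iff_count:
  assumes G: "finite_group G" and H: "finite_group H" and X: "is_biset G H X" and Y: "is_biset G H Y"
  shows "biset_iso G H X Y \<longleftrightarrow> biset_count G H X = biset_count G H Y"
proof
  interpret G: finite_group G by fact
  interpret H: finite_group H by fact
  interpret X: finite_action "G \<times>\<times> H" "points X" "biset_act H X" by (rule biset_action[OF G H X])
  note b = is_bisetD[OF X] and c = is_bisetD[OF Y]
  {
    assume "biset_iso G H X Y"
    then obtain f where f: "bij_betw f (points X) (points Y)"
      and l: "\<And>g x. g \<in> carrier G \<Longrightarrow> x \<in> points X \<Longrightarrow> f (lact X g x) = lact Y g (f x)"
      and r: "\<And>h x. h \<in> carrier H \<Longrightarrow> x \<in> points X \<Longrightarrow> f (ract X x h) = ract Y (f x) h"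
      unfolding biset_iso_def by blast
    show "biset_count G H X = biset_count G H Y"
    proof
      fix V show "biset_count G H X V = biset_count G H Y V"
        unfolding biset_count_def
        by (rule isomorphic_imp_stab_count_eq[OF f])
          (auto simp: X.act_closed biset_act_def l r b)
    qed
  next
    assume "biset_count G H X = biset_count G H Y"
    then have "stab_count (G \<times>\<times> H) (points X) (biset_act H X) V = stab_count (G \<times>\<times> H) (points Y) (biset_act H Y) V" for V
      by (simp add: biset_count_def)
    from stab_count_eq_imp_isomorphic[OF biset_action[OF G H X] biset_action[OF G H Y] this]
    obtain f where f: "bij_betw f (points X) (points Y)"
      and e: "\<And>p x. p \<in> carrier (G \<times>\<times> H) \<Longrightarrow> x \<in> points X \<Longrightarrow> f (biset_act H X p x) = biset_act H Y p (f x)"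
      by blast
    have fY: "f x \<in> points Y" if "x \<in> points X" for x using f that by (auto simp: bij_betw_def)
    have "f (lact X g x) = lact Y g (f x)" if "g \<in> carrier G" "x \<in> points X" for g x
      using e[of "(g, \<one>\<^bsub>H\<^esub>)" x] that fY by (simp add: biset_act_def b c)
    moreover have "f (ract X x h) = ract Y (f x) h" if "h \<in> carrier H" "x \<in> points X" for h x
      using e[of "(\<one>\<^bsub>G\<^esub>, inv\<^bsub>H\<^esub> h)" x] that fY by (simp add: biset_act_def b c)
    ultimately show "biset_iso G H X Y" unfolding biset_iso_def using f by blast
  }
qed

text \<open>
  Turns an action of \<open>G \<times> H\<close> into a biset. The inverse in the right action cancels the one in
  \<open>biset_act\<close>.
\<close>

definition action_biset :: "'g monoid \<Rightarrow> 'h monoid \<Rightarrow> 'x set \<Rightarrow> ('g \<times> 'h \<Rightarrow> 'x \<Rightarrow> 'x) \<Rightarrow> ('x, 'g, 'h) biset" where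
  "action_biset G H S a = \<lparr>points = S, lact = (\<lambda>g. a (g, \<one>\<^bsub>H\<^esub>)), ract = (\<lambda>x h. a (\<one>\<^bsub>G\<^esub>, inv\<^bsub>H\<^esub> h) x)\<rparr>"

lemma action_biset:
  assumes G: "finite_group G" and H: "finite_group H" and S: "finite_action (G \<times>\<times> H) S a"
  shows "is_biset G H (action_biset G H S a)"
    and "biset_count G H (action_biset G H S a) = stab_count (G \<times>\<times> H) S a"
proof -
  interpret G: finite_group G by fact
  interpret H: finite_group H by fact
  interpret S: finite_action "G \<times>\<times> H" S a by fact
  have cl: "a (g, h) x \<in> S" if "g \<in> carrier G" "h \<in> carrier H" "x \<in> S" for g h x
    using that by (simp add: S.act_closed)
  have one: "a (\<one>\<^bsub>G\<^esub>, \<one>\<^bsub>H\<^esub>) x = x" if "x \<in> S" for x using S.act_one[OF that] by simp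
  have mult: "a (g, h) (a (g', h') x) = a (g \<otimes>\<^bsub>G\<^esub> g', h \<otimes>\<^bsub>H\<^esub> h') x"
    if "g \<in> carrier G" "h \<in> carrier H" "g' \<in> carrier G" "h' \<in> carrier H" "x \<in> S" for g h g' h' x
    using S.act_mult[of "(g, h)" "(g', h')" x] that by simp
  show "is_biset G H (action_biset G H S a)"
    by (simp add: is_biset_def action_biset_def S.finite_points cl one mult H.inv_mult_group)
  have "biset_act H (action_biset G H S a) p x = a p x" if "p \<in> carrier (G \<times>\<times> H)" "x \<in> S" for p x
    using that by (auto simp: biset_act_def action_biset_def mult)
  then have "act_stab (G \<times>\<times> H) (biset_act H (action_biset G H S a)) x = act_stab (G \<times>\<times> H) a x" if "x \<in> S" for x
    using that by (auto simp: act_stab_def)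
  then have "{x \<in> S. act_stab (G \<times>\<times> H) (biset_act H (action_biset G H S a)) x = V}
     = {x \<in> S. act_stab (G \<times>\<times> H) a x = V}" for V by auto
  then show "biset_count G H (action_biset G H S a) = stab_count (G \<times>\<times> H) S a"
    by (intro ext) (simp add: biset_count_def stab_count_def, simp add: action_biset_def)
qed

text \<open>
  Isomorphism classes consist of bisets whose points are natural numbers. This lemma provides
  members for the class of a biset with any type of points.
\<close>

lemma biset_nat_copy:
  assumes G: "finite_group G" and H: "finite_group H" and X: "is_biset G H X"
  shows "\<exists>Y::(nat, 'g, 'h) biset. is_biset (G :: 'g monoid) (H :: 'h monoid) Y \<and> biset_count G H Y = biset_count G H X"
proof -
  interpret X: finite_action "G \<times>\<times> H" "points X" "biset_act H X" by (rule biset_action[OF G H X])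
  obtain f :: "_ \<Rightarrow> nat" where f: "inj_on f (points X)"
    using finite_imp_inj_to_nat_seg[OF X.finite_points] by blast
  let ?f' = "the_inv_into (points X) f"
  let ?b = "\<lambda>p i. f (biset_act H X p (?f' i))"
  have inv: "?f' (f x) = x" if "x \<in> points X" for x using f that by (rule the_inv_into_f_f)
  have "finite_action_axioms (G \<times>\<times> H) (f ` points X) ?b"
    by standard (auto simp: X.finite_points X.act_closed X.act_mult inv simp del: carrier_DirProd mult_DirProd one_DirProd
        intro: X.act_one[THEN arg_cong])
  then have S: "finite_action (G \<times>\<times> H) (f ` points X) ?b"
    by (simp add: finite_action_def finite_group_DirProd G H)
  have "stab_count (G \<times>\<times> H) (points X) (biset_act H X) V = stab_count (G \<times>\<times> H) (f ` points X) ?b V" for V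
    by (rule isomorphic_imp_stab_count_eq[of f]) (use f in \<open>simp_all add: bij_betw_def inv X.act_closed\<close>)
  then have "biset_count G H (action_biset G H (f ` points X) ?b) = biset_count G H X"
    unfolding action_biset(2)[OF G H S] by (auto simp: biset_count_def)
  then show ?thesis using action_biset(1)[OF G H S] by blast
qed

lemma iso_class_of_eq:
  assumes "finite_group G" "finite_group H" "is_biset G H X"
  shows "iso_class_of G H X = {Y. is_biset G H Y \<and> biset_count G H X = biset_count G H Y}"
  unfolding iso_class_of_def using biset_iso_iff_count[OF assms] by blast

lemma iso_class_of_nonempty:
  assumes "finite_group G" "finite_group H" "is_biset G H X"
  shows "iso_class_of G H X \<noteq> {}"
  using biset_nat_copy[OF assms] unfolding iso_class_of_eq[OF assms] by fastforce

lemma iso_class_of_cong: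
  assumes "finite_group G" "finite_group H" "is_biset G H X" "is_biset G H Y"
    and "biset_count G H X = biset_count G H Y"
  shows "iso_class_of G H X = iso_class_of G H Y"
  using assms by (simp add: iso_class_of_eq)

lemma iso_class_of_in_iso_classes:
  assumes "finite_group G" "finite_group H" "is_biset G H X"
  shows "iso_class_of G H X \<in> iso_classes G H"
proof -
  obtain Y :: "(nat, _, _) biset" where Y: "is_biset G H Y" "biset_count G H Y = biset_count G H X"
    using biset_nat_copy[OF assms] by blast
  have "iso_class_of G H X = iso_class_of G H Y"
    by (rule iso_class_of_cong) (use assms Y in simp_all)
  then show ?thesis using Y(1) unfolding iso_classes_def by blast
qed

lemma biset_sum:
  fixes X :: "('x, 'g, 'h) biset" and Y :: "('y, 'g, 'h) biset"
  assumes G: "finite_group G" and H: "finite_group H" and X: "is_biset G H X" and Y: "is_biset G H Y"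
  shows "is_biset G H (biset_sum X Y)"
    and "biset_count G H (biset_sum X Y) V = biset_count G H X V + biset_count G H Y V"
proof -
  note b = is_bisetD[OF X] and c = is_bisetD[OF Y]
  show "is_biset G H (biset_sum X Y)"
    unfolding is_biset_def biset_sum_def by (auto simp: b c)
  have st: "biset_stab G H (biset_sum X Y) (Inl x) = biset_stab G H X x"
    "biset_stab G H (biset_sum X Y) (Inr y) = biset_stab G H Y y" for x y
    by (auto simp: act_stab_def biset_act_def biset_sum_def)
  have pts: "points (biset_sum X Y) = Inl ` points X \<union> Inr ` points Y"
    by (auto simp: biset_sum_def)
  have "{z \<in> points (biset_sum X Y). biset_stab G H (biset_sum X Y) z = V}
    = Inl ` {x \<in> points X. biset_stab G H X x = V} \<union> Inr ` {y \<in> points Y. biset_stab G H Y y = V}"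
    by (auto simp: pts st)
  moreover have "finite {x \<in> points X. biset_stab G H X x = V}" "finite {y \<in> points Y. biset_stab G H Y y = V}"
    using b(1) c(1) by auto
  moreover have "Inl ` A \<inter> Inr ` B = {}" for A :: "'x set" and B :: "'y set" by auto
  ultimately show "biset_count G H (biset_sum X Y) V = biset_count G H X V + biset_count G H Y V"
    unfolding biset_count_def stab_count_def by (simp add: card_Un_disjoint card_image)
qed

lemma biset_stab_subgroup:
  assumes "finite_group G" "finite_group H" "is_biset G H X" "x \<in> points X"
  shows "subgroup (biset_stab G H X x) (G \<times>\<times> H)"
  using finite_action.stab_subgroup[OF biset_action[OF assms(1-3)] assms(4)] .

lemma sum_over_stabilizers:
  fixes f :: "_ \<Rightarrow> nat"
  assumes G: "finite_group G" and H: "finite_group H" and X: "is_biset G H X"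
  shows "(\<Sum>x\<in>points X. f (biset_stab G H X x)) = (\<Sum>L\<in>subgroups_of (G \<times>\<times> H). biset_count G H X L * f L)"
proof -
  have fin: "finite (subgroups_of (G \<times>\<times> H))"
    by (rule finite_subgroups_of) (rule finite_group.finite_carrier[OF finite_group_DirProd[OF G H]])
  have "(\<Sum>x\<in>points X. f (biset_stab G H X x))
    = (\<Sum>L\<in>subgroups_of (G \<times>\<times> H). \<Sum>x\<in>{x. x \<in> points X \<and> biset_stab G H X x = L}. f (biset_stab G H X x))"
    by (rule sum.group[symmetric]) (use is_bisetD(1)[OF X] fin biset_stab_subgroup[OF G H X] in auto)
  also have "\<dots> = (\<Sum>L\<in>subgroups_of (G \<times>\<times> H). biset_count G H X L * f L)"
    by (intro sum.cong refl) (simp add: biset_count_def stab_count_def)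
  finally show ?thesis .
qed

lemma card_fixed_points:
  assumes G: "finite_group G" and H: "finite_group H" and X: "is_biset G H X"
    and U: "U \<subseteq> carrier (G \<times>\<times> H)"
  shows "card (fixed_points H X U) = (\<Sum>V | V \<in> subgroups_of (G \<times>\<times> H) \<and> U \<subseteq> V. biset_count G H X V)"
proof -
  have fin: "finite (subgroups_of (G \<times>\<times> H))"
    by (rule finite_subgroups_of) (rule finite_group.finite_carrier[OF finite_group_DirProd[OF G H]])
  have "fixed_points H X U = {x \<in> points X. U \<subseteq> biset_stab G H X x}"
    using U by (auto simp: fixed_points_def act_stab_def biset_act_def)
  then have "card (fixed_points H X U) = (\<Sum>x\<in>points X. if U \<subseteq> biset_stab G H X x then 1 else 0)"
    using is_bisetD(1)[OF X] by (simp add: sum.If_cases Int_def)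
  also have "\<dots> = (\<Sum>V\<in>subgroups_of (G \<times>\<times> H). biset_count G H X V * (if U \<subseteq> V then 1 else 0))"
    by (rule sum_over_stabilizers[OF G H X])
  also have "\<dots> = (\<Sum>V | V \<in> subgroups_of (G \<times>\<times> H) \<and> U \<subseteq> V. biset_count G H X V)"
    by (rule sum.mono_neutral_cong_right) (use fin in auto)
  finally show ?thesis .
qed


section \<open>Stabilizers in the tensor product of bisets\<close>

text \<open>
  The action on pairs whose orbits are the points of \<open>biset_tensor\<close>.
\<close>

definition middle_act :: "'h monoid \<Rightarrow> ('x, 'g, 'h) biset \<Rightarrow> ('y, 'h, 'k) biset \<Rightarrow> 'h \<Rightarrow> 'x \<times> 'y \<Rightarrow> 'x \<times> 'y" where
  "middle_act H X Y h = (\<lambda>(x, y). (ract X x (inv\<^bsub>H\<^esub> h), lact Y h y))"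

locale biset_tensor_product = G: finite_group G + H: finite_group H + K: finite_group K
  for G :: "'g monoid" and H :: "'h monoid" and K :: "'k monoid" +
  fixes X :: "('x, 'g, 'h) biset" and Y :: "('y, 'h, 'k) biset"
  assumes X: "is_biset G H X" and Y: "is_biset H K Y"
begin

lemmas bX = is_bisetD[OF X] and bY = is_bisetD[OF Y]

abbreviation "T \<equiv> biset_tensor H X Y"
abbreviation "mid \<equiv> act_orbit H (middle_act H X Y)"

lemma middle_action: "finite_action H (points X \<times> points Y) (middle_act H X Y)"
  by standard (auto simp: middle_act_def bX bY H.inv_mult_group)

sublocale M: finite_action H "points X \<times> points Y" "middle_act H X Y" by (rule middle_action)

lemma mid_alt: "mid (x, y) = {(ract X x (inv\<^bsub>H\<^esub> h), lact Y h y) | h. h \<in> carrier H}"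
  by (auto simp: act_orbit_def middle_act_def)

lemma points_tensor: "points T = mid ` (points X \<times> points Y)"
proof -
  have "points T = {mid (x, y) | x y. x \<in> points X \<and> y \<in> points Y}"
    by (simp add: biset_tensor_def mid_alt)
  then show ?thesis by auto
qed

lemma lact_tensor:
  assumes "g \<in> carrier G" "x \<in> points X" "y \<in> points Y"
  shows "lact T g (mid (x, y)) = mid (lact X g x, y)"
proof -
  have "(\<lambda>(x, y). (lact X g x, y)) ` mid (x, y) = mid (lact X g x, y)"
    unfolding act_orbit_def image_image
    by (rule image_cong[OF refl]) (use assms in \<open>simp add: middle_act_def bX\<close>)
  then show ?thesis by (simp add: biset_tensor_def)
qed

lemma ract_tensor:
  assumes "k \<in> carrier K" "x \<in> points X" "y \<in> points Y"
  shows "ract T (mid (x, y)) k = mid (x, ract Y y k)"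
proof -
  have "(\<lambda>(x, y). (x, ract Y y k)) ` mid (x, y) = mid (x, ract Y y k)"
    unfolding act_orbit_def image_image
    by (rule image_cong[OF refl]) (use assms in \<open>simp add: middle_act_def bY\<close>)
  then show ?thesis by (simp add: biset_tensor_def)
qed

lemmas act_tensor = lact_tensor ract_tensor

lemma tensor_is_biset: "is_biset G K T"
  unfolding is_biset_def points_tensor
  by (auto simp: act_tensor bX bY)

text \<open>
  The pair \<open>(g, k)\<close> fixes the orbit of \<open>(x, y)\<close> iff some \<open>h\<close> satisfies \<open>g x = x h\<close> and
  \<open>y k\<^sup>-\<^sup>1 = h\<^sup>-\<^sup>1 y\<close>, which says that \<open>(g, h)\<close> fixes \<open>x\<close> and \<open>(h, k)\<close> fixes \<open>y\<close>.
\<close>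

lemma tensor_stab:
  assumes x: "x \<in> points X" and y: "y \<in> points Y"
  shows "biset_stab G K T (mid (x, y)) = biset_stab G H X x O biset_stab H K Y y"
proof -
  have *: "biset_act K T (g, k) (mid (x, y)) = mid (x, y)
      \<longleftrightarrow> (\<exists>h\<in>carrier H. (g, h) \<in> biset_stab G H X x \<and> (h, k) \<in> biset_stab H K Y y)"
    if g: "g \<in> carrier G" and k: "k \<in> carrier K" for g k
  proof -
    let ?x = "lact X g x" and ?y = "ract Y y (inv\<^bsub>K\<^esub> k)"
    have p: "?x \<in> points X" "?y \<in> points Y" using x y g k by (simp_all add: bX bY)
    have "biset_act K T (g, k) (mid (x, y)) = mid (?x, ?y)"
      using x y g k by (simp add: biset_act_def act_tensor bX bY)
    moreover have "mid (?x, ?y) = mid (x, y) \<longleftrightarrow> (?x, ?y) \<in> mid (x, y)"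
      using M.orb_eq[of "(x, y)" "(?x, ?y)"] M.orb_self[of "(?x, ?y)"] x y p by auto
    moreover have "(?x, ?y) \<in> mid (x, y) \<longleftrightarrow> (\<exists>h\<in>carrier H. ?x = ract X x (inv\<^bsub>H\<^esub> h) \<and> ?y = lact Y h y)"
      unfolding mid_alt by auto
    moreover have "\<dots> \<longleftrightarrow> (\<exists>h\<in>carrier H. ?x = ract X x h \<and> ?y = lact Y (inv\<^bsub>H\<^esub> h) y)"
      by (metis H.inv_closed H.inv_inv)
    moreover have "?x = ract X x h \<longleftrightarrow> (g, h) \<in> biset_stab G H X x" if h: "h \<in> carrier H" for h
    proof -
      have "ract X (ract X ?x (inv\<^bsub>H\<^esub> h)) h = ?x" "ract X (ract X x h) (inv\<^bsub>H\<^esub> h) = x"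
        using x p h by (simp_all add: bX(7)[symmetric] bX(5,6))
      then have "?x = ract X x h \<longleftrightarrow> ract X ?x (inv\<^bsub>H\<^esub> h) = x" by metis
      then show ?thesis using g h x by (simp add: act_stab_def biset_act_def bX)
    qed
    moreover have "?y = lact Y (inv\<^bsub>H\<^esub> h) y \<longleftrightarrow> (h, k) \<in> biset_stab H K Y y" if h: "h \<in> carrier H" for h
    proof -
      have "lact Y (inv\<^bsub>H\<^esub> h) (lact Y h ?y) = ?y" "lact Y h (lact Y (inv\<^bsub>H\<^esub> h) y) = y"
        using y p h by (simp_all add: bY(4)[symmetric] bY(2,3))
      then have "?y = lact Y (inv\<^bsub>H\<^esub> h) y \<longleftrightarrow> lact Y h ?y = y" by metis
      then show ?thesis using k h y by (simp add: act_stab_def biset_act_def)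
    qed
    ultimately show ?thesis by simp
  qed
  show ?thesis
  proof (rule equalityI; rule subsetI)
    fix p assume "p \<in> biset_stab G K T (mid (x, y))"
    then show "p \<in> biset_stab G H X x O biset_stab H K Y y"
      using * by (cases p) (auto simp: act_stab_def[of "G \<times>\<times> K"])
  next
    fix p assume "p \<in> biset_stab G H X x O biset_stab H K Y y"
    then obtain g h k where p: "p = (g, k)" "(g, h) \<in> biset_stab G H X x" "(h, k) \<in> biset_stab H K Y y" by auto
    then have "g \<in> carrier G" "h \<in> carrier H" "k \<in> carrier K" by (simp_all add: act_stab_def)
    then show "p \<in> biset_stab G K T (mid (x, y))"
      using * p by (auto simp: act_stab_def[of "G \<times>\<times> K"])
  qed
qed

lemma middle_stab:
  assumes x: "x \<in> points X" and y: "y \<in> points Y"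
  shows "M.stab (x, y) = k2 G H (biset_stab G H X x) \<inter> k1 H K (biset_stab H K Y y)"
  using x y by (auto simp: act_stab_def middle_act_def k1_def k2_def biset_act_def bX bY)

text \<open>
  By \<open>middle_stab\<close> the summands are orders of stabilizers under \<open>middle_act\<close>. Over one orbit, that is
  over one point of the tensor product, they add up to the order of \<open>H\<close>.
\<close>

lemma tensor_count_points:
  "order H * biset_count G K T N = (\<Sum>x\<in>points X. \<Sum>y\<in>points Y.
     if biset_stab G H X x O biset_stab H K Y y = N
     then card (k2 G H (biset_stab G H X x) \<inter> k1 H K (biset_stab H K Y y)) else 0)"
proof -
  let ?Z = "points X \<times> points Y"
  let ?f = "\<lambda>z. if biset_stab G K T (mid z) = N then card (M.stab z) else 0"
  have fin: "finite ?Z" by (simp add: bX bY)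
  have "(\<Sum>x\<in>points X. \<Sum>y\<in>points Y.
     if biset_stab G H X x O biset_stab H K Y y = N
     then card (k2 G H (biset_stab G H X x) \<inter> k1 H K (biset_stab H K Y y)) else 0) = sum ?f ?Z"
    unfolding sum.cartesian_product
  proof (rule sum.cong[OF refl])
    fix z assume "z \<in> ?Z"
    then obtain x y where "z = (x, y)" "x \<in> points X" "y \<in> points Y" by auto
    then show "(case z of (x, y) \<Rightarrow> if biset_stab G H X x O biset_stab H K Y y = N
       then card (k2 G H (biset_stab G H X x) \<inter> k1 H K (biset_stab H K Y y)) else 0) = ?f z"
      by (simp add: tensor_stab middle_stab)
  qed
  also have "\<dots> = (\<Sum>Q\<in>points T. \<Sum>z | z \<in> ?Z \<and> mid z = Q. ?f z)"
    unfolding points_tensor by (rule sum.image_gen[OF fin])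
  also have "\<dots> = (\<Sum>Q\<in>points T. if biset_stab G K T Q = N then order H else 0)"
  proof (intro sum.cong refl)
    fix Q assume "Q \<in> points T"
    then obtain z0 where z0: "z0 \<in> ?Z" "Q = mid z0" by (auto simp: points_tensor)
    have Q: "{z. z \<in> ?Z \<and> mid z = Q} = mid z0"
      using M.orb_self M.orb_eq[OF z0(1)] M.orb_subset[OF z0(1)] z0 by blast
    have "(\<Sum>z | z \<in> ?Z \<and> mid z = Q. ?f z) = (\<Sum>z | z \<in> ?Z \<and> mid z = Q. if biset_stab G K T Q = N then card (M.stab z) else 0)"
      by (rule sum.cong) auto
    also have "\<dots> = (if biset_stab G K T Q = N then order H else 0)"
      unfolding Q using M.sum_orbit_card_stab[OF z0(1)] by simp
    finally show "(\<Sum>z | z \<in> ?Z \<and> mid z = Q. ?f z) = (if biset_stab G K T Q = N then order H else 0)" .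
  qed
  also have "\<dots> = order H * biset_count G K T N"
    using is_bisetD(1)[OF tensor_is_biset]
    by (simp add: biset_count_def stab_count_def sum.If_cases Int_def)
  finally show ?thesis ..
qed

lemma tensor_count:
  "order H * biset_count G K T N = (\<Sum>L\<in>subgroups_of (G \<times>\<times> H). \<Sum>M\<in>subgroups_of (H \<times>\<times> K).
     biset_count G H X L * biset_count H K Y M * (if L O M = N then card (k2 G H L \<inter> k1 H K M) else 0))"
  unfolding tensor_count_points
    sum_over_stabilizers[OF H.finite_group_axioms K.finite_group_axioms Y,
      of "\<lambda>M. if _ O M = N then card (k2 G H _ \<inter> k1 H K M) else 0"]
    sum_over_stabilizers[OF G.finite_group_axioms H.finite_group_axioms X,
      of "\<lambda>L. \<Sum>M\<in>subgroups_of (H \<times>\<times> K). biset_count H K Y M * (if L O M = N then card (k2 G H L \<inter> k1 H K M) else 0)"]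
  by (simp add: sum_distrib_left mult.assoc)

end


section \<open>Transitive bisets\<close>

text \<open>
  The left cosets of \<open>U\<close> are the orbit of \<open>U\<close> when the group acts on all of its subsets by
  translation, and \<open>U\<close> is its own stabilizer.
\<close>

definition translate :: "'p monoid \<Rightarrow> 'p \<Rightarrow> 'p set \<Rightarrow> 'p set" where
  "translate P p C = (\<lambda>q. p \<otimes>\<^bsub>P\<^esub> q) ` C"

definition coset_biset :: "'g monoid \<Rightarrow> 'h monoid \<Rightarrow> ('g \<times> 'h) set \<Rightarrow> (('g \<times> 'h) set, 'g, 'h) biset" where
  "coset_biset G H U =
     action_biset G H (act_orbit (G \<times>\<times> H) (translate (G \<times>\<times> H)) U) (translate (G \<times>\<times> H))"

lemma translate_action:
  assumes "finite_group P" shows "finite_action P (Pow (carrier P)) (translate P)"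
proof -
  interpret finite_group P by fact
  show ?thesis
  proof
    show "finite (Pow (carrier P))" by (simp add: finite_carrier)
  next
    fix p C assume "p \<in> carrier P" "C \<in> Pow (carrier P)"
    then show "translate P p C \<in> Pow (carrier P)" by (auto simp: translate_def)
  next
    fix C assume "C \<in> Pow (carrier P)"
    then have "translate P \<one>\<^bsub>P\<^esub> C = id ` C" unfolding translate_def by (intro image_cong) auto
    then show "translate P \<one>\<^bsub>P\<^esub> C = C" by simp
  next
    fix p q C assume "p \<in> carrier P" "q \<in> carrier P" "C \<in> Pow (carrier P)"
    then show "translate P (p \<otimes>\<^bsub>P\<^esub> q) C = translate P p (translate P q C)"
      unfolding translate_def image_image by (intro image_cong refl) (auto simp: m_assoc)
  qed
qed

lemma translate_stab:
  assumes "finite_group P" and U: "subgroup U P"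
  shows "act_stab P (translate P) U = U"
proof -
  interpret finite_group P by fact
  interpret U: subgroup U P by fact
  have "translate P p U = U \<longleftrightarrow> p \<in> U" if p: "p \<in> carrier P" for p
  proof
    assume "translate P p U = U"
    moreover have "p \<otimes>\<^bsub>P\<^esub> \<one>\<^bsub>P\<^esub> \<in> translate P p U" unfolding translate_def by (rule imageI) simp
    ultimately show "p \<in> U" using p by simp
  next
    assume pU: "p \<in> U"
    show "translate P p U = U"
    proof
      show "translate P p U \<subseteq> U" using pU by (auto simp: translate_def)
      show "U \<subseteq> translate P p U"
      proof
        fix u assume u: "u \<in> U"
        then have "u = p \<otimes>\<^bsub>P\<^esub> (inv\<^bsub>P\<^esub> p \<otimes>\<^bsub>P\<^esub> u)" using p U.mem_carrier by (simp add: m_assoc[symmetric])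
        then show "u \<in> translate P p U" unfolding translate_def using pU u by blast
      qed
    qed
  qed
  then show ?thesis using U.subset by (auto simp: act_stab_def)
qed

lemma coset_biset:
  assumes G: "finite_group G" and H: "finite_group H" and U: "subgroup U (G \<times>\<times> H)"
  shows "is_biset G H (coset_biset G H U)"
    and "card V * biset_count G H (coset_biset G H U) V
       = card {p \<in> carrier (G \<times>\<times> H). conj_set (G \<times>\<times> H) p U = V}"
    and "\<lbrakk>is_biset G H X; x \<in> points X; biset_stab G H X x = U\<rbrakk> \<Longrightarrow>
       biset_count G H (X\<lparr>points := act_orbit (G \<times>\<times> H) (biset_act H X) x\<rparr>) = biset_count G H (coset_biset G H U)"
proof -
  note GH = finite_group_DirProd[OF G H]
  interpret P: finite_action "G \<times>\<times> H" "Pow (carrier (G \<times>\<times> H))" "translate (G \<times>\<times> H)"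
    by (rule translate_action[OF GH])
  have UP: "U \<in> Pow (carrier (G \<times>\<times> H))" using subgroup.subset[OF U] by simp
  note cb = action_biset[OF G H P.orbit_action[OF UP], folded coset_biset_def]
  show "is_biset G H (coset_biset G H U)" by (rule cb(1))
  show "card V * biset_count G H (coset_biset G H U) V
       = card {p \<in> carrier (G \<times>\<times> H). conj_set (G \<times>\<times> H) p U = V}"
    using P.stab_count_orbit[OF UP, of V] by (simp add: cb(2) translate_stab[OF GH U])
  assume X: "is_biset G H X" and x: "x \<in> points X" and xU: "biset_stab G H X x = U"
  show "biset_count G H (X\<lparr>points := act_orbit (G \<times>\<times> H) (biset_act H X) x\<rparr>) = biset_count G H (coset_biset G H U)"
  proof
    fix V
    have "biset_act H (X\<lparr>points := act_orbit (G \<times>\<times> H) (biset_act H X) x\<rparr>) = biset_act H X"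
      by (simp add: biset_act_def)
    then show "biset_count G H (X\<lparr>points := act_orbit (G \<times>\<times> H) (biset_act H X) x\<rparr>) V
      = biset_count G H (coset_biset G H U) V"
      unfolding cb(2) using stab_count_orbit_eq[OF biset_action[OF G H X] P.finite_action_axioms x UP, of V]
      by (simp add: biset_count_def xU translate_stab[OF GH U])
  qed
qed

lemma sub_biset:
  assumes "finite_group G" "finite_group H" "is_biset G H X" and S: "finite_action (G \<times>\<times> H) S (biset_act H X)" "S \<subseteq> points X"
  shows "is_biset G H (X\<lparr>points := S\<rparr>)"
proof -
  interpret G: finite_group G by fact
  interpret H: finite_group H by fact
  interpret S: finite_action "G \<times>\<times> H" S "biset_act H X" by fact
  note b = is_bisetD[OF assms(3)]
  have "lact X g x \<in> S" if "g \<in> carrier G" "x \<in> S" for g x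
    using S.act_closed[of "(g, \<one>\<^bsub>H\<^esub>)" x] that S(2) by (auto simp: biset_act_def b)
  moreover have "ract X x h \<in> S" if "h \<in> carrier H" "x \<in> S" for h x
    using S.act_closed[of "(\<one>\<^bsub>G\<^esub>, inv\<^bsub>H\<^esub> h)" x] that S(2) by (auto simp: biset_act_def b subsetD)
  ultimately show ?thesis using S.finite_points S(2) b unfolding is_biset_def by (auto simp: subsetD)
qed


section \<open>Presented abelian groups\<close>

abbreviation keys :: "('a \<Rightarrow>\<^sub>0 int) \<Rightarrow> 'a set" where "keys \<equiv> Poly_Mapping.keys"
abbreviation lookup :: "('a \<Rightarrow>\<^sub>0 int) \<Rightarrow> 'a \<Rightarrow> int" where "lookup \<equiv> Poly_Mapping.lookup"

text \<open>
  For \<open>h x k = k * w x\<close> this is the additivity of the linear extension of \<open>w\<close>.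
\<close>

lemma frag_weighted_sum_add:
  fixes h :: "'a \<Rightarrow> int \<Rightarrow> 'b::ab_group_add"
  assumes h: "\<And>x a b. h x (a + b) = h x a + h x b"
  shows "(\<Sum>x\<in>keys (p + q). h x (lookup (p + q) x))
    = (\<Sum>x\<in>keys p. h x (lookup p x))
      + (\<Sum>x\<in>keys q. h x (lookup q x))"
proof -
  have h0: "h x 0 = 0" for x using h[of x 0 0] by simp
  let ?K = "keys p \<union> keys q"
  have ext: "(\<Sum>x\<in>keys r. h x (lookup r x)) = (\<Sum>x\<in>?K. h x (lookup r x))"
    if "keys r \<subseteq> ?K" for r
    by (rule sum.mono_neutral_left) (use that h0 in \<open>auto simp: in_keys_iff\<close>)
  show ?thesis
    using ext[OF keys_add] ext[of p] ext[of q] by (simp add: lookup_add h sum.distrib)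
qed

lemma frag_bilin_add_left: "frag_bilin f (p + p') q = frag_bilin f p q + frag_bilin f p' q"
  by (simp add: frag_bilin_def frag_extend_add)

lemma frag_bilin_diff_left: "frag_bilin f (p - p') q = frag_bilin f p q - frag_bilin f p' q"
  by (simp add: frag_bilin_def frag_extend_diff)

lemma frag_bilin_alt:
  "frag_bilin f p q = (\<Sum>x\<in>keys p. \<Sum>y\<in>keys q.
      frag_cmul (lookup p x * lookup q y) (f x y))"
  by (simp add: frag_bilin_def frag_extend_def frag_cmul_sum o_def)

lemma frag_bilin_swap: "frag_bilin f p q = frag_bilin (\<lambda>y x. f x y) q p"
  unfolding frag_bilin_alt
  by (subst sum.swap) (simp only: mult.commute)

lemma frag_bilin_add_right: "frag_bilin f p (q + q') = frag_bilin f p q + frag_bilin f p q'"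
  by (simp add: frag_bilin_swap[of f p] frag_bilin_add_left)

lemma frag_bilin_diff_right: "frag_bilin f p (q - q') = frag_bilin f p q - frag_bilin f p q'"
  by (simp add: frag_bilin_swap[of f p] frag_bilin_diff_left)

lemma frag_bilin_zero: "frag_bilin f 0 q = 0" "frag_bilin f p 0 = 0"
  using frag_bilin_diff_left[of f 0 0 q] frag_bilin_diff_right[of f p 0 0] by simp_all

lemma frag_bilin_of: "frag_bilin f (frag_of x) (frag_of y) = f x y"
  by (simp add: frag_bilin_def)

lemmas frag_on_induct = free_Abelian_group_induct [consumes 1, case_names zero diff of]

text \<open>
  The Burnside group and the tensor product over the integers both are free abelian groups modulo the
  subgroup \<open>N\<close> generated by given relations. Operations on their elements are defined through
  representatives; the lemmas \<open>coset_value\<close>, \<open>coset_unary_map\<close> and \<open>coset_binary_map\<close> reduce the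
  independence of the representatives to a check on the generating relations.
\<close>

locale presented_group =
  fixes S :: "'a set" and Rel :: "('a \<Rightarrow>\<^sub>0 int) set"
  assumes Rel_keys: "\<And>p. p \<in> Rel \<Longrightarrow> keys p \<subseteq> S"
begin

abbreviation "F \<equiv> free_Abelian_group S"
abbreviation "N \<equiv> generate F Rel"
abbreviation "Q \<equiv> F Mod N"
abbreviation "coset p \<equiv> N #>\<^bsub>F\<^esub> p"

lemma Rel_subset: "Rel \<subseteq> carrier F"
  using Rel_keys by auto

lemma N_subgroup: "subgroup N F"
  by (rule group.generate_is_subgroup[OF group_free_Abelian_group Rel_subset])

lemma N_keys: "p \<in> N \<Longrightarrow> keys p \<subseteq> S"
  using subgroup.mem_carrier[OF N_subgroup] by simp

lemma N_zero: "0 \<in> N"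
  using subgroup.one_closed[OF N_subgroup] by simp

lemma N_add: "p \<in> N \<Longrightarrow> q \<in> N \<Longrightarrow> p + q \<in> N"
  using subgroup.m_closed[OF N_subgroup, of p q] by simp

lemma N_minus: "p \<in> N \<Longrightarrow> - p \<in> N"
  using subgroup.m_inv_closed[OF N_subgroup, of p] N_keys by simp

lemma N_diff: "p \<in> N \<Longrightarrow> q \<in> N \<Longrightarrow> p - q \<in> N"
  using N_add[of p "- q"] N_minus[of q] by simp

lemma N_Rel: "p \<in> Rel \<Longrightarrow> p \<in> N"
  by (rule generate.incl)

lemma N_induct [consumes 1, case_names rel zero diff]:
  assumes "p \<in> N" and rel: "\<And>p. p \<in> Rel \<Longrightarrow> P p" and zero: "P 0"
    and diff: "\<And>p q. p \<in> N \<Longrightarrow> q \<in> N \<Longrightarrow> P p \<Longrightarrow> P q \<Longrightarrow> P (p - q)"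
  shows "P p"
  using assms(1)
proof (induction p rule: generate.induct)
  case one
  then show ?case using zero by simp
next
  case (incl h)
  then show ?case by (rule rel)
next
  case (inv h)
  then have "P (0 - h)" by (intro diff) (simp_all add: zero rel N_zero N_Rel)
  then show ?case using Rel_keys[OF inv] by simp
next
  case (eng p q)
  have "P (p - (0 - q))" using eng by (intro diff) (simp_all add: zero N_zero N_minus)
  then show ?case by simp
qed

lemma mem_coset: "q \<in> coset p \<longleftrightarrow> q - p \<in> N"
proof
  assume "q \<in> coset p"
  then show "q - p \<in> N" by (auto simp: r_coset_def)
next
  assume "q - p \<in> N"
  moreover have "q = q - p + p" by simp
  ultimately show "q \<in> coset p" by (force simp: r_coset_def)
qed

lemma coset_eq_iff: "coset p = coset q \<longleftrightarrow> p - q \<in> N"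
proof
  assume "coset p = coset q"
  moreover have "p \<in> coset p" by (simp add: mem_coset N_zero)
  ultimately show "p - q \<in> N" by (simp add: mem_coset)
next
  assume pq: "p - q \<in> N"
  have "r - p \<in> N \<longleftrightarrow> r - q \<in> N" for r
    using N_add[OF _ pq, of "r - p"] N_diff[OF _ pq, of "r - q"] by auto
  then show "coset p = coset q" by (auto simp: mem_coset)
qed

lemma coset_self: "p \<in> coset p"
  by (simp add: mem_coset N_zero)

lemma coset_keys: "keys p \<subseteq> S \<Longrightarrow> q \<in> coset p \<Longrightarrow> keys q \<subseteq> S"
  using N_keys[of "q - p"] keys_add[of "q - p" p] by (auto simp: mem_coset)

lemma carrier_Q: "carrier Q = coset ` {p. keys p \<subseteq> S}"
  by (auto simp: carrier_FactGroup)

lemma coset_in_Q: "keys p \<subseteq> S \<Longrightarrow> coset p \<in> carrier Q"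
  unfolding carrier_Q by blast

lemma Q_cases:
  assumes "A \<in> carrier Q"
  obtains p where "keys p \<subseteq> S" "A = coset p"
  using assms unfolding carrier_Q by blast

lemma Q_comm_group: "comm_group Q"
  by (rule comm_group.abelian_FactGroup[OF abelian_free_Abelian_group N_subgroup])

lemma Q_mult: "keys p \<subseteq> S \<Longrightarrow> keys q \<subseteq> S \<Longrightarrow> coset p \<otimes>\<^bsub>Q\<^esub> coset q = coset (p + q)"
  using normal.rcos_sum[OF comm_group.subgroup_imp_normal[OF abelian_free_Abelian_group N_subgroup], of p q] by simp

lemma Q_one: "\<one>\<^bsub>Q\<^esub> = coset 0"
  by (auto simp: mem_coset)

lemma Q_inv: "keys p \<subseteq> S \<Longrightarrow> inv\<^bsub>Q\<^esub> coset p = coset (- p)"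
proof -
  interpret Q: comm_group Q by (rule Q_comm_group)
  assume p: "keys p \<subseteq> S"
  show ?thesis
    by (rule Q.inv_equality) (use p in \<open>simp_all only: Q_mult coset_in_Q keys_minus Q_one ab_left_minus\<close>)
qed

text \<open>
  The closure condition includes inverses because the generators need not generate the group as a
  monoid.
\<close>

lemma Q_induct [consumes 1, case_names of one diff]:
  assumes A: "A \<in> carrier Q" and gen: "\<And>x. x \<in> S \<Longrightarrow> P (coset (frag_of x))"
    and one: "P \<one>\<^bsub>Q\<^esub>"
    and mult: "\<And>A B. A \<in> carrier Q \<Longrightarrow> B \<in> carrier Q \<Longrightarrow> P A \<Longrightarrow> P B \<Longrightarrow> P (A \<otimes>\<^bsub>Q\<^esub> inv\<^bsub>Q\<^esub> B)"
  shows "P A"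
proof -
  obtain p where p: "keys p \<subseteq> S" "A = coset p" using A by (rule Q_cases)
  have "keys p \<subseteq> S \<Longrightarrow> P (coset p)" for p
  proof (induction p rule: frag_on_induct)
    case zero
    then show ?case using one by (simp only: Q_one)
  next
    case (diff x y)
    have "P (coset x \<otimes>\<^bsub>Q\<^esub> inv\<^bsub>Q\<^esub> coset y)" using diff by (intro mult) (simp_all only: coset_in_Q)
    also have "coset x \<otimes>\<^bsub>Q\<^esub> inv\<^bsub>Q\<^esub> coset y = coset (x - y)"
      using diff by (simp only: Q_inv Q_mult keys_minus diff_conv_add_uminus)
    finally show ?case .
  next
    case (of a)
    then show ?case by (rule gen)
  qed
  then show ?thesis using p by simp
qed

lemma coset_value:
  fixes \<phi> :: "('a \<Rightarrow>\<^sub>0 int) \<Rightarrow> 'b::ab_group_add"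
  assumes add: "\<And>p q. \<phi> (p + q) = \<phi> p + \<phi> q" and rel: "\<And>p. p \<in> Rel \<Longrightarrow> \<phi> p = 0"
  shows "the_elem (\<phi> ` coset p) = \<phi> p"
proof -
  have zero: "\<phi> 0 = 0" using add[of 0 0] by simp
  have diff: "\<phi> (p - q) = \<phi> p - \<phi> q" for p q using add[of "p - q" q] by simp
  have N: "\<phi> n = 0" if "n \<in> N" for n
    using that by (induction rule: N_induct) (simp_all add: rel zero diff)
  have "\<phi> q = \<phi> p" if "q \<in> coset p" for q
  proof -
    have "\<phi> q - \<phi> p = 0" using N[of "q - p"] that unfolding mem_coset diff by blast
    then show ?thesis by (rule eq_iff_diff_eq_0[THEN iffD2])
  qed
  then have "\<phi> ` coset p = {\<phi> p}" using coset_self[of p] by blast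
  then show ?thesis by simp
qed

lemma coset_unary_map:
  assumes f: "\<And>r. r \<in> Rel \<Longrightarrow> frag_extend f r \<in> N"
  shows "(\<Union>s\<in>coset p. coset (frag_extend f s)) = coset (frag_extend f p)"
proof -
  have N: "frag_extend f n \<in> N" if "n \<in> N" for n
    using that by (induction rule: N_induct) (simp_all add: f N_zero frag_extend_diff N_diff)
  have "coset (frag_extend f s) = coset (frag_extend f p)" if "s \<in> coset p" for s
    using N[of "s - p"] that by (simp add: coset_eq_iff mem_coset frag_extend_diff)
  then show ?thesis using coset_self[of p] by blast
qed

lemma coset_binary_map:
  assumes left: "\<And>r y. r \<in> Rel \<Longrightarrow> y \<in> S \<Longrightarrow> frag_extend (\<lambda>x. f x y) r \<in> N"
    and right: "\<And>r x. r \<in> Rel \<Longrightarrow> x \<in> S \<Longrightarrow> frag_extend (f x) r \<in> N"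
    and p: "keys p \<subseteq> S" and q: "keys q \<subseteq> S"
  shows "(\<Union>s\<in>coset p. \<Union>t\<in>coset q. coset (frag_bilin f s t)) = coset (frag_bilin f p q)"
proof -
  have relgen: "frag_bilin g r t \<in> N"
    if g: "\<And>r y. r \<in> Rel \<Longrightarrow> y \<in> S \<Longrightarrow> frag_extend (\<lambda>x. g x y) r \<in> N"
      and r: "r \<in> Rel" and t: "keys t \<subseteq> S" for g r t
    using t
  proof (induction t rule: frag_on_induct)
    case (of a)
    then show ?case using g[OF r] by (simp add: frag_bilin_swap[of g r] frag_bilin_def)
  qed (simp_all add: frag_bilin_zero frag_bilin_diff_right N_zero N_diff)
  have N: "frag_bilin g n t \<in> N"
    if g: "\<And>r y. r \<in> Rel \<Longrightarrow> y \<in> S \<Longrightarrow> frag_extend (\<lambda>x. g x y) r \<in> N"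
      and n: "n \<in> N" and t: "keys t \<subseteq> S" for g n t
    using n
  proof (induction rule: N_induct)
    case (rel r)
    show ?case by (rule relgen[OF _ rel t]) (rule g)
  qed (simp_all add: frag_bilin_zero frag_bilin_diff_left N_zero N_diff)
  have eq: "coset (frag_bilin f s t) = coset (frag_bilin f p q)" if s: "s \<in> coset p" and t: "t \<in> coset q" for s t
  proof -
    have "frag_bilin f s t - frag_bilin f p q = frag_bilin f (s - p) t + frag_bilin (\<lambda>y x. f x y) (t - q) p"
      by (simp add: frag_bilin_diff_left frag_bilin_diff_right frag_bilin_swap[of f, symmetric])
    moreover have "frag_bilin f (s - p) t \<in> N"
      using s coset_keys[OF q t] by (intro N[OF left]) (simp_all add: mem_coset)
    moreover have "frag_bilin (\<lambda>y x. f x y) (t - q) p \<in> N"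
      using t p by (intro N) (simp_all add: mem_coset right)
    ultimately show ?thesis by (simp add: coset_eq_iff N_add)
  qed
  show ?thesis using eq coset_self[of p] coset_self[of q] by blast
qed

end


section \<open>The double Burnside group\<close>

context finite_group
begin

definition burnside_gens :: "(('g, 'g) iso_class \<Rightarrow>\<^sub>0 int) set" where
  "burnside_gens = {frag_of (iso_class_of G G (biset_sum X Y))
        - frag_of (iso_class_of G G X) - frag_of (iso_class_of G G Y)
      | (X :: (nat, 'g, 'g) biset) (Y :: (nat, 'g, 'g) biset). is_biset G G X \<and> is_biset G G Y}"

lemmas FG = finite_group_axioms
lemmas class_in = iso_class_of_in_iso_classes[OF FG FG]
lemmas count_sum = biset_sum[OF FG FG]

lemma presented_burnside: "presented_group (iso_classes G G) burnside_gens"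
proof
  fix p assume "p \<in> burnside_gens"
  then obtain X Y :: "(nat, 'g, 'g) biset" where X: "is_biset G G X" "is_biset G G Y"
    and p: "p = frag_of (iso_class_of G G (biset_sum X Y)) - frag_of (iso_class_of G G X) - frag_of (iso_class_of G G Y)"
    unfolding burnside_gens_def by blast
  have "keys p \<subseteq> {iso_class_of G G (biset_sum X Y), iso_class_of G G X, iso_class_of G G Y}"
    unfolding p by (rule order_trans[OF keys_diff]) (use keys_diff[of "frag_of (iso_class_of G G (biset_sum X Y))" "frag_of (iso_class_of G G X)"] in auto)
  also have "\<dots> \<subseteq> iso_classes G G" using X by (auto simp: class_in count_sum(1))
  finally show "keys p \<subseteq> iso_classes G G" .
qed

sublocale B: presented_group "iso_classes G G" burnside_gens
  by (rule presented_burnside)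

lemma burnside_unfold:
  "burnside_rels G G = B.N" "burnside_group G G = B.Q" "burnside_coset G G p = B.coset p"
  by (simp_all add: burnside_group_def burnside_coset_def burnside_rels_def burnside_gens_def)

text \<open>
  Counts determine a biset up to isomorphism, so \<open>Z\<close> is isomorphic to the disjoint union of \<open>X\<close> and
  \<open>Y\<close>.
\<close>

lemma sum_relation:
  assumes X: "is_biset G G X" and Y: "is_biset G G Y" and Z: "is_biset G G Z"
    and count: "\<And>V. biset_count G G Z V = biset_count G G X V + biset_count G G Y V"
  shows "frag_of (iso_class_of G G Z) - frag_of (iso_class_of G G X) - frag_of (iso_class_of G G Y) \<in> B.N"
proof -
  obtain X' :: "(nat, 'g, 'g) biset" where X': "is_biset G G X'" "biset_count G G X' = biset_count G G X"
    using biset_nat_copy[OF FG FG X] by blast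
  obtain Y' :: "(nat, 'g, 'g) biset" where Y': "is_biset G G Y'" "biset_count G G Y' = biset_count G G Y"
    using biset_nat_copy[OF FG FG Y] by blast
  have "biset_count G G Z = biset_count G G (biset_sum X' Y')"
    using count count_sum(2)[OF X'(1) Y'(1)] X'(2) Y'(2) by (intro ext) simp
  then have "iso_class_of G G Z = iso_class_of G G (biset_sum X' Y')"
    using iso_class_of_cong[OF FG FG Z count_sum(1)[OF X'(1) Y'(1)]] by simp
  moreover have "iso_class_of G G X = iso_class_of G G X'" "iso_class_of G G Y = iso_class_of G G Y'"
    using iso_class_of_cong[OF FG FG X X'(1)] iso_class_of_cong[OF FG FG Y Y'(1)] X' Y' by simp_all
  moreover have "frag_of (iso_class_of G G (biset_sum X' Y')) - frag_of (iso_class_of G G X') - frag_of (iso_class_of G G Y') \<in> burnside_gens"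
    unfolding burnside_gens_def using X' Y' by blast
  ultimately show ?thesis using B.N_Rel by simp
qed

lemma order_pos: "order G > 0"
  using finite_carrier order_gt_0_iff_finite by blast

lemma tensor_product_locale:
  "is_biset G G X \<Longrightarrow> is_biset G G Y \<Longrightarrow> biset_tensor_product G G G X Y"
  by unfold_locales

lemmas tensor_biset =
  biset_tensor_product.tensor_is_biset[OF tensor_product_locale]
  biset_tensor_product.tensor_count[OF tensor_product_locale]

text \<open>
  The formula \<open>tensor_count\<close> is bilinear in the counts of the factors. The order of \<open>G\<close> can be
  cancelled in it because counts are natural numbers. In this way the tensor product respects
  isomorphisms and, by \<open>tensor_count_sum\<close>, disjoint unions.
\<close>

lemma tensor_count_cong:
  assumes "is_biset G G X" "is_biset G G Y" "is_biset G G X'" "is_biset G G Y'"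
    and "biset_count G G X = biset_count G G X'" "biset_count G G Y = biset_count G G Y'"
  shows "biset_count G G (biset_tensor G X Y) = biset_count G G (biset_tensor G X' Y')"
proof
  fix V
  have "order G * biset_count G G (biset_tensor G X Y) V = order G * biset_count G G (biset_tensor G X' Y') V"
    using assms by (simp add: tensor_biset(2))
  then show "biset_count G G (biset_tensor G X Y) V = biset_count G G (biset_tensor G X' Y') V"
    using order_pos by simp
qed

lemma tensor_count_sum:
  assumes X: "is_biset G G X" and X': "is_biset G G X'" and Z: "is_biset G G Z" and Y: "is_biset G G Y"
    and count: "\<And>V. biset_count G G Z V = biset_count G G X V + biset_count G G X' V"
  shows "biset_count G G (biset_tensor G Z Y) V = biset_count G G (biset_tensor G X Y) V + biset_count G G (biset_tensor G X' Y) V"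
    and "biset_count G G (biset_tensor G Y Z) V = biset_count G G (biset_tensor G Y X) V + biset_count G G (biset_tensor G Y X') V"
proof -
  have "order G * biset_count G G (biset_tensor G Z Y) V
      = order G * (biset_count G G (biset_tensor G X Y) V + biset_count G G (biset_tensor G X' Y) V)"
    by (simp add: tensor_biset(2) assms distrib_left distrib_right sum.distrib)
  then show "biset_count G G (biset_tensor G Z Y) V = biset_count G G (biset_tensor G X Y) V + biset_count G G (biset_tensor G X' Y) V"
    using order_pos by simp
  have "order G * biset_count G G (biset_tensor G Y Z) V
      = order G * (biset_count G G (biset_tensor G Y X) V + biset_count G G (biset_tensor G Y X') V)"
    by (simp add: tensor_biset(2) assms distrib_left distrib_right sum.distrib)
  then show "biset_count G G (biset_tensor G Y Z) V = biset_count G G (biset_tensor G Y X) V + biset_count G G (biset_tensor G Y X') V"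
    using order_pos by simp
qed

lemma iso_class_mult_of:
  assumes X: "is_biset G G X" and Y: "is_biset G G Y"
  shows "iso_class_mult G (iso_class_of G G X) (iso_class_of G G Y) = iso_class_of G G (biset_tensor G X Y)"
proof -
  have eq: "iso_class_of G G (biset_tensor G X' Y') = iso_class_of G G (biset_tensor G X Y)"
    if "X' \<in> iso_class_of G G X" "Y' \<in> iso_class_of G G Y" for X' Y'
  proof -
    have X': "is_biset G G X'" "biset_count G G X = biset_count G G X'"
      and Y': "is_biset G G Y'" "biset_count G G Y = biset_count G G Y'"
      using that iso_class_of_eq[OF FG FG X] iso_class_of_eq[OF FG FG Y] by auto
    show ?thesis
      by (rule iso_class_of_cong[OF FG FG]) (use X Y X' Y' tensor_count_cong[OF X Y X'(1) Y'(1)] tensor_biset in auto)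
  qed
  show ?thesis unfolding iso_class_mult_def
    using eq iso_class_of_nonempty[OF FG FG X] iso_class_of_nonempty[OF FG FG Y] by blast
qed

lemma iso_classes_cases:
  assumes "C \<in> iso_classes G G"
  obtains X :: "(nat, 'g, 'g) biset" where "is_biset G G X" "C = iso_class_of G G X"
  using assms unfolding iso_classes_def by blast

abbreviation "class_product \<equiv> \<lambda>C D. frag_of (iso_class_mult G C D)"

lemma class_product_relations:
  assumes r: "r \<in> burnside_gens" and C: "C \<in> iso_classes G G"
  shows "frag_extend (\<lambda>D. class_product D C) r \<in> B.N" "frag_extend (class_product C) r \<in> B.N"
proof -
  obtain X Y :: "(nat, 'g, 'g) biset" where X: "is_biset G G X" and Y: "is_biset G G Y"
    and p: "r = frag_of (iso_class_of G G (biset_sum X Y)) - frag_of (iso_class_of G G X) - frag_of (iso_class_of G G Y)"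
    using r unfolding burnside_gens_def by blast
  obtain Z :: "(nat, 'g, 'g) biset" where Z: "is_biset G G Z" "C = iso_class_of G G Z"
    using C by (rule iso_classes_cases)
  note XY = count_sum(1)[OF X Y]
  show "frag_extend (\<lambda>D. class_product D C) r \<in> B.N"
    unfolding p Z(2) frag_extend_diff frag_extend_of
      iso_class_mult_of[OF X Z(1)] iso_class_mult_of[OF Y Z(1)] iso_class_mult_of[OF XY Z(1)]
    by (rule sum_relation) (simp_all add: tensor_biset(1) X Y Z(1) XY tensor_count_sum(1)[OF X Y XY Z(1) count_sum(2)[OF X Y]])
  show "frag_extend (class_product C) r \<in> B.N"
    unfolding p Z(2) frag_extend_diff frag_extend_of
      iso_class_mult_of[OF Z(1) X] iso_class_mult_of[OF Z(1) Y] iso_class_mult_of[OF Z(1) XY]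
    by (rule sum_relation) (simp_all add: tensor_biset(1) X Y Z(1) XY tensor_count_sum(2)[OF X Y XY Z(1) count_sum(2)[OF X Y]])
qed

lemma burnside_mult_coset:
  assumes "keys p \<subseteq> iso_classes G G" "keys q \<subseteq> iso_classes G G"
  shows "burnside_mult G (B.coset p) (B.coset q) = B.coset (frag_bilin class_product p q)"
  unfolding burnside_mult_def burnside_unfold
  by (rule B.coset_binary_map[OF class_product_relations assms])

lemma keys_class_product:
  assumes "keys p \<subseteq> iso_classes G G" "keys q \<subseteq> iso_classes G G"
  shows "keys (frag_bilin class_product p q) \<subseteq> iso_classes G G"
proof -
  have mult: "iso_class_mult G C D \<in> iso_classes G G" if C: "C \<in> iso_classes G G" and D: "D \<in> iso_classes G G" for C D
  proof -
    obtain X :: "(nat, 'g, 'g) biset" where X: "is_biset G G X" "C = iso_class_of G G X"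
      using C by (rule iso_classes_cases)
    obtain Y :: "(nat, 'g, 'g) biset" where Y: "is_biset G G Y" "D = iso_class_of G G Y"
      using D by (rule iso_classes_cases)
    show ?thesis using class_in[OF tensor_biset(1)[OF X(1) Y(1)]] by (simp add: X(2) Y(2) iso_class_mult_of[OF X(1) Y(1)])
  qed
  have "keys (frag_extend (class_product C) q) \<subseteq> iso_classes G G" if "C \<in> iso_classes G G" for C
    by (rule order_trans[OF keys_frag_extend]) (use mult[OF that] assms(2) in auto)
  then show ?thesis unfolding frag_bilin_def
    by (intro order_trans[OF keys_frag_extend]) (use assms(1) in auto)
qed

abbreviation "bclass X \<equiv> B.coset (frag_of (iso_class_of G G X))"

lemma bclass_in: "is_biset G G X \<Longrightarrow> bclass X \<in> carrier B.Q"
  by (rule B.coset_in_Q) (simp add: class_in)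

lemma bclass_cong:
  "is_biset G G X \<Longrightarrow> is_biset G G Y \<Longrightarrow> biset_count G G X = biset_count G G Y \<Longrightarrow> bclass X = bclass Y"
  using iso_class_of_cong[OF FG FG] by metis

lemma bclass_sum:
  assumes "is_biset G G X" "is_biset G G Y" "is_biset G G Z"
    and "\<And>V. biset_count G G Z V = biset_count G G X V + biset_count G G Y V"
  shows "bclass Z = bclass X \<otimes>\<^bsub>B.Q\<^esub> bclass Y"
  using sum_relation[OF assms] assms
  by (subst B.Q_mult) (simp_all add: class_in B.coset_eq_iff algebra_simps)

lemma burnside_mult_bclass:
  "is_biset G G X \<Longrightarrow> is_biset G G Y \<Longrightarrow> burnside_mult G (bclass X) (bclass Y) = bclass (biset_tensor G X Y)"
  by (subst burnside_mult_coset) (simp_all add: class_in frag_bilin_of iso_class_mult_of)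

lemma burnside_mult_closed:
  "x \<in> carrier B.Q \<Longrightarrow> y \<in> carrier B.Q \<Longrightarrow> burnside_mult G x y \<in> carrier B.Q"
  by (elim B.Q_cases) (simp only: burnside_mult_coset B.coset_in_Q keys_class_product)

lemma burnside_mult_add:
  assumes "x \<in> carrier B.Q" "x' \<in> carrier B.Q" "y \<in> carrier B.Q"
  shows "burnside_mult G (x \<otimes>\<^bsub>B.Q\<^esub> x') y = burnside_mult G x y \<otimes>\<^bsub>B.Q\<^esub> burnside_mult G x' y"
    and "burnside_mult G y (x \<otimes>\<^bsub>B.Q\<^esub> x') = burnside_mult G y x \<otimes>\<^bsub>B.Q\<^esub> burnside_mult G y x'"
proof -
  obtain p where p: "keys p \<subseteq> iso_classes G G" "x = B.coset p" using assms(1) by (rule B.Q_cases)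
  obtain p' where p': "keys p' \<subseteq> iso_classes G G" "x' = B.coset p'" using assms(2) by (rule B.Q_cases)
  obtain q where q: "keys q \<subseteq> iso_classes G G" "y = B.coset q" using assms(3) by (rule B.Q_cases)
  have pp: "keys (p + p') \<subseteq> iso_classes G G"
    by (rule order_trans[OF keys_add]) (use p p' in simp)
  show "burnside_mult G (x \<otimes>\<^bsub>B.Q\<^esub> x') y = burnside_mult G x y \<otimes>\<^bsub>B.Q\<^esub> burnside_mult G x' y"
    using p(1) p'(1) q(1) pp unfolding p(2) p'(2) q(2)
    by (simp only: B.Q_mult burnside_mult_coset keys_class_product frag_bilin_add_left)
  show "burnside_mult G y (x \<otimes>\<^bsub>B.Q\<^esub> x') = burnside_mult G y x \<otimes>\<^bsub>B.Q\<^esub> burnside_mult G y x'"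
    using p(1) p'(1) q(1) pp unfolding p(2) p'(2) q(2)
    by (simp only: B.Q_mult burnside_mult_coset keys_class_product frag_bilin_add_right)
qed

lemma iso_class_mark_of:
  assumes X: "is_biset G G X" and U: "U \<subseteq> carrier GG"
  shows "iso_class_mark G U (iso_class_of G G X)
    = (\<Sum>V | V \<in> subgroups_of GG \<and> U \<subseteq> V. int (biset_count G G X V))"
proof -
  have "int (card (fixed_points G Y U)) = (\<Sum>V | V \<in> subgroups_of GG \<and> U \<subseteq> V. int (biset_count G G X V))"
    if "Y \<in> iso_class_of G G X" for Y
    using that iso_class_of_eq[OF FG FG X] card_fixed_points[OF FG FG _ U, of Y] by simp
  then have "(\<lambda>Y. int (card (fixed_points G Y U))) ` iso_class_of G G X
     = {\<Sum>V | V \<in> subgroups_of GG \<and> U \<subseteq> V. int (biset_count G G X V)}"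
    using iso_class_of_nonempty[OF FG FG X] by auto
  then show ?thesis by (simp add: iso_class_mark_def)
qed

lemma burnside_mark_coset:
  assumes U: "U \<subseteq> carrier GG"
  shows "burnside_mark G U (B.coset p) = (\<Sum>C\<in>keys p. lookup p C * iso_class_mark G U C)"
  unfolding burnside_mark_def
proof (rule B.coset_value)
  let ?\<phi> = "\<lambda>p. \<Sum>C\<in>keys p. lookup p C * iso_class_mark G U C"
  show add: "?\<phi> (p + q) = ?\<phi> p + ?\<phi> q" for p q
    using frag_weighted_sum_add[of "\<lambda>C k. k * iso_class_mark G U C" p q] by (simp add: distrib_right)
  have diff: "?\<phi> (p - q) = ?\<phi> p - ?\<phi> q" for p q using add[of "p - q" q] by simp
  fix r assume "r \<in> burnside_gens"
  then obtain X Y :: "(nat, 'g, 'g) biset" where X: "is_biset G G X" and Y: "is_biset G G Y"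
    and p: "r = frag_of (iso_class_of G G (biset_sum X Y)) - frag_of (iso_class_of G G X) - frag_of (iso_class_of G G Y)"
    unfolding burnside_gens_def by blast
  have of: "?\<phi> (frag_of C) = iso_class_mark G U C" for C by simp
  show "?\<phi> r = 0" unfolding p diff of
    by (simp only: iso_class_mark_of[OF X U] iso_class_mark_of[OF Y U] iso_class_mark_of[OF count_sum(1)[OF X Y] U]
      count_sum(2)[OF X Y] of_nat_add sum.distrib)
qed

lemma burnside_mark_bclass:
  assumes X: "is_biset G G X" and U: "U \<subseteq> carrier GG"
  shows "burnside_mark G U (bclass X) = (\<Sum>V | V \<in> subgroups_of GG \<and> U \<subseteq> V. int (biset_count G G X V))"
  by (simp add: burnside_mark_coset[OF U] iso_class_mark_of[OF X U])

lemma burnside_mark_add: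
  assumes "x \<in> carrier B.Q" "y \<in> carrier B.Q" and U: "U \<subseteq> carrier GG"
  shows "burnside_mark G U (x \<otimes>\<^bsub>B.Q\<^esub> y) = burnside_mark G U x + burnside_mark G U y"
proof -
  obtain p where p: "keys p \<subseteq> iso_classes G G" "x = B.coset p" using assms(1) by (rule B.Q_cases)
  obtain q where q: "keys q \<subseteq> iso_classes G G" "y = B.coset q" using assms(2) by (rule B.Q_cases)
  show ?thesis
    using p(1) q(1) frag_weighted_sum_add[of "\<lambda>C k. k * iso_class_mark G U C" p q] unfolding p(2) q(2)
    by (simp only: B.Q_mult burnside_mark_coset[OF U] distrib_right)
qed

end


section \<open>The double Burnside algebra\<close>

lemma card_conj_set:
  assumes "group X" "x \<in> carrier X" "L \<subseteq> carrier X"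
  shows "card (conj_set X x L) = card L"
  unfolding conj_set_def
proof (rule card_image)
  interpret group X by fact
  show "inj_on (\<lambda>l. x \<otimes>\<^bsub>X\<^esub> l \<otimes>\<^bsub>X\<^esub> inv\<^bsub>X\<^esub> x) L"
    using assms by (auto simp: inj_on_def subsetD)
qed

lemma (in finite_action) stab_count_conj:
  assumes p: "p \<in> carrier P" and V: "V \<subseteq> carrier P"
  shows "stab_count P S act (conj_set P p V) = stab_count P S act V"
proof -
  have "bij_betw (act p) {x \<in> S. stab x = V} {x \<in> S. stab x = conj_set P p V}"
  proof (rule bij_betwI[where g = "act (inv p)"])
    show "act p \<in> {x \<in> S. stab x = V} \<rightarrow> {x \<in> S. stab x = conj_set P p V}"
      using p by (auto simp: act_closed stab_act)
    show "act (inv p) \<in> {x \<in> S. stab x = conj_set P p V} \<rightarrow> {x \<in> S. stab x = V}"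
      using p V by (auto simp: act_closed stab_act conj_set_inv[OF is_group p])
  qed (use p in \<open>simp_all add: act_inv act_inv'\<close>)
  from bij_betw_same_card[OF this] show ?thesis unfolding stab_count_def ..
qed

context invertible_order
begin

definition tensor_gens :: "(('r \<times> ('g, 'g) burnside_elt) \<Rightarrow>\<^sub>0 int) set" where
  "tensor_gens =
     {frag_of (r + s, x) - frag_of (r, x) - frag_of (s, x) | r s x. x \<in> carrier B.Q} \<union>
      {frag_of (r, x \<otimes>\<^bsub>B.Q\<^esub> y) - frag_of (r, x) - frag_of (r, y) | r x y.
         x \<in> carrier B.Q \<and> y \<in> carrier B.Q}"

abbreviation pairs :: "('r \<times> ('g, 'g) burnside_elt) set" where
  "pairs \<equiv> UNIV \<times> carrier B.Q"

lemma BQ_mult_closed: "x \<in> carrier B.Q \<Longrightarrow> y \<in> carrier B.Q \<Longrightarrow> x \<otimes>\<^bsub>B.Q\<^esub> y \<in> carrier B.Q"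
proof -
  interpret BQ: comm_group B.Q by (rule B.Q_comm_group)
  show "x \<in> carrier B.Q \<Longrightarrow> y \<in> carrier B.Q \<Longrightarrow> x \<otimes>\<^bsub>B.Q\<^esub> y \<in> carrier B.Q" by (rule BQ.m_closed)
qed

lemma tensor_gens_cases:
  assumes "p \<in> tensor_gens"
  obtains (scalar) r s x where "x \<in> carrier B.Q" "p = frag_of (r + s, x) - frag_of (r, x) - frag_of (s, x)"
  | (element) r x y where "x \<in> carrier B.Q" "y \<in> carrier B.Q"
      "p = frag_of (r, x \<otimes>\<^bsub>B.Q\<^esub> y) - frag_of (r, x) - frag_of (r, y)"
  using assms unfolding tensor_gens_def by blast

lemma keys_three: "keys (frag_of a - frag_of b - frag_of c) \<subseteq> {a, b, c}"
  using keys_diff[of "frag_of a - frag_of b" "frag_of c"] keys_diff[of "frag_of a" "frag_of b"] by auto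

lemma presented_tensor: "presented_group pairs tensor_gens"
proof
  fix p assume "p \<in> tensor_gens"
  then show "keys p \<subseteq> pairs"
  proof (cases rule: tensor_gens_cases)
    case (scalar r s x)
    show ?thesis unfolding scalar(2) by (rule order_trans[OF keys_three]) (use scalar(1) in simp)
  next
    case (element r x y)
    show ?thesis unfolding element(3)
      by (rule order_trans[OF keys_three]) (use element(1,2) BQ_mult_closed in blast)
  qed
qed

sublocale T: presented_group pairs tensor_gens
  by (rule presented_tensor)

abbreviation tens :: "'r \<Rightarrow> ('g, 'g) burnside_elt \<Rightarrow> ('r, 'g, 'g) rburnside_elt" where
  "tens r x \<equiv> T.coset (frag_of (r, x))"

abbreviation RB :: "('r, ('r, 'g, 'g) rburnside_elt) module" where
  "RB \<equiv> double_burnside_algebra G"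

abbreviation "pair_product \<equiv> \<lambda>(r :: 'r, x) (r', x'). frag_of (r * r', burnside_mult G x x')"

lemma tensor_unfold:
  "tensor_int (burnside_group G G) = T.Q" "tensor_coset (burnside_group G G) = T.coset"
proof -
  have rels: "tensor_rels (burnside_group G G) = T.N"
    unfolding tensor_rels_def tensor_gens_def burnside_unfold ..
  show "tensor_int (burnside_group G G) = T.Q" "tensor_coset (burnside_group G G) = T.coset"
    unfolding tensor_int_def tensor_coset_def rels unfolding burnside_unfold by (rule refl)+
qed

lemma RB_simps:
  "carrier RB = carrier T.Q"
  "a \<otimes>\<^bsub>RB\<^esub> b = (\<Union>s\<in>a. \<Union>t\<in>b. T.coset (frag_bilin pair_product s t))"
  "\<one>\<^bsub>RB\<^esub> = tens 1 (bclass (regular_biset G))"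
  "\<zero>\<^bsub>RB\<^esub> = \<one>\<^bsub>T.Q\<^esub>" "a \<oplus>\<^bsub>RB\<^esub> b = a \<otimes>\<^bsub>T.Q\<^esub> b"
  "r \<odot>\<^bsub>RB\<^esub> a = (\<Union>s\<in>a. T.coset (frag_extend (\<lambda>(r', x). frag_of (r * r', x)) s))"
  unfolding double_burnside_algebra_def Let_def tensor_unfold
  unfolding biset_class_def burnside_unfold
  by (simp_all only: partial_object.simps monoid.simps ring.simps module.simps)

lemma tens_in: "x \<in> carrier B.Q \<Longrightarrow> tens r x \<in> carrier T.Q"
  by (rule T.coset_in_Q) simp

lemma tens_add_scalar: "x \<in> carrier B.Q \<Longrightarrow> tens (r + s) x = tens r x \<otimes>\<^bsub>T.Q\<^esub> tens s x"
proof -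
  assume x: "x \<in> carrier B.Q"
  have "frag_of (r + s, x) - frag_of (r, x) - frag_of (s, x) \<in> T.N"
    by (rule T.N_Rel) (use x in \<open>auto simp: tensor_gens_def\<close>)
  then show ?thesis using x
    by (subst T.Q_mult) (simp_all add: T.coset_eq_iff diff_diff_eq)
qed

lemma tens_add: "x \<in> carrier B.Q \<Longrightarrow> y \<in> carrier B.Q \<Longrightarrow> tens r (x \<otimes>\<^bsub>B.Q\<^esub> y) = tens r x \<otimes>\<^bsub>T.Q\<^esub> tens r y"
proof -
  assume x: "x \<in> carrier B.Q" and y: "y \<in> carrier B.Q"
  have "frag_of (r, x \<otimes>\<^bsub>B.Q\<^esub> y) - frag_of (r, x) - frag_of (r, y) \<in> T.N"
    by (rule T.N_Rel, unfold tensor_gens_def) (use x y in blast)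
  then show ?thesis using x y
    by (subst T.Q_mult) (simp_all only: T.coset_eq_iff diff_diff_eq keys_frag_of, auto)
qed

lemma tens_hom: "group_hom B.Q T.Q (tens r)"
proof -
  interpret BQ: comm_group B.Q by (rule B.Q_comm_group)
  interpret TQ: comm_group T.Q by (rule T.Q_comm_group)
  show ?thesis
    by unfold_locales (auto intro!: homI tens_in tens_add simp del: mult_FactGroup)
qed

lemma tens_zero: "x \<in> carrier B.Q \<Longrightarrow> tens 0 x = \<one>\<^bsub>T.Q\<^esub>"
proof -
  interpret TQ: comm_group T.Q by (rule T.Q_comm_group)
  assume x: "x \<in> carrier B.Q"
  have "tens 0 x = tens 0 x \<otimes>\<^bsub>T.Q\<^esub> tens 0 x" using tens_add_scalar[OF x, of 0 0] by simp
  then show ?thesis using tens_in[OF x, of 0] by (metis TQ.r_cancel_one')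
qed

lemma tens_minus: "x \<in> carrier B.Q \<Longrightarrow> tens (- r) x = inv\<^bsub>T.Q\<^esub> tens r x"
proof -
  interpret TQ: comm_group T.Q by (rule T.Q_comm_group)
  assume x: "x \<in> carrier B.Q"
  have "tens (- r) x \<otimes>\<^bsub>T.Q\<^esub> tens r x = \<one>\<^bsub>T.Q\<^esub>"
    using tens_add_scalar[OF x, of "- r" r] tens_zero[OF x] by (simp only: ab_left_minus)
  from TQ.inv_equality[OF this tens_in[OF x] tens_in[OF x]] show ?thesis ..
qed

text \<open>
  A minus sign can be moved from the Burnside group to the scalar, so every element is a sum of tensors
  \<open>r \<otimes> [X]\<close> with a biset \<open>X\<close>.
\<close>

lemma RB_induct [consumes 1, case_names gen add]:
  assumes A: "a \<in> carrier RB"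
    and gen: "\<And>r (X :: (nat, 'g, 'g) biset). is_biset G G X \<Longrightarrow> P (tens r (bclass X))"
    and add: "\<And>a b. a \<in> carrier RB \<Longrightarrow> b \<in> carrier RB \<Longrightarrow> P a \<Longrightarrow> P b \<Longrightarrow> P (a \<oplus>\<^bsub>RB\<^esub> b)"
  shows "P a"
proof -
  interpret BQ: comm_group B.Q by (rule B.Q_comm_group)
  interpret TQ: comm_group T.Q by (rule T.Q_comm_group)
  have mult: "P (a \<otimes>\<^bsub>T.Q\<^esub> b)" if "a \<in> carrier T.Q" "b \<in> carrier T.Q" "P a" "P b" for a b
    using add[of a b] that by (simp only: RB_simps)
  \<comment> \<open>The zero element is a tensor with scalar \<open>0\<close>; the empty biset serves as its second factor.\<close>
  have reg: "is_biset G G (action_biset G G ({} :: nat set) (\<lambda>p x. x))"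
    by (rule action_biset(1)[OF FG FG])
      (simp add: finite_action_def finite_action_axioms_def finite_group_DirProd FG)
  have P_one: "P \<one>\<^bsub>T.Q\<^esub>"
    using gen[OF reg, of 0] tens_zero[OF bclass_in[OF reg]] by (simp only:)
  have P: "\<forall>r. P (tens r x)" if "x \<in> carrier B.Q" for x
    using that
  proof (induction x rule: B.Q_induct)
    case (of C)
    then show ?case using gen by (auto elim!: iso_classes_cases)
  next
    case one
    show ?case
    proof
      fix r
      have "tens r \<one>\<^bsub>B.Q\<^esub> = \<one>\<^bsub>T.Q\<^esub>" by (rule group_hom.hom_one[OF tens_hom])
      then show "P (tens r \<one>\<^bsub>B.Q\<^esub>)" using P_one by (simp only:)
    qed
  next
    case (diff x y)
    have "tens r (x \<otimes>\<^bsub>B.Q\<^esub> inv\<^bsub>B.Q\<^esub> y) = tens r x \<otimes>\<^bsub>T.Q\<^esub> tens (- r) y" for r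
      using diff by (simp only: tens_add BQ.inv_closed group_hom.hom_inv[OF tens_hom] tens_minus)
    then show ?case using diff mult tens_in by (simp only:) blast
  qed
  have "P a \<and> P (inv\<^bsub>T.Q\<^esub> a)" if "a \<in> carrier T.Q" for a
    using that
  proof (induction a rule: T.Q_induct)
    case (of z)
    then obtain r x where z: "z = (r, x)" "x \<in> carrier B.Q" by auto
    show ?case unfolding z(1) tens_minus[OF z(2), symmetric] using P[OF z(2)] by blast
  next
    case one
    show ?case using P_one by (simp only: TQ.inv_one)
  next
    case (diff a b)
    have "inv\<^bsub>T.Q\<^esub> (a \<otimes>\<^bsub>T.Q\<^esub> inv\<^bsub>T.Q\<^esub> b) = inv\<^bsub>T.Q\<^esub> a \<otimes>\<^bsub>T.Q\<^esub> b"
      using diff by (simp only: TQ.inv_mult TQ.inv_closed TQ.inv_inv)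
    then show ?case using diff mult TQ.inv_closed by (simp only:)
  qed
  then show ?thesis using A by (simp only: RB_simps)
qed

lemma pair_product_relations:
  assumes r: "p \<in> tensor_gens" and z: "z \<in> pairs"
  shows "frag_extend (\<lambda>w. pair_product w z) p \<in> T.N" "frag_extend (pair_product z) p \<in> T.N"
proof -
  obtain t y where z: "z = (t, y)" "y \<in> carrier B.Q" using z by auto
  have gen1: "frag_of (r + s, x) - frag_of (r, x) - frag_of (s, x) \<in> T.N" if "x \<in> carrier B.Q" for r s x
    by (rule T.N_Rel, unfold tensor_gens_def) (use that in blast)
  have gen2: "frag_of (r, x \<otimes>\<^bsub>B.Q\<^esub> x') - frag_of (r, x) - frag_of (r, x') \<in> T.N"
    if "x \<in> carrier B.Q" "x' \<in> carrier B.Q" for r x x'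
    by (rule T.N_Rel, unfold tensor_gens_def) (use that in blast)
  from r show "frag_extend (\<lambda>w. pair_product w z) p \<in> T.N"
  proof (cases rule: tensor_gens_cases)
    case (scalar r s x)
    show ?thesis unfolding scalar(2) z frag_extend_diff frag_extend_of prod.case distrib_right
      by (rule gen1) (rule burnside_mult_closed[OF scalar(1) z(2)])
  next
    case (element r x x')
    show ?thesis unfolding element(3) z frag_extend_diff frag_extend_of prod.case burnside_mult_add(1)[OF element(1,2) z(2)]
      by (rule gen2) (rule burnside_mult_closed[OF _ z(2)], fact)+
  qed
  from r show "frag_extend (pair_product z) p \<in> T.N"
  proof (cases rule: tensor_gens_cases)
    case (scalar r s x)
    show ?thesis unfolding scalar(2) z frag_extend_diff frag_extend_of prod.case distrib_left
      by (rule gen1) (rule burnside_mult_closed[OF z(2) scalar(1)])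
  next
    case (element r x x')
    show ?thesis unfolding element(3) z frag_extend_diff frag_extend_of prod.case burnside_mult_add(2)[OF element(1,2) z(2)]
      by (rule gen2) (rule burnside_mult_closed[OF z(2)], fact)+
  qed
qed

lemma RB_mult_coset:
  assumes "keys p \<subseteq> pairs" "keys q \<subseteq> pairs"
  shows "T.coset p \<otimes>\<^bsub>RB\<^esub> T.coset q = T.coset (frag_bilin pair_product p q)"
  unfolding RB_simps(2) by (rule T.coset_binary_map[OF pair_product_relations assms])

lemma keys_pair_product:
  assumes p: "keys p \<subseteq> pairs" and q: "keys q \<subseteq> pairs"
  shows "keys (frag_bilin pair_product p q) \<subseteq> pairs"
proof -
  have "keys (pair_product z w) \<subseteq> pairs" if "z \<in> pairs" "w \<in> pairs" for z w
    using that burnside_mult_closed by (cases z; cases w) simp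
  note single = this
  have ext: "keys (frag_extend (pair_product z) q) \<subseteq> pairs" if z: "z \<in> pairs" for z
  proof (rule order_trans[OF keys_frag_extend], rule UN_least)
    fix w assume "w \<in> keys q"
    then show "keys (pair_product z w) \<subseteq> pairs" by (intro single[OF z] subsetD[OF q])
  qed
  show ?thesis unfolding frag_bilin_def
  proof (rule order_trans[OF keys_frag_extend], rule UN_least)
    fix w assume "w \<in> keys p"
    then show "keys (frag_extend (pair_product w) q) \<subseteq> pairs" by (intro ext subsetD[OF p])
  qed
qed

lemma RB_mult_closed: "a \<in> carrier RB \<Longrightarrow> b \<in> carrier RB \<Longrightarrow> a \<otimes>\<^bsub>RB\<^esub> b \<in> carrier RB"
  unfolding RB_simps(1) by (elim T.Q_cases) (simp only: RB_mult_coset T.coset_in_Q keys_pair_product)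

lemma RB_distrib:
  assumes "a \<in> carrier RB" "b \<in> carrier RB" "c \<in> carrier RB"
  shows "(a \<oplus>\<^bsub>RB\<^esub> b) \<otimes>\<^bsub>RB\<^esub> c = a \<otimes>\<^bsub>RB\<^esub> c \<oplus>\<^bsub>RB\<^esub> b \<otimes>\<^bsub>RB\<^esub> c"
    and "c \<otimes>\<^bsub>RB\<^esub> (a \<oplus>\<^bsub>RB\<^esub> b) = c \<otimes>\<^bsub>RB\<^esub> a \<oplus>\<^bsub>RB\<^esub> c \<otimes>\<^bsub>RB\<^esub> b"
proof -
  obtain p where p: "keys p \<subseteq> pairs" "a = T.coset p" using assms(1) unfolding RB_simps(1) by (rule T.Q_cases)
  obtain q where q: "keys q \<subseteq> pairs" "b = T.coset q" using assms(2) unfolding RB_simps(1) by (rule T.Q_cases)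
  obtain s where s: "keys s \<subseteq> pairs" "c = T.coset s" using assms(3) unfolding RB_simps(1) by (rule T.Q_cases)
  have pq: "keys (p + q) \<subseteq> pairs" by (rule order_trans[OF keys_add]) (use p q in simp)
  show "(a \<oplus>\<^bsub>RB\<^esub> b) \<otimes>\<^bsub>RB\<^esub> c = a \<otimes>\<^bsub>RB\<^esub> c \<oplus>\<^bsub>RB\<^esub> b \<otimes>\<^bsub>RB\<^esub> c"
    using p(1) q(1) s(1) pq unfolding p(2) q(2) s(2)
    by (simp only: RB_simps(5) T.Q_mult RB_mult_coset keys_pair_product frag_bilin_add_left)
  show "c \<otimes>\<^bsub>RB\<^esub> (a \<oplus>\<^bsub>RB\<^esub> b) = c \<otimes>\<^bsub>RB\<^esub> a \<oplus>\<^bsub>RB\<^esub> c \<otimes>\<^bsub>RB\<^esub> b"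
    using p(1) q(1) s(1) pq unfolding p(2) q(2) s(2)
    by (simp only: RB_simps(5) T.Q_mult RB_mult_coset keys_pair_product frag_bilin_add_right)
qed

lemma RB_mult_tens:
  "x \<in> carrier B.Q \<Longrightarrow> y \<in> carrier B.Q \<Longrightarrow> tens r x \<otimes>\<^bsub>RB\<^esub> tens s y = tens (r * s) (burnside_mult G x y)"
  by (subst RB_mult_coset) (simp_all add: frag_bilin_of)

lemma RB_smult_coset:
  "t \<odot>\<^bsub>RB\<^esub> T.coset p = T.coset (frag_extend (\<lambda>(r, x). frag_of (t * r, x)) p)"
  unfolding RB_simps(6)
proof (rule T.coset_unary_map)
  fix q assume "q \<in> tensor_gens"
  then show "frag_extend (\<lambda>(r, x). frag_of (t * r, x)) q \<in> T.N"
  proof (cases rule: tensor_gens_cases)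
    case (scalar r s x)
    show ?thesis unfolding scalar(2) frag_extend_diff frag_extend_of prod.case distrib_left
      by (rule T.N_Rel, unfold tensor_gens_def) (use scalar(1) in blast)
  next
    case (element r x y)
    show ?thesis unfolding element(3) frag_extend_diff frag_extend_of prod.case
      by (rule T.N_Rel, unfold tensor_gens_def) (use element(1,2) in blast)
  qed
qed

lemma RB_smult_add:
  assumes "a \<in> carrier RB" "b \<in> carrier RB"
  shows "t \<odot>\<^bsub>RB\<^esub> a \<in> carrier RB" "t \<odot>\<^bsub>RB\<^esub> (a \<oplus>\<^bsub>RB\<^esub> b) = t \<odot>\<^bsub>RB\<^esub> a \<oplus>\<^bsub>RB\<^esub> t \<odot>\<^bsub>RB\<^esub> b"
proof -
  obtain p where p: "keys p \<subseteq> pairs" "a = T.coset p" using assms(1) unfolding RB_simps(1) by (rule T.Q_cases)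
  obtain q where q: "keys q \<subseteq> pairs" "b = T.coset q" using assms(2) unfolding RB_simps(1) by (rule T.Q_cases)
  have keys: "keys (frag_extend (\<lambda>(r, x). frag_of (t * r, x)) s) \<subseteq> pairs" if "keys s \<subseteq> pairs" for s
    by (rule order_trans[OF keys_frag_extend]) (use that in auto)
  show "t \<odot>\<^bsub>RB\<^esub> a \<in> carrier RB"
    using keys[OF p(1)] unfolding p(2) by (simp only: RB_smult_coset RB_simps(1) T.coset_in_Q)
  show "t \<odot>\<^bsub>RB\<^esub> (a \<oplus>\<^bsub>RB\<^esub> b) = t \<odot>\<^bsub>RB\<^esub> a \<oplus>\<^bsub>RB\<^esub> t \<odot>\<^bsub>RB\<^esub> b"
    using p(1) q(1) keys unfolding p(2) q(2)
    by (simp only: RB_simps(5) T.Q_mult RB_smult_coset frag_extend_add)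
qed

lemma RB_smult_tens: "t \<odot>\<^bsub>RB\<^esub> tens r x = tens (t * r) x"
  by (simp add: RB_smult_coset)

lemma RB_abelian_group: "abelian_group RB"
proof -
  interpret TQ: comm_group T.Q by (rule T.Q_comm_group)
  show ?thesis
    by (rule abelian_groupI)
      (simp_all only: RB_simps(1,4,5) TQ.m_closed TQ.one_closed TQ.m_ac TQ.l_one TQ.r_one TQ.l_inv_ex)
qed


section \<open>The mark homomorphism\<close>

abbreviation count_elt :: "('x, 'g, 'g) biset \<Rightarrow> ('g \<times> 'g) set \<Rightarrow> 'r" where
  "count_elt X \<equiv> \<lambda>V. rint (int (biset_count G G X V))"

lemma rho_coset:
  "rho G G (T.coset t) = (\<lambda>N. if subgroup N GG then
     (\<Sum>(r, x)\<in>keys t. rint (lookup t (r, x)) * (r * rint (burnside_mark G N x))) else 0)"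
proof
  fix N
  let ?\<phi> = "\<lambda>U t. \<Sum>(r, x)\<in>keys t. rint (lookup t (r, x)) * (r * rint (burnside_mark G U x)) :: 'r"
  have \<phi>: "?\<phi> U t = (\<Sum>z\<in>keys t. rint (lookup t z) * (fst z * rint (burnside_mark G U (snd z))))" for U t
    by (intro sum.cong refl) auto
  have val: "the_elem (?\<phi> U ` T.coset t) = ?\<phi> U t" if U: "U \<in> subgroups_of GG" for U
  proof (rule T.coset_value)
    show add: "?\<phi> U (p + q) = ?\<phi> U p + ?\<phi> U q" for p q
      unfolding \<phi> using frag_weighted_sum_add[of "\<lambda>z k. rint k * (fst z * rint (burnside_mark G U (snd z)))" p q]
      by (simp add: rint_add distrib_right)
    have diff: "?\<phi> U (p - q) = ?\<phi> U p - ?\<phi> U q" for p q using add[of "p - q" q] by simp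
    have of: "?\<phi> U (frag_of z) = fst z * rint (burnside_mark G U (snd z))" for z by (cases z) simp
    have Uc: "U \<subseteq> carrier GG" using U by (simp only: subgroups_of_iff subgroup.subset)
    fix p assume "p \<in> tensor_gens"
    then show "?\<phi> U p = 0"
    proof (cases rule: tensor_gens_cases)
      case (scalar r s x)
      show ?thesis unfolding scalar(2) diff of by (simp add: algebra_simps)
    next
      case (element r x y)
      show ?thesis unfolding element(3) diff of fst_conv snd_conv burnside_mark_add[OF element(1,2) Uc]
        by (simp add: rint_add algebra_simps)
    qed
  qed
  have "rho G G (T.coset t) N = (\<Sum>U\<in>subgroups_of GG. if U = N then ?\<phi> U t else 0)"
    unfolding rho_def by (intro sum.cong refl) (simp only: val, simp add: bas_def)
  also have "\<dots> = (if subgroup N GG then ?\<phi> N t else 0)"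
    unfolding sum.delta[OF finite_subgroups_of[OF GG_finite]] by simp
  finally show "rho G G (T.coset t) N = (if subgroup N GG then ?\<phi> N t else 0)" .
qed

lemma rho_add:
  assumes "a \<in> carrier RB" "b \<in> carrier RB"
  shows "rho G G (a \<oplus>\<^bsub>RB\<^esub> b) = (\<lambda>N. rho G G a N + rho G G b N :: 'r)"
proof
  fix N
  obtain p where p: "keys p \<subseteq> pairs" "a = T.coset p" using assms(1) unfolding RB_simps(1) by (rule T.Q_cases)
  obtain q where q: "keys q \<subseteq> pairs" "b = T.coset q" using assms(2) unfolding RB_simps(1) by (rule T.Q_cases)
  have "a \<oplus>\<^bsub>RB\<^esub> b = T.coset (p + q)" using p q by (simp only: RB_simps(5) T.Q_mult)
  moreover have "(\<Sum>(r, x)\<in>keys (p + q). rint (lookup (p + q) (r, x)) * (r * rint (burnside_mark G N x)))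
    = (\<Sum>(r, x)\<in>keys p. rint (lookup p (r, x)) * (r * rint (burnside_mark G N x)))
    + (\<Sum>(r, x)\<in>keys q. rint (lookup q (r, x)) * (r * rint (burnside_mark G N x)) :: 'r)"
    using frag_weighted_sum_add[of "\<lambda>z k. rint k * (fst z * rint (burnside_mark G N (snd z)))" p q]
    by (simp add: rint_add distrib_right case_prod_unfold)
  ultimately show "rho G G (a \<oplus>\<^bsub>RB\<^esub> b) N = rho G G a N + rho G G b N"
    unfolding p(2) q(2) by (simp only: rho_coset) simp
qed

text \<open>
  The coefficient at \<open>U\<close> is a number of fixed points, which is the number of points whose stabilizer
  contains \<open>U\<close>. This is the factorization of the mark map through \<open>zeta\<close>.
\<close>

lemma rho_tens_bclass:
  assumes X: "is_biset G G X"
  shows "rho G G (tens r (bclass X)) = zeta GG (\<lambda>V. r * count_elt X V)"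
proof
  fix N
  show "rho G G (tens r (bclass X)) N = zeta GG (\<lambda>V. r * count_elt X V) N"
    by (simp add: rho_coset zeta_apply[OF GG_finite] burnside_mark_bclass[OF X subgroup.subset] rint_sum sum_distrib_left)
qed

lemma count_elt_conj_fixed:
  assumes X: "is_biset G G X"
  shows "(\<lambda>V. r * count_elt X V) \<in> conj_fixed GG"
proof -
  interpret X: finite_action "GG" "points X" "biset_act G X" by (rule biset_action[OF FG FG X])
  show ?thesis
    unfolding conj_fixed_iff[OF GG_group GG_finite]
    by (simp add: free_mod_def biset_count_def X.stab_count_not_subgroup X.stab_count_conj subgroup.subset del: carrier_DirProd)
qed

text \<open>
  The factor \<open>\<kappa>\<close> is the reciprocal of the number of pairs in a point of the tensor product, so the
  sum over pairs that defines \<open>star\<close> becomes a sum over points.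
\<close>

lemma star_count_elt:
  assumes X: "is_biset G G X" and Y: "is_biset G G Y"
  shows "star G G G (count_elt X) (count_elt Y) = count_elt (biset_tensor G X Y)"
proof
  fix N
  let ?S = "subgroups_of GG"
  have "rint (int (order G)) * count_elt (biset_tensor G X Y) N
     = (\<Sum>L\<in>?S. \<Sum>M\<in>?S. count_elt X L * count_elt Y M * (if L O M = N then rint (int (card (k2 G G L \<inter> k1 G G M))) else 0))"
    unfolding rint_mult[symmetric] of_nat_mult[symmetric] tensor_biset(2)[OF X Y]
    by (simp only: of_nat_sum rint_sum of_nat_mult rint_mult) (intro sum.cong refl, simp)
  then have "inv_order * (rint (int (order G)) * count_elt (biset_tensor G X Y) N) = star G G G (count_elt X) (count_elt Y) N"
    by (simp only: star_def bilin_ext_def sum_distrib_left kappa_def bas_def)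
      (intro sum.cong refl, simp add: ac_simps)
  then show "star G G G (count_elt X) (count_elt Y) N = count_elt (biset_tensor G X Y) N"
    using order_inv_order by (simp add: mult.assoc[symmetric] mult.commute)
qed

lemma rho_mult:
  assumes a: "a \<in> carrier RB" and b: "b \<in> carrier RB"
  shows "rho G G (a \<otimes>\<^bsub>RB\<^esub> b) = rho G G a \<otimes>\<^bsub>A\<^esub> rho G G b"
proof -
  interpret A: ring A by (rule ghost_ring)
  have carr: "rho G G c \<in> carrier A" if c: "c \<in> carrier RB" for c
  proof -
    obtain p where "c = T.coset p" using c unfolding RB_simps(1) by (rule T.Q_cases)
    then show ?thesis by (simp add: rho_coset ghost_simps free_mod_def)
  qed
  have add: "rho G G (c \<oplus>\<^bsub>RB\<^esub> d) = rho G G c \<oplus>\<^bsub>A\<^esub> rho G G d" if "c \<in> carrier RB" "d \<in> carrier RB" for c d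
    using rho_add[OF that] by (simp add: ghost_simps)
  show ?thesis using a
  proof (induction a rule: RB_induct)
    case (gen r X)
    note X = gen
    show ?case using b
    proof (induction b rule: RB_induct)
      case (gen s Y)
      have "rho G G (tens r (bclass X) \<otimes>\<^bsub>RB\<^esub> tens s (bclass Y))
        = zeta GG (\<lambda>V. (r * s) * star G G G (count_elt X) (count_elt Y) V)"
        by (simp only: RB_mult_tens bclass_in X gen burnside_mult_bclass rho_tens_bclass tensor_biset(1) star_count_elt)
      also have "(\<lambda>V. (r * s) * star G G G (count_elt X) (count_elt Y) V)
        = star G G G (\<lambda>V. r * count_elt X V) (\<lambda>V. s * count_elt Y V)"
        by (simp add: star_smult_left star_smult_right mult.assoc)
      finally show ?case by (simp only: rho_tens_bclass X gen ghost_mult_zeta)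
    next
      case (add c d)
      have t: "tens r (bclass X) \<in> carrier RB" by (simp only: RB_simps(1) tens_in bclass_in X)
      show ?case
        using add t carr by (simp only: RB_distrib \<open>\<And>c d. c \<in> carrier RB \<Longrightarrow> d \<in> carrier RB \<Longrightarrow> rho G G (c \<oplus>\<^bsub>RB\<^esub> d) = rho G G c \<oplus>\<^bsub>A\<^esub> rho G G d\<close> RB_mult_closed A.r_distr)
    qed
  next
    case (add c d)
    then show ?case
      using b carr by (simp only: RB_distrib \<open>\<And>c d. c \<in> carrier RB \<Longrightarrow> d \<in> carrier RB \<Longrightarrow> rho G G (c \<oplus>\<^bsub>RB\<^esub> d) = rho G G c \<oplus>\<^bsub>A\<^esub> rho G G d\<close> RB_mult_closed A.l_distr)
  qed
qed

lemma rho_smult: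
  assumes "a \<in> carrier RB"
  shows "rho G G (t \<odot>\<^bsub>RB\<^esub> a) = t \<odot>\<^bsub>A\<^esub> rho G G a"
  using assms
proof (induction a rule: RB_induct)
  case (gen r X)
  have "zeta GG (\<lambda>V. t * r * count_elt X V) = (\<lambda>N. t * zeta GG (\<lambda>V. r * count_elt X V) N)"
    by (simp only: mult.assoc zeta_smult)
  then show ?case by (simp only: RB_smult_tens rho_tens_bclass gen ghost_simps)
next
  case (add a b)
  then show ?case by (simp only: RB_smult_add rho_add ghost_simps distrib_left)
qed

lemma regular_biset: "is_biset G G (regular_biset G)"
  by (simp add: is_biset_def regular_biset_def finite_carrier m_assoc)

text \<open>
  The stabilizer of the point \<open>g\<close> is \<open>Delta G g\<close>. This explains the idempotent: \<open>e_tilde\<close> is the image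
  of the identity of the double Burnside algebra under the mark map.
\<close>

lemma count_regular: "count_elt (regular_biset G) = e_elt G"
proof
  fix V
  have st: "biset_stab G G (regular_biset G) g = Delta G g" if g: "g \<in> carrier G" for g
  proof -
    have "a \<otimes> (g \<otimes> inv b) = g \<longleftrightarrow> a = g \<otimes> b \<otimes> inv g" if "a \<in> carrier G" "b \<in> carrier G" for a b
      using that g by (metis inv_closed inv_inv inv_mult_group inv_solve_right' m_assoc m_closed)
    then show ?thesis using g by (auto simp: act_stab_def Delta_def biset_act_def regular_biset_def)
  qed
  have "{g \<in> carrier G. biset_stab G G (regular_biset G) g = V} = {g \<in> carrier G. V = Delta G g}"
    using st by auto
  then have "biset_count G G (regular_biset G) V = (\<Sum>g\<in>carrier G. if V = Delta G g then 1 else 0)"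
    using finite_carrier by (simp add: biset_count_def stab_count_def regular_biset_def sum.If_cases Int_def)
  then show "count_elt (regular_biset G) V = e_elt G V"
    by (simp only: of_nat_sum rint_sum e_elt_def bas_def) (intro sum.cong refl, simp)
qed

lemma rho_one: "rho G G \<one>\<^bsub>RB\<^esub> = e_tilde G"
  by (simp only: RB_simps(3) rho_tens_bclass[OF regular_biset] mult_1 count_regular e_tilde_def)

end


section \<open>The inverse of the mark homomorphism\<close>

context invertible_order
begin

abbreviation "cosets U \<equiv> bclass (coset_biset G G U)"

text \<open>
  The scalar \<open>|U| / |G|\<^sup>2\<close>, the reciprocal of the number of cosets of \<open>U\<close> in \<open>G \<times> G\<close>.
\<close>

definition inverse_weight :: "('g \<times> 'g) set \<Rightarrow> 'r" where
  "inverse_weight U = rint (int (card U)) * (inv_order * inv_order)"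

text \<open>
  For the stabilizer counts of a biset, this lets each point contribute the class of its orbit divided
  by the length of the orbit: the orbit of a point with stabilizer \<open>U\<close> is isomorphic to the biset of
  cosets of \<open>U\<close>.
\<close>

definition theta :: "(('g \<times> 'g) set \<Rightarrow> 'r) \<Rightarrow> ('r, 'g, 'g) rburnside_elt" where
  "theta c = (\<Otimes>\<^bsub>T.Q\<^esub>U\<in>subgroups_of GG. tens (c U * inverse_weight U) (cosets U))"

lemma finite_S: "finite (subgroups_of GG)"
  by (rule finite_subgroups_of[OF GG_finite])

lemma coset_is_biset: "U \<in> subgroups_of GG \<Longrightarrow> is_biset G G (coset_biset G G U)"
  by (simp add: coset_biset(1)[OF FG FG])

lemma theta_factor: "U \<in> subgroups_of GG \<Longrightarrow> tens r (cosets U) \<in> carrier T.Q"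
  by (intro tens_in bclass_in coset_is_biset)

lemma theta_in: "theta c \<in> carrier RB"
proof -
  interpret TQ: comm_group T.Q by (rule T.Q_comm_group)
  show ?thesis unfolding theta_def RB_simps(1) by (rule TQ.finprod_closed) (rule funcsetI, rule theta_factor)
qed

lemma theta_add: "theta (\<lambda>U. c U + d U) = theta c \<oplus>\<^bsub>RB\<^esub> theta d"
proof -
  interpret TQ: comm_group T.Q by (rule T.Q_comm_group)
  have factor: "tens ((c U + d U) * inverse_weight U) (cosets U)
      = tens (c U * inverse_weight U) (cosets U) \<otimes>\<^bsub>T.Q\<^esub> tens (d U * inverse_weight U) (cosets U)"
    if "U \<in> subgroups_of GG" for U
    unfolding distrib_right by (rule tens_add_scalar) (rule bclass_in[OF coset_is_biset[OF that]])
  have "theta (\<lambda>U. c U + d U) = (\<Otimes>\<^bsub>T.Q\<^esub>U\<in>subgroups_of GG.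
      tens (c U * inverse_weight U) (cosets U) \<otimes>\<^bsub>T.Q\<^esub> tens (d U * inverse_weight U) (cosets U))"
    unfolding theta_def
    by (rule TQ.finprod_cong'[OF refl _ factor]) (rule funcsetI, intro TQ.m_closed theta_factor)
  also have "\<dots> = theta c \<otimes>\<^bsub>T.Q\<^esub> theta d" unfolding theta_def
    by (intro TQ.finprod_multf funcsetI theta_factor)
  finally show ?thesis by (simp only: RB_simps(5))
qed

lemma tens_sum:
  assumes x: "x \<in> carrier B.Q" and "finite I"
  shows "tens (\<Sum>i\<in>I. r i) x = (\<Otimes>\<^bsub>T.Q\<^esub>i\<in>I. tens (r i) x)"
  using assms(2)
proof (induction I rule: finite_induct)
  case empty
  interpret TQ: comm_group T.Q by (rule T.Q_comm_group)
  show ?case by (simp only: sum.empty TQ.finprod_empty tens_zero[OF x])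
next
  case (insert i I)
  interpret TQ: comm_group T.Q by (rule T.Q_comm_group)
  have "(\<Otimes>\<^bsub>T.Q\<^esub>i\<in>insert i I. tens (r i) x) = tens (r i) x \<otimes>\<^bsub>T.Q\<^esub> (\<Otimes>\<^bsub>T.Q\<^esub>i\<in>I. tens (r i) x)"
    by (rule TQ.finprod_insert[OF insert.hyps]) (intro funcsetI tens_in[OF x])+
  then show ?case unfolding sum.insert[OF insert.hyps] tens_add_scalar[OF x] insert.IH by (rule sym)
qed

lemma inv_order_sq: "rint (int (order GG)) * (inv_order * inv_order) = (1 :: 'r)"
proof -
  have "order GG = order G * order G" by (simp add: order_def DirProd_def card_cartesian_product)
  then have "rint (int (order GG)) * (inv_order * inv_order)
    = (rint (int (order G)) * inv_order) * (rint (int (order G)) * inv_order)"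
    by (simp only: of_nat_mult rint_mult) (simp only: ac_simps)
  then show ?thesis by (simp only: order_inv_order mult_1)
qed

text \<open>
  All transitive bisets that occur with a nonzero coefficient are isomorphic to the orbit \<open>Z\<close>, so their
  scalars can be added up. The total is \<open>r\<close> because the orders of the stabilizers of the points of \<open>Z\<close>
  add up to the order of \<open>G \<times> G\<close>.
\<close>

lemma tens_transitive_eq_theta:
  assumes X: "is_biset G G X" and x: "x \<in> points X"
    and Z: "Z = X\<lparr>points := act_orbit GG (biset_act G X) x\<rparr>"
  shows "tens r (bclass Z) = theta (\<lambda>V. r * count_elt Z V)"
proof -
  interpret X: finite_action "GG" "points X" "biset_act G X" by (rule biset_action[OF FG FG X])
  interpret TQ: comm_group T.Q by (rule T.Q_comm_group)
  have Zb: "is_biset G G Z" unfolding Z by (rule sub_biset[OF FG FG X X.orbit_action[OF x] X.orb_subset[OF x]])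
  have act: "biset_act G Z = biset_act G X" by (simp add: Z biset_act_def)
  have factor: "tens (r * count_elt Z V * inverse_weight V) (cosets V)
      = tens (r * count_elt Z V * inverse_weight V) (bclass Z)" if V: "V \<in> subgroups_of GG" for V
  proof (cases "biset_count G G Z V = 0")
    case True
    then show ?thesis
      using tens_zero[OF bclass_in[OF Zb]] tens_zero[OF bclass_in[OF coset_is_biset[OF V]]]
      by (simp only: of_nat_0 rint_0 mult_zero_left mult_zero_right)
  next
    case False
    then have "card {y \<in> X.orb x. X.stab y = V} \<noteq> 0"
      unfolding biset_count_def stab_count_def act by (simp add: Z)
    then have "{y \<in> X.orb x. X.stab y = V} \<noteq> {}" by (intro notI) (simp only: card.empty)
    then obtain y where y: "y \<in> X.orb x" "X.stab y = V" by blast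
    have "Z = X\<lparr>points := X.orb y\<rparr>" unfolding Z X.orb_eq[OF x y(1)] ..
    then have "biset_count G G Z = biset_count G G (coset_biset G G V)"
      using coset_biset(3)[OF FG FG _ X subsetD[OF X.orb_subset[OF x] y(1)] y(2)] V
      by (simp only: subgroups_of_iff)
    then have "bclass Z = cosets V" by (rule bclass_cong[OF Zb coset_is_biset[OF V]])
    then show ?thesis by (simp only:)
  qed
  have "(\<Sum>V\<in>subgroups_of GG. biset_count G G Z V * card V) = (\<Sum>y\<in>points Z. card (biset_stab G G Z y))"
    by (rule sum_over_stabilizers[OF FG FG Zb, symmetric])
  also have "\<dots> = order GG"
    unfolding act using X.sum_orbit_card_stab[OF x] by (simp add: Z)
  finally have total: "(\<Sum>V\<in>subgroups_of GG. biset_count G G Z V * card V) = order GG" .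
  have "(\<Sum>V\<in>subgroups_of GG. r * count_elt Z V * inverse_weight V)
    = r * (rint (int (\<Sum>V\<in>subgroups_of GG. biset_count G G Z V * card V)) * (inv_order * inv_order))"
    by (simp only: rint_sum_nat of_nat_mult rint_mult sum_distrib_left sum_distrib_right inverse_weight_def mult.assoc)
  also have "\<dots> = r" by (simp only: total inv_order_sq mult_1_right)
  finally have r: "(\<Sum>V\<in>subgroups_of GG. r * count_elt Z V * inverse_weight V) = r" .
  have "theta (\<lambda>V. r * count_elt Z V)
    = (\<Otimes>\<^bsub>T.Q\<^esub>V\<in>subgroups_of GG. tens (r * count_elt Z V * inverse_weight V) (bclass Z))"
    unfolding theta_def
    by (rule TQ.finprod_cong'[OF refl _ factor]) (rule funcsetI, rule tens_in[OF bclass_in[OF Zb]])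
  also have "\<dots> = tens r (bclass Z)"
    by (simp only: tens_sum[OF bclass_in[OF Zb] finite_S, symmetric] r)
  finally show ?thesis ..
qed

text \<open>
  Both sides are additive under disjoint unions; split off one orbit at a time.
\<close>

lemma tens_eq_theta:
  assumes "is_biset G G X"
  shows "tens r (bclass X) = theta (\<lambda>V. r * count_elt X V)"
  using assms
proof (induction "card (points X)" arbitrary: X rule: less_induct)
  case less
  note X = less.prems
  interpret X: finite_action "GG" "points X" "biset_act G X" by (rule biset_action[OF FG FG X])
  interpret TQ: comm_group T.Q by (rule T.Q_comm_group)
  interpret BQ: comm_group B.Q by (rule B.Q_comm_group)
  show ?case
  proof (cases "points X = {}")
    case True
    then have c: "biset_count G G X V = 0" for V by (simp add: biset_count_def stab_count_def)
    \<comment> \<open>The empty biset is isomorphic to the disjoint union of two copies of itself.\<close>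
    have "bclass X = bclass X \<otimes>\<^bsub>B.Q\<^esub> bclass X" by (rule bclass_sum[OF X X X]) (simp add: c)
    then have "bclass X = \<one>\<^bsub>B.Q\<^esub>" using bclass_in[OF X] by (metis BQ.r_cancel_one')
    then have "tens r (bclass X) = \<one>\<^bsub>T.Q\<^esub>" by (simp only: group_hom.hom_one[OF tens_hom])
    moreover have "theta (\<lambda>V. r * count_elt X V) = (\<Otimes>\<^bsub>T.Q\<^esub>U\<in>subgroups_of GG. \<one>\<^bsub>T.Q\<^esub>)"
      unfolding theta_def
    proof (rule TQ.finprod_cong'[OF refl])
      show "tens (r * count_elt X U * inverse_weight U) (cosets U) = \<one>\<^bsub>T.Q\<^esub>" if "U \<in> subgroups_of GG" for U
        using tens_zero[OF bclass_in[OF coset_is_biset[OF that]]] by (simp only: c of_nat_0 rint_0 mult_zero_left mult_zero_right)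
    qed (rule funcsetI, rule TQ.one_closed)
    ultimately show ?thesis by (simp only: TQ.finprod_one)
  next
    case False
    then obtain x where x: "x \<in> points X" by auto
    let ?O = "X.orb x"
    let ?Z = "X\<lparr>points := ?O\<rparr>" and ?W = "X\<lparr>points := points X - ?O\<rparr>"
    have Z: "is_biset G G ?Z" by (rule sub_biset[OF FG FG X X.orbit_action[OF x] X.orb_subset[OF x]])
    have W: "is_biset G G ?W" by (rule sub_biset[OF FG FG X X.orbit_complement_action[OF x]]) simp
    have act: "biset_act G ?Z = biset_act G X" "biset_act G ?W = biset_act G X" by (simp_all add: biset_act_def)
    have count: "biset_count G G X V = biset_count G G ?Z V + biset_count G G ?W V" for V
      using X.stab_count_split[OF X.orb_subset[OF x], of V] by (simp only: biset_count_def act) simp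
    have "card (points ?W) < card (points X)"
      using X.orb_self[OF x] x X.finite_points by (simp, intro psubset_card_mono) auto
    then have IH: "tens r (bclass ?W) = theta (\<lambda>V. r * count_elt ?W V)" using W by (rule less.hyps)
    have "tens r (bclass X) = tens r (bclass ?Z) \<oplus>\<^bsub>RB\<^esub> tens r (bclass ?W)"
      unfolding bclass_sum[OF Z W X count] RB_simps(5) by (rule tens_add[OF bclass_in[OF Z] bclass_in[OF W]])
    also have "\<dots> = theta (\<lambda>V. r * count_elt X V)"
      unfolding IH tens_transitive_eq_theta[OF X x refl] theta_add[symmetric]
      by (simp only: count of_nat_add rint_add distrib_left)
    finally show ?thesis .
  qed
qed

text \<open>
  An element can be recovered from its image under \<open>rho\<close>: undo \<open>zeta\<close> and apply \<open>theta\<close>.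
\<close>

lemma rho_eq_zeta_of_theta:
  assumes "a \<in> carrier RB"
  shows "\<exists>c\<in>conj_fixed GG. rho G G a = zeta GG c \<and> a = theta c"
  using assms
proof (induction a rule: RB_induct)
  case (gen r X)
  show ?case
    by (rule bexI[OF _ count_elt_conj_fixed[OF gen, of r]]) (intro conjI rho_tens_bclass[OF gen] tens_eq_theta[OF gen])
next
  case (add a b)
  then obtain c d where c: "c \<in> conj_fixed GG" "rho G G a = zeta GG c" "a = theta c"
    and d: "d \<in> conj_fixed GG" "rho G G b = zeta GG d" "b = theta d" by blast
  have "rho G G (a \<oplus>\<^bsub>RB\<^esub> b) = zeta GG (\<lambda>N. c N + d N)"
    by (simp only: rho_add[OF add.hyps] c(2) d(2) zeta_add)
  moreover have "a \<oplus>\<^bsub>RB\<^esub> b = theta (\<lambda>N. c N + d N)" by (simp only: c(3) d(3) theta_add)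
  ultimately show ?case using conj_fixed_add_closed[OF c(1) d(1)] by blast
qed

lemma rho_finprod:
  assumes "finite I" "\<And>i. i \<in> I \<Longrightarrow> f i \<in> carrier RB"
    and "\<And>i. i \<in> I \<Longrightarrow> rho G G (f i) = zeta GG (g i)"
  shows "rho G G (\<Otimes>\<^bsub>T.Q\<^esub>i\<in>I. f i) = zeta GG (\<lambda>N. \<Sum>i\<in>I. g i N)"
proof -
  interpret TQ: comm_group T.Q by (rule T.Q_comm_group)
  show ?thesis using assms
  proof (induction I rule: finite_induct)
    case empty
    have "rho G G \<one>\<^bsub>T.Q\<^esub> = (\<lambda>N. 0 :: 'r)" by (simp only: T.Q_one rho_coset) auto
    moreover have "zeta GG (\<lambda>N. 0 :: 'r) = (\<lambda>N. 0)" by (simp add: zeta_def lin_ext_def)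
    ultimately show ?case by (simp only: TQ.finprod_empty sum.empty)
  next
    case (insert i I)
    have fc: "\<And>i. i \<in> I \<Longrightarrow> f i \<in> carrier T.Q" "f i \<in> carrier T.Q" using insert.prems(1) by (simp_all only: RB_simps(1) insert_iff simp_thms)
    have "(\<Otimes>\<^bsub>T.Q\<^esub>i\<in>insert i I. f i) = f i \<oplus>\<^bsub>RB\<^esub> (\<Otimes>\<^bsub>T.Q\<^esub>i\<in>I. f i)"
      unfolding RB_simps(5) by (rule TQ.finprod_insert[OF insert.hyps]) (use fc in blast)+
    moreover have "(\<Otimes>\<^bsub>T.Q\<^esub>i\<in>I. f i) \<in> carrier RB"
      unfolding RB_simps(1) by (rule TQ.finprod_closed) (use fc in blast)
    moreover have "rho G G (\<Otimes>\<^bsub>T.Q\<^esub>i\<in>I. f i) = zeta GG (\<lambda>N. \<Sum>i\<in>I. g i N)"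
      using insert.IH insert.prems by blast
    moreover have "rho G G (f i) = zeta GG (g i)" "f i \<in> carrier RB" using insert.prems by blast+
    ultimately have "rho G G (\<Otimes>\<^bsub>T.Q\<^esub>i\<in>insert i I. f i) = zeta GG (\<lambda>N. g i N + (\<Sum>i\<in>I. g i N))"
      by (simp only: rho_add zeta_add)
    then show ?case by (simp only: sum.insert[OF insert.hyps])
  qed
qed

text \<open>
  The points of the cosets of \<open>U\<close> have the conjugates of \<open>U\<close> as stabilizers. As \<open>c\<close> is constant on
  conjugates, the coefficient at \<open>V\<close> is \<open>c V / |G|\<^sup>2\<close> times the number of all \<open>(p, U)\<close> such that \<open>p\<close>
  conjugates \<open>U\<close> to \<open>V\<close>; there is exactly one such \<open>U\<close> for each \<open>p\<close>.
\<close>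

lemma rho_theta:
  assumes c: "c \<in> conj_fixed GG"
  shows "rho G G (theta c) = zeta GG c"
proof -
  let ?S = "subgroups_of GG" and ?P = "carrier GG"
  interpret D: group "GG" by (rule GG_group)
  have c': "c \<in> free_mod GG" "\<And>p N. p \<in> ?P \<Longrightarrow> subgroup N GG \<Longrightarrow> c (conj_set GG p N) = c N"
    using c conj_fixed_iff[OF GG_group GG_finite] by blast+
  let ?n = "\<lambda>U V. card {p \<in> ?P. conj_set GG p U = V}"
  have summand: "c U * inverse_weight U * count_elt (coset_biset G G U) V = rint (int (?n U V)) * (c V * (inv_order * inv_order))"
    if U: "subgroup U GG" and V: "subgroup V GG" for U V
  proof (cases "?n U V = 0")
    case True
    have "card V > 0" using V subgroup.one_closed[OF V] finite_subset[OF subgroup.subset[OF V] GG_finite]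
      by (auto simp: card_gt_0_iff simp del: one_DirProd)
    then have "biset_count G G (coset_biset G G U) V = 0" using coset_biset(2)[OF FG FG U, of V] True by simp
    then show ?thesis by (simp only: True of_nat_0 rint_0 mult_zero_left mult_zero_right)
  next
    case False
    then have "{p \<in> ?P. conj_set GG p U = V} \<noteq> {}" by (metis card.empty)
    then obtain p where p: "p \<in> ?P" "conj_set GG p U = V" by blast
    have "card U = card V" using card_conj_set[OF GG_group p(1) subgroup.subset[OF U]] p(2) by simp
    then have "card U * biset_count G G (coset_biset G G U) V = ?n U V" using coset_biset(2)[OF FG FG U, of V] by (simp only:)
    then have count: "rint (int (card U)) * count_elt (coset_biset G G U) V = rint (int (?n U V))"
      by (simp only: rint_mult[symmetric] of_nat_mult[symmetric])
    have "c U = c V" using c'(2)[OF p(1) U] p(2) by simp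
    then show ?thesis unfolding inverse_weight_def count[symmetric] by (simp only: ac_simps)
  qed
  have count_all: "(\<Sum>U\<in>?S. ?n U V) = order GG" if V: "subgroup V GG" for V
  proof -
    have iff: "conj_set GG p U = V \<longleftrightarrow> U = conj_set GG (inv\<^bsub>GG\<^esub> p) V"
      if "p \<in> ?P" "U \<in> ?S" for p U
      using that V conj_set_inv[OF GG_group that(1)] by (metis subgroup.subset subgroups_of_iff)
    have "(\<Sum>U\<in>?S. ?n U V) = (\<Sum>U\<in>?S. \<Sum>p\<in>?P. if conj_set GG p U = V then 1 else 0)"
      using GG_finite by (simp add: sum.If_cases Int_def del: carrier_DirProd)
    also have "\<dots> = (\<Sum>p\<in>?P. \<Sum>U\<in>?S. if conj_set GG p U = V then 1 else 0)" by (rule sum.swap)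
    also have "\<dots> = (\<Sum>p\<in>?P. \<Sum>U\<in>?S. if U = conj_set GG (inv\<^bsub>GG\<^esub> p) V then 1 else 0)"
      by (intro sum.cong refl) (simp only: iff)
    also have "\<dots> = (\<Sum>p\<in>?P. 1)"
      unfolding sum.delta[OF finite_S]
      by (intro sum.cong refl) (simp only: subgroups_of_iff conj_set_subgroup[OF GG_group D.inv_closed V] if_True)
    finally show ?thesis by (simp add: order_def)
  qed
  have "rho G G (theta c) = zeta GG (\<lambda>V. \<Sum>U\<in>?S. c U * inverse_weight U * count_elt (coset_biset G G U) V)"
    unfolding theta_def
    by (rule rho_finprod[OF finite_S]) (simp_all only: RB_simps(1) theta_factor rho_tens_bclass coset_is_biset)
  also have "(\<lambda>V. \<Sum>U\<in>?S. c U * inverse_weight U * count_elt (coset_biset G G U) V) = c"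
  proof
    fix V
    show "(\<Sum>U\<in>?S. c U * inverse_weight U * count_elt (coset_biset G G U) V) = c V"
    proof (cases "subgroup V GG")
      case True
      have "(\<Sum>U\<in>?S. c U * inverse_weight U * count_elt (coset_biset G G U) V)
        = (\<Sum>U\<in>?S. rint (int (?n U V)) * (c V * (inv_order * inv_order)))"
        by (intro sum.cong refl) (simp only: summand True subgroups_of_iff)
      also have "\<dots> = rint (int (order GG)) * (c V * (inv_order * inv_order))"
        by (simp only: sum_distrib_right[symmetric] rint_sum_nat[symmetric] count_all[OF True])
      also have "\<dots> = c V * (rint (int (order GG)) * (inv_order * inv_order))"
        by (rule mult.left_commute)
      also have "\<dots> = c V" by (simp only: inv_order_sq mult_1_right)
      finally show ?thesis .
    next
      case False
      have "biset_count G G (coset_biset G G U) V = 0" if "U \<in> ?S" for U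
        unfolding biset_count_def
        by (rule finite_action.stab_count_not_subgroup[OF biset_action[OF FG FG coset_is_biset[OF that]] False])
      then have "(\<Sum>U\<in>?S. c U * inverse_weight U * count_elt (coset_biset G G U) V) = 0"
        by (intro sum.neutral ballI) (simp only: of_nat_0 rint_0 mult_zero_right)
      then show ?thesis using free_mod_zero[OF c'(1) False] by (simp only:)
    qed
  qed
  finally show ?thesis .
qed

lemma rho_bij: "bij_betw (rho G G) (carrier RB) (conj_fixed GG :: (('g \<times> 'g) set \<Rightarrow> 'r) set)"
proof (rule bij_betw_imageI)
  show "inj_on (rho G G) (carrier RB)"
  proof (rule inj_onI)
    fix a b assume a: "a \<in> carrier RB" and b: "b \<in> carrier RB" and eq: "rho G G a = (rho G G b :: _ \<Rightarrow> 'r)"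
    obtain c where c: "c \<in> conj_fixed GG" "rho G G a = zeta GG c" "a = theta c"
      using rho_eq_zeta_of_theta[OF a] by blast
    obtain d where d: "d \<in> conj_fixed GG" "rho G G b = zeta GG d" "b = theta d"
      using rho_eq_zeta_of_theta[OF b] by blast
    have "c \<in> free_mod GG" "d \<in> free_mod GG" using c(1) d(1) by (simp_all only: conj_fixed_def mem_Collect_eq)
    then have "c = d" by (rule zeta_inj[OF GG_finite]) (use eq c(2) d(2) in \<open>simp only:\<close>)
    then show "a = b" by (simp only: c(3) d(3))
  qed
  show "rho G G ` carrier RB = (conj_fixed GG :: (('g \<times> 'g) set \<Rightarrow> 'r) set)"
  proof (intro equalityI subsetI)
    fix x :: "('g \<times> 'g) set \<Rightarrow> 'r" assume "x \<in> rho G G ` carrier RB"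
    then obtain a where a: "a \<in> carrier RB" "x = rho G G a" by blast
    from rho_eq_zeta_of_theta[OF a(1)] obtain c where c: "c \<in> conj_fixed GG" "x = zeta GG c"
      using a(2) by blast
    have "c \<in> free_mod GG" using c(1) by (simp only: conj_fixed_def mem_Collect_eq)
    then show "x \<in> conj_fixed GG" using zeta_conj_fixed_iff[OF GG_group GG_finite] c by blast
  next
    fix x :: "('g \<times> 'g) set \<Rightarrow> 'r" assume "x \<in> conj_fixed GG"
    then obtain c :: "('g \<times> 'g) set \<Rightarrow> 'r" where "c \<in> conj_fixed GG" "x = zeta GG c"
      by (rule conj_fixed_zeta_cases)
    then have "x = rho G G (theta c)" by (simp only: rho_theta)
    then show "x \<in> rho G G ` carrier RB" using theta_in by blast
  qed
qed

lemma rho_in: "a \<in> carrier RB \<Longrightarrow> (rho G G a :: _ \<Rightarrow> 'r) \<in> conj_fixed GG"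
  using rho_bij by (auto simp: bij_betw_def)

lemma rho_in_ghost: "a \<in> carrier RB \<Longrightarrow> rho G G a \<in> carrier A"
  using rho_in[of a] by (simp only: conj_fixed_def mem_Collect_eq ghost_simps)

lemma rho_eq_iff: "a \<in> carrier RB \<Longrightarrow> b \<in> carrier RB \<Longrightarrow> (rho G G a :: _ \<Rightarrow> 'r) = rho G G b \<Longrightarrow> a = b"
  using bij_betw_imp_inj_on[OF rho_bij] by (rule inj_onD)

text \<open>
  Associativity and the unit laws hold for the images in the ghost ring, and \<open>rho\<close> is injective and
  multiplicative.
\<close>

lemma RB_ring: "ring RB"
proof (rule ringI)
  interpret A: ring A by (rule ghost_ring)
  show "abelian_group RB" by (rule RB_abelian_group)
  show "Group.monoid RB"
  proof (rule monoidI)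
    show one: "\<one>\<^bsub>RB\<^esub> \<in> carrier RB"
      unfolding RB_simps(1,3) by (rule tens_in[OF bclass_in[OF regular_biset]])
    fix a b c assume a: "a \<in> carrier RB" and b: "b \<in> carrier RB"
    show "a \<otimes>\<^bsub>RB\<^esub> b \<in> carrier RB" by (rule RB_mult_closed[OF a b])
    show "\<one>\<^bsub>RB\<^esub> \<otimes>\<^bsub>RB\<^esub> a = a"
      by (rule rho_eq_iff[OF RB_mult_closed[OF one a] a])
        (simp only: rho_mult[OF one a] rho_one conj_fixed_e_tilde[OF rho_in[OF a]])
    show "a \<otimes>\<^bsub>RB\<^esub> \<one>\<^bsub>RB\<^esub> = a"
      by (rule rho_eq_iff[OF RB_mult_closed[OF a one] a])
        (simp only: rho_mult[OF a one] rho_one conj_fixed_e_tilde[OF rho_in[OF a]])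
    assume c: "c \<in> carrier RB"
    show "a \<otimes>\<^bsub>RB\<^esub> b \<otimes>\<^bsub>RB\<^esub> c = a \<otimes>\<^bsub>RB\<^esub> (b \<otimes>\<^bsub>RB\<^esub> c)"
      using a b c by (intro rho_eq_iff) (simp_all only: RB_mult_closed rho_mult A.m_assoc rho_in_ghost)
  qed
qed (simp_all only: RB_distrib)

lemma rho_ring_iso:
  "rho G G \<in> ring_iso RB (A\<lparr>carrier := conj_fixed GG, one := e_tilde G\<rparr>)"
proof -
  have "rho G G \<in> ring_hom RB (A\<lparr>carrier := conj_fixed GG, one := e_tilde G\<rparr>)"
  proof (rule ring_hom_memI)
    fix a b assume a: "a \<in> carrier RB" and b: "b \<in> carrier RB"
    show "rho G G a \<in> carrier (A\<lparr>carrier := conj_fixed GG, one := e_tilde G\<rparr>)"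
      using rho_in[OF a] by simp
    show "rho G G (a \<otimes>\<^bsub>RB\<^esub> b)
      = rho G G a \<otimes>\<^bsub>A\<lparr>carrier := conj_fixed GG, one := e_tilde G\<rparr>\<^esub> rho G G b"
      using rho_mult[OF a b] by simp
    show "rho G G (a \<oplus>\<^bsub>RB\<^esub> b)
      = rho G G a \<oplus>\<^bsub>A\<lparr>carrier := conj_fixed GG, one := e_tilde G\<rparr>\<^esub> rho G G b"
      using rho_add[OF a b] by (simp add: ghost_simps)
  next
    show "rho G G \<one>\<^bsub>RB\<^esub> = \<one>\<^bsub>A\<lparr>carrier := conj_fixed GG, one := e_tilde G\<rparr>\<^esub>"
      using rho_one by simp
  qed
  then show ?thesis using rho_bij by (simp add: ring_iso_def)
qed

end

theorem proposition3p9: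
  fixes G :: "'g monoid" and H :: "'h monoid" and K :: "'k monoid"
  assumes "group G" and "group H" and "group K"
    and "finite (carrier G)" and "finite (carrier H)" and "finite (carrier K)"
    and "invertible_in_ring (rint (int (order H)) :: 'r::{comm_ring,comm_monoid_mult})"
  shows
    "(\<forall>a\<in>free_mod (G \<times>\<times> H). \<forall>b\<in>free_mod (H \<times>\<times> K).
        zeta (G \<times>\<times> K) (star G H K a b :: ('g \<times> 'k) set \<Rightarrow> 'r) =
        tstar G H K (zeta (G \<times>\<times> H) a) (zeta (H \<times>\<times> K) b)) \<and>
     (invertible_in_ring (rint (int (order G)) :: 'r) \<longrightarrow>
       (let A = (ghost_algebra G :: ('r, ('g \<times> 'g) set \<Rightarrow> 'r) module);
            RB = (double_burnside_algebra G :: ('r, ('r, 'g, 'g) rburnside_elt) module);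
            e = e_tilde G;
            F = conj_fixed (G \<times>\<times> G)
        in ring A \<and> ring RB \<and>
           e \<in> carrier A \<and> e \<otimes>\<^bsub>A\<^esub> e = e \<and>
           F = {e \<otimes>\<^bsub>A\<^esub> a \<otimes>\<^bsub>A\<^esub> e | a. a \<in> carrier A} \<and>
           nonunital_subring F A \<and>
           rho G G \<in> ring_iso RB (A\<lparr>carrier := F, one := e\<rparr>) \<and>
           (\<forall>r. \<forall>x\<in>carrier RB. rho G G (r \<odot>\<^bsub>RB\<^esub> x) = r \<odot>\<^bsub>A\<^esub> rho G G x)))"
proof (intro conjI ballI impI, goal_cases)
  case (1 a b)
  show ?case by (rule zeta_star) fact+
next
  case 2
  interpret invertible_order G "TYPE('r)"
    by (intro invertible_order.intro finite_group.intro finite_group_axioms.intro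
        invertible_order_axioms.intro assms(1,4) 2)
  show ?case
    unfolding Let_def
    by (intro conjI allI ballI ghost_ring RB_ring e_tilde_ghost e_tilde_idempotent conj_fixed_eq_corner
        conj_fixed_subring rho_ring_iso rho_smult)
qed

end
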